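(* Let $\mathcal{F}_t$ be a smooth $1$-parameter family of smooth transversely oriented codimension one foliations on a smooth manifold $M$, with smooth families of defining $1$-forms $\alpha=\alpha(t)$ and of $1$-forms $\beta=\beta(t)$ satisfying $d\alpha=\alpha\wedge\beta$. Then for every $t$, the $3$-form $(\dot\beta\wedge d\beta)(t)$ is in $\mathcal{I}(\mathcal{F}_t)$. It is closed, and its cohomology class $T(\mathcal{F}_t)\in H^3(\mathcal{I}(\mathcal{F}_t))$ is independent of the choices of $\alpha$ and $\beta$. Its image in the de Rham cohomology $H^3(M,\mathbb{R})$ is $\frac{1}{2}\frac{d}{dt}GV(\mathcal{F}_t)$. The product of $T(\mathcal{F}_t)$ with the Reeb class $[\beta]\in H^1(\mathcal{F}_t)$ under the pairing $H^3(\mathcal{I}(\mathcal{F}_t))\times H^1(\mathcal{F}_t)\to H^4(\mathcal{I}(\mathcal{F}_t))$ is a class in $H^4(\mathcal{I}(\mathcal{F}_t))$ whose image in the de Rham cohomology $H^4(M,\mathbb{R})$ equals $TGV(\mathcal{F}_t)$ up to sign.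
   Context: All manifolds, foliations, forms and families are of class $C^\infty$; a dot denotes the derivative with respect to $t$ and $d$ the exterior derivative on $M$. A defining form of a transversely oriented codimension one foliation $\mathcal{F}$ is a nowhere vanishing $1$-form $\alpha$ with $\ker\alpha=T\mathcal{F}$, positive on positively oriented transversals; there is then a $1$-form $\beta$ with $d\alpha=\alpha\wedge\beta$. $\mathcal{I}(\mathcal{F})\subset\Omega^*(M)$ is the graded differential ideal of forms vanishing on $T\mathcal{F}$ (i.e. on all tuples of vectors tangent to $\mathcal{F}$), and $H^*(\mathcal{I}(\mathcal{F}))$ is its cohomology under $d$. $H^*(\mathcal{F})$ is the cohomology of the quotient complex $\Omega^*(\mathcal{F})=\Omega^*(M)/\mathcal{I}(\mathcal{F})$ with the induced differential. Since the product of any two forms in $\mathcal{I}(\mathcal{F})$ vanishes, the wedge product induces bilinear maps $H^i(\mathcal{I}(\mathcal{F}))\times H^j(\mathcal{F})\to H^{i+j}(\mathcal{I}(\mathcal{F}))$. The form $d\beta$ lies in $\mathcal{I}(\mathcal{F})$, so $\beta$ defines a class $[\beta]\in H^1(\mathcal{F})$, the Reeb class of $\mathcal{F}$, which is independent of the choices of $\alpha,\beta$. $GV(\mathcal{F})=[\beta\wedge d\beta]\in H^3(M,\mathbb{R})$ is the classical Godbillon-Vey invariant, and for a family, $TGV(\mathcal{F}_t)=[(\dot\beta\wedge\beta\wedge d\beta)(t)]\in H^4(M,\mathbb{R})$; both are well defined independently of the choices of $\alpha$ and $\beta$. *)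

theory Defs
  imports
    "HOL-Analysis.Analysis"
    "HOL-Algebra.Coset"
    "HOL-Combinatorics.Permutations"
    "HOL-Library.Function_Algebras"
begin

section \<open>Smooth maps between normed spaces\<close>

primrec Ck_on :: "nat \<Rightarrow> 'a::real_normed_vector set \<Rightarrow> ('a \<Rightarrow> 'b::real_normed_vector) \<Rightarrow> bool" where
  "Ck_on 0 S f \<longleftrightarrow> continuous_on S f"
| "Ck_on (Suc k) S f \<longleftrightarrow>
     (\<forall>x\<in>S. f differentiable (at x)) \<and> (\<forall>v. Ck_on k S (\<lambda>x. frechet_derivative f (at x) v))"

text \<open>Only used for open \<open>S\<close> in finite-dimensional spaces, where it is the usual notion of
  a \<open>C\<^sup>\<infinity>\<close> map.\<close>

definition smooth_on :: "'a::real_normed_vector set \<Rightarrow> ('a \<Rightarrow> 'b::real_normed_vector) \<Rightarrow> bool" where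
  "smooth_on S f \<longleftrightarrow> (\<forall>k. Ck_on k S f)"


section \<open>Smooth manifolds\<close>

text \<open>A manifold is a Hausdorff, second countable topological type \<open>'m\<close> together with a smooth
  atlas modelled on a Euclidean space \<open>'e\<close>; a chart is a pair of its domain and its coordinate map.
  The values of the coordinate map outside the domain are irrelevant.\<close>

type_synonym ('m, 'e) chart = "'m set \<times> ('m \<Rightarrow> 'e)"
type_synonym ('m, 'e) atlas = "('m, 'e) chart set"

definition dom_chart :: "('m, 'e) chart \<Rightarrow> 'm set" where
  "dom_chart c = fst c"

definition coord :: "('m, 'e) chart \<Rightarrow> 'm \<Rightarrow> 'e" where
  "coord c = snd c"

definition im_chart :: "('m, 'e) chart \<Rightarrow> 'e set" where
  "im_chart c = coord c ` dom_chart c"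

definition inv_chart :: "('m, 'e) chart \<Rightarrow> 'e \<Rightarrow> 'm" where
  "inv_chart c = inv_into (dom_chart c) (coord c)"

definition transition :: "('m, 'e) chart \<Rightarrow> ('m, 'e) chart \<Rightarrow> 'e \<Rightarrow> 'e" where
  "transition c c' = coord c' \<circ> inv_chart c"

definition smooth_atlas ::
    "('m::{t2_space,second_countable_topology}, 'e::euclidean_space) atlas \<Rightarrow> bool" where
  "smooth_atlas A \<longleftrightarrow>
     (\<forall>c\<in>A. open (dom_chart c) \<and> open (im_chart c) \<and>
        homeomorphism (dom_chart c) (im_chart c) (coord c) (inv_chart c)) \<and>
     (\<Union>c\<in>A. dom_chart c) = UNIV \<and>
     (\<forall>c\<in>A. \<forall>c'\<in>A. smooth_on (coord c ` (dom_chart c \<inter> dom_chart c')) (transition c c'))"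

definition smooth_fun_on ::
    "('m::topological_space, 'e::euclidean_space) atlas \<Rightarrow> 'm set \<Rightarrow> ('m \<Rightarrow> real) \<Rightarrow> bool" where
  "smooth_fun_on A U f \<longleftrightarrow>
     (\<forall>c\<in>A. smooth_on (coord c ` (U \<inter> dom_chart c)) (f \<circ> inv_chart c))"

text \<open>A tangent vector at \<open>p\<close> is represented by its components \<open>v :: 'e\<close> in a chart \<open>c\<close> around
  \<open>p\<close>; this is the derivative of \<open>f\<close> at \<open>p\<close> along it.\<close>

definition dir_deriv ::
    "('m, 'e::euclidean_space) chart \<Rightarrow> ('m \<Rightarrow> real) \<Rightarrow> 'm \<Rightarrow> 'e \<Rightarrow> real" where
  "dir_deriv c f p v = frechet_derivative (f \<circ> inv_chart c) (at (coord c p)) v"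


section \<open>Differential forms\<close>

text \<open>A tuple of \<open>k\<close> vectors is a sequence of which only the entries with index below \<open>k\<close> matter.\<close>

definition alternating :: "nat \<Rightarrow> ((nat \<Rightarrow> 'e::real_vector) \<Rightarrow> real) \<Rightarrow> bool" where
  "alternating k \<phi> \<longleftrightarrow>
     (\<forall>v w. (\<forall>i<k. v i = w i) \<longrightarrow> \<phi> v = \<phi> w) \<and>
     (\<forall>v. \<forall>i<k. linear (\<lambda>u. \<phi> (v(i := u)))) \<and>
     (\<forall>v. \<forall>i<k. \<forall>j<k. i \<noteq> j \<and> v i = v j \<longrightarrow> \<phi> v = 0)"

text \<open>A differential form is the family of its local coordinate expressions: \<open>\<omega> c\<close> is a form on
  the open set \<open>im_chart c\<close>, and the expressions in two charts are related by pullback along the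
  transition map. Requiring the value \<open>0\<close> for irrelevant arguments makes equality of forms
  equality of functions.\<close>

type_synonym ('m, 'e) form = "('m, 'e) chart \<Rightarrow> 'e \<Rightarrow> (nat \<Rightarrow> 'e) \<Rightarrow> real"

definition forms ::
    "('m::topological_space, 'e::euclidean_space) atlas \<Rightarrow> nat \<Rightarrow> ('m, 'e) form set" where
  "forms A k = {\<omega>.
     (\<forall>c\<in>A. \<forall>x\<in>im_chart c. alternating k (\<omega> c x)) \<and>
     (\<forall>c\<in>A. \<forall>v. smooth_on (im_chart c) (\<lambda>x. \<omega> c x v)) \<and>
     (\<forall>c\<in>A. \<forall>c'\<in>A. \<forall>p\<in>dom_chart c \<inter> dom_chart c'. \<forall>v.
        \<omega> c (coord c p) v =
        \<omega> c' (coord c' p) (\<lambda>i. frechet_derivative (transition c c') (at (coord c p)) (v i))) \<and>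
     (\<forall>c x v. c \<notin> A \<or> x \<notin> im_chart c \<longrightarrow> \<omega> c x v = 0)}"

definition form_scale :: "real \<Rightarrow> ('m, 'e) form \<Rightarrow> ('m, 'e) form" where
  "form_scale r \<omega> = (\<lambda>c x v. r * \<omega> c x v)"

text \<open>Wedge and exterior derivative are normalised so that
  \<open>(\<alpha> \<and> \<beta>)(X,Y) = \<alpha>(X) \<beta>(Y) - \<alpha>(Y) \<beta>(X)\<close> and
  \<open>d\<alpha>(X,Y) = X \<alpha>(Y) - Y \<alpha>(X) - \<alpha>([X,Y])\<close> for \<open>1\<close>-forms. The degrees are explicit arguments.\<close>

definition wedge ::
    "nat \<Rightarrow> nat \<Rightarrow> ('m, 'e) form \<Rightarrow> ('m, 'e) form \<Rightarrow> ('m, 'e) form" where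
  "wedge k l \<omega> \<eta> = (\<lambda>c x v. (1 / (fact k * fact l)) *
     (\<Sum>\<sigma> | \<sigma> permutes {..<k + l}.
        of_int (sign \<sigma>) * \<omega> c x (\<lambda>i. v (\<sigma> i)) * \<eta> c x (\<lambda>i. v (\<sigma> (k + i)))))"

definition ext_d ::
    "('m, 'e::euclidean_space) atlas \<Rightarrow> nat \<Rightarrow> ('m, 'e) form \<Rightarrow> ('m, 'e) form" where
  "ext_d A k \<omega> = (\<lambda>c x v.
     if c \<in> A \<and> x \<in> im_chart c
     then \<Sum>i\<le>k. (-1) ^ i *
       frechet_derivative (\<lambda>y. \<omega> c y (\<lambda>j. if j < i then v j else v (Suc j))) (at x) (v i)
     else 0)"

definition smooth_form_family ::
    "('m::topological_space, 'e::euclidean_space) atlas \<Rightarrow> real set \<Rightarrow> nat \<Rightarrow>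
      (real \<Rightarrow> ('m, 'e) form) \<Rightarrow> bool" where
  "smooth_form_family A J k \<omega> \<longleftrightarrow>
     (\<forall>t\<in>J. \<omega> t \<in> forms A k) \<and>
     (\<forall>c\<in>A. \<forall>v. smooth_on (J \<times> im_chart c) (\<lambda>(t, x). \<omega> t c x v))"

definition form_dot :: "(real \<Rightarrow> ('m, 'e) form) \<Rightarrow> real \<Rightarrow> ('m, 'e) form" where
  "form_dot \<omega> t = (\<lambda>c x v. deriv (\<lambda>s. \<omega> s c x v) t)"


section \<open>Transversely oriented codimension one foliations\<close>

text \<open>A transversely oriented codimension one foliation is given by local submersions to the line
  (distinguished maps) whose level sets are the plaques and which differ on overlaps by
  orientation preserving local diffeomorphisms of the line; the submersions increase in the
  positive transverse direction.\<close>

type_synonym 'm foliation = "('m set \<times> ('m \<Rightarrow> real)) set"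

definition foliation ::
    "('m::topological_space, 'e::euclidean_space) atlas \<Rightarrow> 'm foliation \<Rightarrow> bool" where
  "foliation A F \<longleftrightarrow>
     (\<forall>(U, f)\<in>F. open U \<and> smooth_fun_on A U f \<and>
        (\<forall>c\<in>A. \<forall>p\<in>U \<inter> dom_chart c. \<exists>v. dir_deriv c f p v \<noteq> 0)) \<and>
     (\<Union>(U, f)\<in>F. U) = UNIV \<and>
     (\<forall>(U, f)\<in>F. \<forall>(V, g)\<in>F. \<forall>p\<in>U \<inter> V.
        \<exists>W D h. open W \<and> p \<in> W \<and> W \<subseteq> U \<inter> V \<and> open D \<and> f ` W \<subseteq> D \<and>
          smooth_on D h \<and> (\<forall>r\<in>D. deriv h r > 0) \<and> (\<forall>q\<in>W. g q = h (f q)))"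

text \<open>The vector at \<open>p\<close> with components \<open>v\<close> in the chart \<open>c\<close> is tangent to the leaf through \<open>p\<close>,
  respectively is the velocity of a positively oriented transversal.\<close>

definition leaf_tangent ::
    "'m foliation \<Rightarrow> ('m, 'e::euclidean_space) chart \<Rightarrow> 'm \<Rightarrow> 'e \<Rightarrow> bool" where
  "leaf_tangent F c p v \<longleftrightarrow> (\<forall>(U, f)\<in>F. p \<in> U \<longrightarrow> dir_deriv c f p v = 0)"

definition positive_transverse ::
    "'m foliation \<Rightarrow> ('m, 'e::euclidean_space) chart \<Rightarrow> 'm \<Rightarrow> 'e \<Rightarrow> bool" where
  "positive_transverse F c p v \<longleftrightarrow> (\<forall>(U, f)\<in>F. p \<in> U \<longrightarrow> dir_deriv c f p v > 0)"

text \<open>A smooth family is one admitting, near every \<open>(t, p)\<close>, distinguished maps that depend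
  smoothly on the parameter.\<close>

definition foliation_family ::
    "('m::topological_space, 'e::euclidean_space) atlas \<Rightarrow> real set \<Rightarrow>
      (real \<Rightarrow> 'm foliation) \<Rightarrow> bool" where
  "foliation_family A J \<F> \<longleftrightarrow>
     (\<forall>t\<in>J. foliation A (\<F> t)) \<and>
     (\<forall>t\<in>J. \<forall>p. \<exists>K U f. open K \<and> t \<in> K \<and> K \<subseteq> J \<and> open U \<and> p \<in> U \<and>
        (\<forall>c\<in>A. smooth_on (K \<times> coord c ` (U \<inter> dom_chart c)) (\<lambda>(s, x). f s (inv_chart c x))) \<and>
        (\<forall>s\<in>K. foliation A (insert (U, f s) (\<F> s))))"

definition defining_form ::
    "('m::topological_space, 'e::euclidean_space) atlas \<Rightarrow> 'm foliation \<Rightarrow>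
      ('m, 'e) form \<Rightarrow> bool" where
  "defining_form A F \<alpha> \<longleftrightarrow> \<alpha> \<in> forms A 1 \<and>
     (\<forall>c\<in>A. \<forall>p\<in>dom_chart c.
        (\<exists>v. \<alpha> c (coord c p) (\<lambda>_. v) \<noteq> 0) \<and>
        (\<forall>v. \<alpha> c (coord c p) (\<lambda>_. v) = 0 \<longleftrightarrow> leaf_tangent F c p v) \<and>
        (\<forall>v. positive_transverse F c p v \<longrightarrow> \<alpha> c (coord c p) (\<lambda>_. v) > 0))"

definition defining_pair ::
    "('m::topological_space, 'e::euclidean_space) atlas \<Rightarrow> 'm foliation \<Rightarrow>
      ('m, 'e) form \<Rightarrow> ('m, 'e) form \<Rightarrow> bool" where
  "defining_pair A F \<alpha> \<beta> \<longleftrightarrow>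
     defining_form A F \<alpha> \<and> \<beta> \<in> forms A 1 \<and> ext_d A 1 \<alpha> = wedge 1 1 \<alpha> \<beta>"

definition defining_families ::
    "('m::topological_space, 'e::euclidean_space) atlas \<Rightarrow> real set \<Rightarrow>
      (real \<Rightarrow> 'm foliation) \<Rightarrow> (real \<Rightarrow> ('m, 'e) form) \<Rightarrow> (real \<Rightarrow> ('m, 'e) form) \<Rightarrow> bool" where
  "defining_families A J \<F> \<alpha> \<beta> \<longleftrightarrow>
     smooth_form_family A J 1 \<alpha> \<and> smooth_form_family A J 1 \<beta> \<and>
     (\<forall>t\<in>J. defining_pair A (\<F> t) (\<alpha> t) (\<beta> t))"


section \<open>Cohomology\<close>

text \<open>Cohomology of a cochain complex of groups \<open>C k\<close> (written multiplicatively, as in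
  HOL-Algebra) with differentials \<open>\<delta> k\<close> from \<open>C k\<close> to \<open>C (Suc k)\<close>.\<close>

fun coboundaries :: "(nat \<Rightarrow> 'v monoid) \<Rightarrow> (nat \<Rightarrow> 'v \<Rightarrow> 'v) \<Rightarrow> nat \<Rightarrow> 'v set" where
  "coboundaries C \<delta> 0 = {\<one>\<^bsub>C 0\<^esub>}"
| "coboundaries C \<delta> (Suc k) = \<delta> k ` carrier (C k)"

definition cohomology :: "(nat \<Rightarrow> 'v monoid) \<Rightarrow> (nat \<Rightarrow> 'v \<Rightarrow> 'v) \<Rightarrow> nat \<Rightarrow> 'v set monoid" where
  "cohomology C \<delta> k =
     (C k)\<lparr>carrier := kernel (C k) (C (Suc k)) (\<delta> k)\<rparr> Mod coboundaries C \<delta> k"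

definition coh_class :: "(nat \<Rightarrow> 'v monoid) \<Rightarrow> (nat \<Rightarrow> 'v \<Rightarrow> 'v) \<Rightarrow> nat \<Rightarrow> 'v \<Rightarrow> 'v set" where
  "coh_class C \<delta> k x = coboundaries C \<delta> k #>\<^bsub>C k\<^esub> x"

definition form_complex ::
    "('m::topological_space, 'e::euclidean_space) atlas \<Rightarrow> nat \<Rightarrow> ('m, 'e) form monoid" where
  "form_complex A k = \<lparr>carrier = forms A k, monoid.mult = (+), one = 0\<rparr>"

definition ideal ::
    "('m::topological_space, 'e::euclidean_space) atlas \<Rightarrow> 'm foliation \<Rightarrow> nat \<Rightarrow>
      ('m, 'e) form set" where
  "ideal A F k = {\<omega> \<in> forms A k. \<forall>c\<in>A. \<forall>p\<in>dom_chart c. \<forall>v.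
     (\<forall>i<k. leaf_tangent F c p (v i)) \<longrightarrow> \<omega> c (coord c p) v = 0}"

definition ideal_complex ::
    "('m::topological_space, 'e::euclidean_space) atlas \<Rightarrow> 'm foliation \<Rightarrow> nat \<Rightarrow>
      ('m, 'e) form monoid" where
  "ideal_complex A F k = (form_complex A k)\<lparr>carrier := ideal A F k\<rparr>"

definition leaf_complex ::
    "('m::topological_space, 'e::euclidean_space) atlas \<Rightarrow> 'm foliation \<Rightarrow> nat \<Rightarrow>
      ('m, 'e) form set monoid" where
  "leaf_complex A F k = form_complex A k Mod ideal A F k"

definition leaf_form ::
    "('m::topological_space, 'e::euclidean_space) atlas \<Rightarrow> 'm foliation \<Rightarrow> nat \<Rightarrow>
      ('m, 'e) form \<Rightarrow> ('m, 'e) form set" where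
  "leaf_form A F k \<omega> = ideal A F k #>\<^bsub>form_complex A k\<^esub> \<omega>"

text \<open>Maps induced on quotients are written as unions over all representatives: when the induced
  map is well defined, all members of the union coincide.\<close>

definition leaf_d ::
    "('m::topological_space, 'e::euclidean_space) atlas \<Rightarrow> 'm foliation \<Rightarrow> nat \<Rightarrow>
      ('m, 'e) form set \<Rightarrow> ('m, 'e) form set" where
  "leaf_d A F k N = (\<Union>\<omega>\<in>N. leaf_form A F (Suc k) (ext_d A k \<omega>))"

definition H_dR ::
    "('m::topological_space, 'e::euclidean_space) atlas \<Rightarrow> nat \<Rightarrow> ('m, 'e) form set monoid" where
  "H_dR A k = cohomology (form_complex A) (ext_d A) k"

definition H_ideal ::
    "('m::topological_space, 'e::euclidean_space) atlas \<Rightarrow> 'm foliation \<Rightarrow> nat \<Rightarrow>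
      ('m, 'e) form set monoid" where
  "H_ideal A F k = cohomology (ideal_complex A F) (ext_d A) k"

definition H_leaf ::
    "('m::topological_space, 'e::euclidean_space) atlas \<Rightarrow> 'm foliation \<Rightarrow> nat \<Rightarrow>
      ('m, 'e) form set set monoid" where
  "H_leaf A F k = cohomology (leaf_complex A F) (leaf_d A F) k"

definition class_dR ::
    "('m::topological_space, 'e::euclidean_space) atlas \<Rightarrow> nat \<Rightarrow> ('m, 'e) form \<Rightarrow>
      ('m, 'e) form set" where
  "class_dR A k \<omega> = coh_class (form_complex A) (ext_d A) k \<omega>"

definition class_ideal ::
    "('m::topological_space, 'e::euclidean_space) atlas \<Rightarrow> 'm foliation \<Rightarrow> nat \<Rightarrow>
      ('m, 'e) form \<Rightarrow> ('m, 'e) form set" where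
  "class_ideal A F k \<omega> = coh_class (ideal_complex A F) (ext_d A) k \<omega>"

definition class_leaf ::
    "('m::topological_space, 'e::euclidean_space) atlas \<Rightarrow> 'm foliation \<Rightarrow> nat \<Rightarrow>
      ('m, 'e) form \<Rightarrow> ('m, 'e) form set set" where
  "class_leaf A F k \<omega> = coh_class (leaf_complex A F) (leaf_d A F) k (leaf_form A F k \<omega>)"

text \<open>Scalar multiplication on de Rham cohomology, and the maps induced by the inclusion of the
  ideal and by the wedge product.\<close>

definition scale_dR ::
    "('m::topological_space, 'e::euclidean_space) atlas \<Rightarrow> nat \<Rightarrow> real \<Rightarrow>
      ('m, 'e) form set \<Rightarrow> ('m, 'e) form set" where
  "scale_dR A k r X = (\<Union>\<omega>\<in>X. class_dR A k (form_scale r \<omega>))"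

definition ideal_to_dR ::
    "('m::topological_space, 'e::euclidean_space) atlas \<Rightarrow> nat \<Rightarrow>
      ('m, 'e) form set \<Rightarrow> ('m, 'e) form set" where
  "ideal_to_dR A k X = (\<Union>\<omega>\<in>X. class_dR A k \<omega>)"

definition pairing ::
    "('m::topological_space, 'e::euclidean_space) atlas \<Rightarrow> 'm foliation \<Rightarrow> nat \<Rightarrow> nat \<Rightarrow>
      ('m, 'e) form set \<Rightarrow> ('m, 'e) form set set \<Rightarrow> ('m, 'e) form set" where
  "pairing A F i j X Y =
     (\<Union>\<omega>\<in>X. \<Union>N\<in>Y. \<Union>\<eta>\<in>N. class_ideal A F (i + j) (wedge i j \<omega> \<eta>))"

text \<open>The derivative at \<open>t\<close> of a curve \<open>\<gamma>\<close> in \<open>H\<^sup>k(M)\<close>: represent the curve by a smooth family of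
  closed forms and take the class of the \<open>t\<close>-derivative of that family. By de Rham's theorem
  the result does not depend on the representing family (if all \<open>\<omega> s\<close> are exact, then their
  periods over cycles vanish, hence so do those of the \<open>t\<close>-derivative).\<close>

definition has_class_derivative ::
    "('m::topological_space, 'e::euclidean_space) atlas \<Rightarrow> nat \<Rightarrow> real set \<Rightarrow>
      (real \<Rightarrow> ('m, 'e) form set) \<Rightarrow> ('m, 'e) form set \<Rightarrow> real \<Rightarrow> bool" where
  "has_class_derivative A k J \<gamma> X t \<longleftrightarrow>
     (\<exists>\<omega>. smooth_form_family A J k \<omega> \<and>
        (\<forall>s\<in>J. ext_d A k (\<omega> s) = 0 \<and> \<gamma> s = class_dR A k (\<omega> s)) \<and>
        X = class_dR A k (form_dot \<omega> t))"


section \<open>Characteristic classes\<close>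

definition reeb_class ::
    "('m::topological_space, 'e::euclidean_space) atlas \<Rightarrow> 'm foliation \<Rightarrow>
      ('m, 'e) form set set" where
  "reeb_class A F = (THE X. \<exists>\<alpha> \<beta>. defining_pair A F \<alpha> \<beta> \<and> X = class_leaf A F 1 \<beta>)"

definition GV ::
    "('m::topological_space, 'e::euclidean_space) atlas \<Rightarrow> 'm foliation \<Rightarrow> ('m, 'e) form set" where
  "GV A F = (THE X. \<exists>\<alpha> \<beta>. defining_pair A F \<alpha> \<beta> \<and>
     X = class_dR A 3 (wedge 1 2 \<beta> (ext_d A 1 \<beta>)))"

definition TGV ::
    "('m::topological_space, 'e::euclidean_space) atlas \<Rightarrow> real set \<Rightarrow> (real \<Rightarrow> 'm foliation) \<Rightarrow>
      real \<Rightarrow> ('m, 'e) form set" where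
  "TGV A J \<F> t = (THE X. \<exists>\<alpha> \<beta>. defining_families A J \<F> \<alpha> \<beta> \<and>
     X = class_dR A 4 (wedge 1 3 (form_dot \<beta> t) (wedge 1 2 (\<beta> t) (ext_d A 1 (\<beta> t)))))"

definition T_form ::
    "('m::topological_space, 'e::euclidean_space) atlas \<Rightarrow> (real \<Rightarrow> ('m, 'e) form) \<Rightarrow>
      real \<Rightarrow> ('m, 'e) form" where
  "T_form A \<beta> t = wedge 1 2 (form_dot \<beta> t) (ext_d A 1 (\<beta> t))"

definition T_class ::
    "('m::topological_space, 'e::euclidean_space) atlas \<Rightarrow> (real \<Rightarrow> 'm foliation) \<Rightarrow>
      (real \<Rightarrow> ('m, 'e) form) \<Rightarrow> real \<Rightarrow> ('m, 'e) form set" where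
  "T_class A \<F> \<beta> t = class_ideal A (\<F> t) 3 (T_form A \<beta> t)"

end

theory Submission
  imports Defs
begin

text \<open>Write a prime for the derivative in \<open>t\<close>. Let \<open>\<I>\<close> be the ideal of forms vanishing on the leaves of one foliation
  of the family. Three properties of it carry the proof: \<open>\<I>\<close> consists of the forms \<open>\<omega>\<close> with \<open>\<alpha> \<and> \<omega> = 0\<close>
  (\<open>ideal_of_wedge_zero\<close>), the product of two of its elements vanishes (\<open>ideal_wedge_ideal\<close>), and it is
  closed under \<open>d\<close> (\<open>ideal_ext_d\<close>). Moreover \<open>d\<beta>\<close> lies in \<open>\<I>\<close> (\<open>ext_d_beta_ideal\<close>).

  So \<open>T = \<beta>' \<and> d\<beta>\<close> lies in \<open>\<I>\<close>. It is closed because \<open>d\<beta> \<and> d\<beta> = 0\<close> for all \<open>t\<close>, and the \<open>t\<close>-derivative of this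
  equation is \<open>2 d\<beta>' \<and> d\<beta> = 0\<close>.

  For another choice, \<open>\<alpha>\<close> is multiplied by a positive function \<open>exp (- h)\<close>, and \<open>\<beta>\<close> becomes \<open>\<beta> + dh + a\<close> with a
  one-form \<open>a\<close> in \<open>\<I>\<close> (\<open>defining_families_difference\<close>). Adding \<open>dh\<close> changes \<open>T\<close> by \<open>d(h' d\<beta>)\<close>. Adding \<open>a\<close>
  changes it by \<open>\<beta>' \<and> da + a' \<and> d\<beta> + a' \<and> da\<close>; differentiating the identities \<open>a \<and> d\<beta> = 0\<close> and \<open>a \<and> da = 0\<close>
  in \<open>t\<close> shows that this is \<open>d(a \<and> \<beta>' - 1/2 a' \<and> a)\<close> (\<open>T_form_add_ideal\<close>). The primitives lie in \<open>\<I>\<close>, so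
  the class of \<open>T\<close> in the cohomology of \<open>\<I>\<close> is unchanged. In the same way \<open>\<beta> \<and> d\<beta>\<close> changes by exact forms.

  Up to \<open>d(\<beta> \<and> \<beta>')\<close>, the \<open>t\<close>-derivative of \<open>\<beta> \<and> d\<beta>\<close> is \<open>2 T\<close> (\<open>GV_form_dot\<close>), which gives the image
  of the class of \<open>T\<close> in de Rham cohomology. Finally \<open>T \<and> \<beta> = \<beta>' \<and> \<beta> \<and> d\<beta>\<close>, so the product with the Reeb class
  maps to \<open>TGV\<close>, with sign \<open>+1\<close>.

  These arguments need the exterior calculus of forms given by coordinate expressions: \<open>d\<close> is independent of the
  chart, \<open>d \<circ> d = 0\<close>, the Leibniz rule, associativity and graded commutativity of the wedge product, and
  the commutation of \<open>d\<close> with the \<open>t\<close>-derivative. They are derived from an antisymmetrisation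
  operator and the symmetry of second derivatives.\<close>

section \<open>Smooth maps\<close>

lemma frechet_derivative_eqI: "(f has_derivative D) (at x) \<Longrightarrow> frechet_derivative f (at x) = D"
  using frechet_derivative_at by metis

lemma Ck_on_cong:
  assumes "open S" "\<And>x. x \<in> S \<Longrightarrow> f x = g x" "Ck_on k S f"
  shows "Ck_on k S g"
  using assms(2,3)
proof (induction k arbitrary: f g)
  case 0
  then show ?case using continuous_on_cong[of S S f g] by simp
next
  case (Suc k)
  have D: "(g has_derivative frechet_derivative f (at x)) (at x)" if "x \<in> S" for x
  proof (rule has_derivative_transform_within_open[of f])
    show "(f has_derivative frechet_derivative f (at x)) (at x)"
      using Suc.prems(2) that frechet_derivative_works by auto
  qed (use Suc.prems assms that in auto)
  show ?case
  proof (simp only: Ck_on.simps, intro conjI ballI allI)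
    show "g differentiable at x" if "x \<in> S" for x
      using D[OF that] differentiableI by blast
    show "Ck_on k S (\<lambda>x. frechet_derivative g (at x) v)" for v
      by (rule Suc.IH[of "\<lambda>x. frechet_derivative f (at x) v"])
        (use D frechet_derivative_eqI Suc.prems in \<open>fastforce+\<close>)
  qed
qed

text \<open>The derivative may be given by any formula valid at the points of the open set, with no reference to
  \<^const>\<open>frechet_derivative\<close>. This is the induction step for all closure properties below.\<close>

lemma Ck_on_SucI:
  assumes "open S" "\<And>x. x \<in> S \<Longrightarrow> (f has_derivative D x) (at x)"
    and "\<And>v. Ck_on k S (\<lambda>x. D x v)"
  shows "Ck_on (Suc k) S f"
proof (simp only: Ck_on.simps, intro conjI ballI allI)
  show "f differentiable at x" if "x \<in> S" for x
    using assms(2)[OF that] differentiableI by blast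
  show "Ck_on k S (\<lambda>x. frechet_derivative f (at x) v)" for v
    by (rule Ck_on_cong[OF assms(1) _ assms(3)]) (simp add: frechet_derivative_eqI[OF assms(2)])
qed

lemma Ck_on_Suc_has_derivative:
  "Ck_on (Suc k) S f \<Longrightarrow> x \<in> S \<Longrightarrow> (f has_derivative frechet_derivative f (at x)) (at x)"
  using frechet_derivative_works by auto

lemma Ck_on_lower: "Ck_on (Suc k) S f \<Longrightarrow> Ck_on k S f"
proof (induction k arbitrary: f)
  case 0
  then show ?case
    by (auto intro!: continuous_at_imp_continuous_on differentiable_imp_continuous_within)
next
  case (Suc k)
  then show ?case by (metis Ck_on.simps(2))
qed

lemma smooth_on_cong:
  "open S \<Longrightarrow> (\<And>x. x \<in> S \<Longrightarrow> f x = g x) \<Longrightarrow> smooth_on S f \<Longrightarrow> smooth_on S g"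
  unfolding smooth_on_def using Ck_on_cong by metis

lemma smooth_on_has_derivative:
  "smooth_on S f \<Longrightarrow> x \<in> S \<Longrightarrow> (f has_derivative frechet_derivative f (at x)) (at x)"
  unfolding smooth_on_def using Ck_on_Suc_has_derivative by metis

lemma smooth_on_differentiable: "smooth_on S f \<Longrightarrow> x \<in> S \<Longrightarrow> f differentiable at x"
  using smooth_on_has_derivative differentiableI by blast

lemma smooth_on_frechet_derivative:
  "smooth_on S f \<Longrightarrow> smooth_on S (\<lambda>x. frechet_derivative f (at x) v)"
  unfolding smooth_on_def using Ck_on.simps(2) by metis

lemma smooth_on_continuous: "smooth_on S f \<Longrightarrow> continuous_on S f"
  unfolding smooth_on_def using Ck_on.simps(1) by metis

lemma Ck_on_subset: "Ck_on k S f \<Longrightarrow> T \<subseteq> S \<Longrightarrow> Ck_on k T f"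
  by (induction k arbitrary: f) (auto intro: continuous_on_subset)

lemma Ck_on_const: "open S \<Longrightarrow> Ck_on k S (\<lambda>x. c)"
proof (induction k arbitrary: c)
  case (Suc k)
  show ?case by (rule Ck_on_SucI[where D="\<lambda>x v. 0"]) (use Suc in auto)
qed simp

lemma Ck_on_add: "open S \<Longrightarrow> Ck_on k S f \<Longrightarrow> Ck_on k S g \<Longrightarrow> Ck_on k S (\<lambda>x. f x + g x)"
proof (induction k arbitrary: f g)
  case (Suc k)
  show ?case
    by (rule Ck_on_SucI[OF Suc.prems(1)
          has_derivative_add[OF Ck_on_Suc_has_derivative Ck_on_Suc_has_derivative]])
      (use Suc in auto)
qed (simp add: continuous_on_add)

lemma Ck_on_linear:
  assumes "bounded_linear L"
  shows "open S \<Longrightarrow> Ck_on k S f \<Longrightarrow> Ck_on k S (\<lambda>x. L (f x))"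
proof (induction k arbitrary: f)
  case (Suc k)
  show ?case
    by (rule Ck_on_SucI[OF Suc.prems(1)
          bounded_linear.has_derivative[OF assms Ck_on_Suc_has_derivative]])
      (use Suc in auto)
qed (simp add: bounded_linear.continuous_on[OF assms])

text \<open>The product rule writes the derivative as a sum of products of functions of one class lower,
  so the induction has to know that \<open>f\<close> and \<open>g\<close> themselves lie in that lower class.\<close>

lemma Ck_on_bilinear:
  assumes "bounded_bilinear B"
  shows "open S \<Longrightarrow> Ck_on k S f \<Longrightarrow> Ck_on k S g \<Longrightarrow> Ck_on k S (\<lambda>x. B (f x) (g x))"
proof (induction k arbitrary: f g)
  case (Suc k)
  have low: "Ck_on k S f" "Ck_on k S g"
    using Suc.prems Ck_on_lower by blast+
  show ?case
  proof (rule Ck_on_SucI[OF Suc.prems(1)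
          bounded_bilinear.FDERIV[OF assms Ck_on_Suc_has_derivative Ck_on_Suc_has_derivative]])
    show "Ck_on k S (\<lambda>x. B (f x) (frechet_derivative g (at x) v) + B (frechet_derivative f (at x) v) (g x))" for v
      by (intro Ck_on_add Suc.IH) (use Suc.prems low in auto)
  qed (use Suc.prems in auto)
qed (simp add: bounded_bilinear.continuous_on[OF assms])

lemma Ck_on_sum:
  "finite I \<Longrightarrow> open S \<Longrightarrow> (\<And>i. i \<in> I \<Longrightarrow> Ck_on k S (f i)) \<Longrightarrow> Ck_on k S (\<lambda>x. \<Sum>i\<in>I. f i x)"
  by (induction I rule: finite_induct) (auto intro: Ck_on_const Ck_on_add)

text \<open>The chain rule contains \<open>f'(g x)\<close> applied to a vector that varies with \<open>x\<close>, whereas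
  \<^const>\<open>Ck_on\<close> speaks of derivatives of \<open>f\<close> in fixed directions. Expanding the vector in a basis,
  which needs a finite-dimensional intermediate space, separates the two.\<close>

lemma Ck_on_compose:
  fixes f :: "'a::euclidean_space \<Rightarrow> 'b::real_normed_vector" and g :: "'c::real_normed_vector \<Rightarrow> 'a"
  assumes "open S" "open T" "g ` S \<subseteq> T"
  shows "Ck_on k T f \<Longrightarrow> Ck_on k S g \<Longrightarrow> Ck_on k S (\<lambda>x. f (g x))"
proof (induction k arbitrary: f)
  case 0
  then show ?case using assms continuous_on_compose2 by auto
next
  case (Suc k)
  let ?D = "\<lambda>x v. \<Sum>b\<in>Basis. (frechet_derivative g (at x) v \<bullet> b) *\<^sub>R frechet_derivative f (at (g x)) b"
  have der: "((\<lambda>x. f (g x)) has_derivative ?D x) (at x)" if "x \<in> S" for x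
  proof -
    have f: "(f has_derivative frechet_derivative f (at (g x))) (at (g x))"
      by (rule Ck_on_Suc_has_derivative[OF Suc.prems(1)]) (use that assms in auto)
    interpret F: bounded_linear "frechet_derivative f (at (g x))"
      using f has_derivative_bounded_linear by blast
    have expand: "frechet_derivative f (at (g x)) w
        = (\<Sum>b\<in>Basis. (w \<bullet> b) *\<^sub>R frechet_derivative f (at (g x)) b)" for w
      by (subst (1) euclidean_representation[symmetric]) (simp only: F.sum F.scaleR)
    then have "?D x = frechet_derivative f (at (g x)) \<circ> frechet_derivative g (at x)"
      unfolding o_def by (intro ext expand[symmetric])
    then show ?thesis
      using diff_chain_at[OF Ck_on_Suc_has_derivative[OF Suc.prems(2) that] f] by (simp add: o_def)
  qed
  show ?case
  proof (rule Ck_on_SucI[OF assms(1) der], assumption)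
    fix v
    show "Ck_on k S (\<lambda>x. ?D x v)"
      by (intro Ck_on_sum[OF finite_Basis assms(1)] Ck_on_bilinear[OF bounded_bilinear_scaleR assms(1)]
          Ck_on_linear[OF bounded_linear_inner_left assms(1)] Suc.IH Ck_on_lower[OF Suc.prems(2)])
        (use Suc.prems in auto)
  qed
qed

lemma smooth_on_const: "open S \<Longrightarrow> smooth_on S (\<lambda>x. c)"
  and smooth_on_add: "open S \<Longrightarrow> smooth_on S f \<Longrightarrow> smooth_on S g \<Longrightarrow> smooth_on S (\<lambda>x. f x + g x)"
  by (simp_all add: smooth_on_def Ck_on_const Ck_on_add)

lemma smooth_on_mult:
  fixes f g :: "'a::real_normed_vector \<Rightarrow> real"
  shows "open S \<Longrightarrow> smooth_on S f \<Longrightarrow> smooth_on S g \<Longrightarrow> smooth_on S (\<lambda>x. f x * g x)"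
  by (simp add: smooth_on_def Ck_on_bilinear[OF bounded_bilinear_mult])

lemma smooth_on_sum:
  "open S \<Longrightarrow> finite I \<Longrightarrow> (\<And>i. i \<in> I \<Longrightarrow> smooth_on S (f i)) \<Longrightarrow> smooth_on S (\<lambda>x. \<Sum>i\<in>I. f i x)"
  by (simp add: smooth_on_def Ck_on_sum)

lemma smooth_on_linear: "bounded_linear L \<Longrightarrow> open S \<Longrightarrow> smooth_on S L"
  unfolding smooth_on_def
proof
  fix k assume L: "bounded_linear L" "open S"
  show "Ck_on k S L"
  proof (cases k)
    case 0
    then show ?thesis using L by (simp add: linear_continuous_on)
  next
    case (Suc j)
    show ?thesis
      unfolding Suc by (rule Ck_on_SucI[where D="\<lambda>x. L"])
        (use L in \<open>auto intro: bounded_linear_imp_has_derivative Ck_on_const\<close>)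
  qed
qed

lemma smooth_on_compose:
  fixes f :: "'a::euclidean_space \<Rightarrow> 'b::real_normed_vector" and g :: "'c::real_normed_vector \<Rightarrow> 'a"
  shows "open S \<Longrightarrow> open T \<Longrightarrow> g ` S \<subseteq> T \<Longrightarrow> smooth_on T f \<Longrightarrow> smooth_on S g \<Longrightarrow> smooth_on S (\<lambda>x. f (g x))"
  by (simp add: smooth_on_def Ck_on_compose)

lemma smooth_on_inverse: "smooth_on (- {0}) (inverse :: real \<Rightarrow> real)"
  unfolding smooth_on_def
proof
  have op: "open (- {0::real})" by (rule open_Compl[OF closed_singleton])
  show "Ck_on k (- {0}) (inverse :: real \<Rightarrow> real)" for k
  proof (induction k)
    case 0
    then show ?case by (auto intro!: continuous_intros)
  next
    case (Suc k)
    show ?case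
    proof (rule Ck_on_SucI[OF op, where D="\<lambda>x v. (- v) * (inverse x * inverse x)"])
      show "(inverse has_derivative (\<lambda>v. - v * (inverse x * inverse x))) (at x)"
        if "x \<in> - {0}" for x :: real
        using has_derivative_inverse'[of x UNIV] that by (simp add: mult.commute mult.left_commute)
      show "Ck_on k (- {0}) (\<lambda>x::real. (- v) * (inverse x * inverse x))" for v
        using Ck_on_bilinear[OF bounded_bilinear_mult op Ck_on_const[OF op]
            Ck_on_bilinear[OF bounded_bilinear_mult op Suc Suc]] .
    qed
  qed
qed

lemma smooth_on_divide:
  fixes f g :: "'a::real_normed_vector \<Rightarrow> real"
  assumes "open S" "smooth_on S f" "smooth_on S g" "\<And>x. x \<in> S \<Longrightarrow> g x \<noteq> 0"
  shows "smooth_on S (\<lambda>x. f x / g x)"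
  unfolding divide_inverse
  by (intro smooth_on_mult smooth_on_compose[OF _ _ _ smooth_on_inverse]) (use assms in auto)

lemma smooth_on_ln: "smooth_on {0<..} (ln :: real \<Rightarrow> real)"
  unfolding smooth_on_def
proof
  fix k
  have op: "open {0::real<..}" by simp
  show "Ck_on k {0<..} (ln :: real \<Rightarrow> real)"
  proof (cases k)
    case 0
    then show ?thesis by (auto intro!: continuous_intros)
  next
    case (Suc j)
    show ?thesis
      unfolding Suc
    proof (rule Ck_on_SucI[OF op, where D="\<lambda>x v. inverse x * v"])
      show "(ln has_derivative (\<lambda>v. inverse x * v)) (at x)" if "x \<in> {0<..}" for x :: real
        using DERIV_ln[of x] that by (simp add: has_field_derivative_def)
      have "Ck_on j {0<..} (inverse :: real \<Rightarrow> real)"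
        using smooth_on_inverse Ck_on_subset[of j "- {0}" inverse "{0<..}"]
        unfolding smooth_on_def by auto
      then show "Ck_on j {0<..} (\<lambda>x::real. inverse x * v)" for v
        using Ck_on_bilinear[OF bounded_bilinear_mult op _ Ck_on_const[OF op]] by blast
    qed
  qed
qed

text \<open>Applying the mean value theorem along \<open>v\<close> and then along \<open>w\<close> turns the second difference over a
  parallelogram into a mixed second derivative at an interior point. The second difference is
  symmetric in \<open>v\<close> and \<open>w\<close>, whence the symmetry of second derivatives.\<close>

lemma second_difference:
  fixes f :: "'a::real_normed_vector \<Rightarrow> real"
  assumes s: "0 < s" and f: "smooth_on S f"
    and in_S: "\<And>a b. 0 \<le> a \<Longrightarrow> a \<le> s \<Longrightarrow> 0 \<le> b \<Longrightarrow> b \<le> s \<Longrightarrow> x + a *\<^sub>R v + b *\<^sub>R w \<in> S"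
  shows "\<exists>a b. 0 < a \<and> a < s \<and> 0 < b \<and> b < s \<and>
    f (x + s *\<^sub>R v + s *\<^sub>R w) - f (x + s *\<^sub>R v) - f (x + s *\<^sub>R w) + f x =
      s * s * frechet_derivative (\<lambda>y. frechet_derivative f (at y) v) (at (x + a *\<^sub>R v + b *\<^sub>R w)) w"
proof -
  let ?g = "\<lambda>y. frechet_derivative f (at y) v"
  have line: "((\<lambda>a. F (z + a *\<^sub>R u)) has_real_derivative frechet_derivative F (at (z + a *\<^sub>R u)) u) (at a)"
    if "smooth_on S F" "z + a *\<^sub>R u \<in> S" for F :: "'a \<Rightarrow> real" and z u a
  proof -
    have F: "(F has_derivative frechet_derivative F (at (z + a *\<^sub>R u))) (at (z + a *\<^sub>R u))"
      using smooth_on_has_derivative that by blast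
    have "((\<lambda>a. z + a *\<^sub>R u) has_derivative (\<lambda>h. h *\<^sub>R u)) (at a)"
      by (auto intro!: derivative_eq_intros)
    from diff_chain_at[OF this F]
    have "((\<lambda>a. F (z + a *\<^sub>R u)) has_derivative
        (\<lambda>h. frechet_derivative F (at (z + a *\<^sub>R u)) (h *\<^sub>R u))) (at a)"
      by (simp add: o_def)
    then show ?thesis
      using has_derivative_bounded_linear[OF F]
      by (simp only: has_field_derivative_def linear_simps(5) real_scaleR_def mult_commute_abs)
  qed
  let ?\<phi> = "\<lambda>a. f (x + s *\<^sub>R w + a *\<^sub>R v) - f (x + a *\<^sub>R v)"
  have "\<exists>a>0. a < s \<and> ?\<phi> s - ?\<phi> 0 = (s - 0) * (?g (x + s *\<^sub>R w + a *\<^sub>R v) - ?g (x + a *\<^sub>R v))"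
  proof (rule MVT2[OF s])
    fix a assume a: "0 \<le> a" "a \<le> s"
    have "x + s *\<^sub>R w + a *\<^sub>R v \<in> S" "x + a *\<^sub>R v \<in> S"
      using in_S[of a s] in_S[of a 0] a s by (simp_all add: algebra_simps)
    then show "(?\<phi> has_real_derivative ?g (x + s *\<^sub>R w + a *\<^sub>R v) - ?g (x + a *\<^sub>R v)) (at a)"
      by (intro DERIV_diff line f)
  qed
  then obtain a where a: "0 < a" "a < s"
    and 1: "?\<phi> s - ?\<phi> 0 = s * (?g (x + s *\<^sub>R w + a *\<^sub>R v) - ?g (x + a *\<^sub>R v))"
    by auto
  let ?\<psi> = "\<lambda>b. ?g (x + a *\<^sub>R v + b *\<^sub>R w)"
  have "\<exists>b>0. b < s \<and> ?\<psi> s - ?\<psi> 0 = (s - 0) * frechet_derivative ?g (at (x + a *\<^sub>R v + b *\<^sub>R w)) w"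
    by (rule MVT2[OF s]) (use a in_S line[OF smooth_on_frechet_derivative[OF f]] in auto)
  then obtain b where b: "0 < b" "b < s"
    and 2: "?\<psi> s - ?\<psi> 0 = s * frechet_derivative ?g (at (x + a *\<^sub>R v + b *\<^sub>R w)) w"
    by auto
  have "f (x + s *\<^sub>R v + s *\<^sub>R w) - f (x + s *\<^sub>R v) - f (x + s *\<^sub>R w) + f x = ?\<phi> s - ?\<phi> 0"
    by (simp add: algebra_simps)
  also have "\<dots> = s * (?\<psi> s - ?\<psi> 0)"
    using 1 by (simp add: algebra_simps)
  finally show ?thesis by (intro exI[of _ a] exI[of _ b]) (use a b 2 in simp)
qed

lemma second_derivative_symmetric_real:
  fixes f :: "'a::real_normed_vector \<Rightarrow> real"
  assumes "open S" "x \<in> S" and f: "smooth_on S f"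
  shows "frechet_derivative (\<lambda>y. frechet_derivative f (at y) v) (at x) w =
    frechet_derivative (\<lambda>y. frechet_derivative f (at y) w) (at x) v" (is "?P x = ?Q x")
proof -
  have "\<bar>?P x - ?Q x\<bar> \<le> e" if e: "e > 0" for e
  proof -
    have "continuous_on S ?P" "continuous_on S ?Q"
      using f by (auto intro!: smooth_on_continuous smooth_on_frechet_derivative)
    then have "\<exists>d>0. \<forall>y. dist y x < d \<longrightarrow> dist (?P y) (?P x) < e/2"
      "\<exists>d>0. \<forall>y. dist y x < d \<longrightarrow> dist (?Q y) (?Q x) < e/2"
      using half_gt_zero[OF e] assms(2)
      by (auto simp only: continuous_on_eq_continuous_at[OF assms(1)] continuous_at_eps_delta)
    then obtain d1 d2 where d12: "d1 > 0" "d2 > 0"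
      "\<And>y. dist y x < d1 \<Longrightarrow> dist (?P y) (?P x) < e/2" "\<And>y. dist y x < d2 \<Longrightarrow> dist (?Q y) (?Q x) < e/2"
      by blast
    obtain d3 where d3: "d3 > 0" "ball x d3 \<subseteq> S"
      using assms openE by blast
    define d where "d = min d1 (min d2 d3)"
    \<comment> \<open>keeps \<open>a v + b w\<close> within half the radius \<open>d\<close> for \<open>0 \<le> a, b \<le> s\<close>\<close>
    define N where "N = norm v + norm w + 1"
    define s where "s = d / (2 * N)"
    have d: "d > 0" "d \<le> d1" "d \<le> d2" "d \<le> d3" using d12 d3 unfolding d_def by auto
    have np: "N > 0" by (simp add: N_def add_nonneg_pos)
    have s: "s > 0" using d np by (simp add: s_def)
    have near: "dist (x + a *\<^sub>R v' + b *\<^sub>R w') x < d"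
      if "0 \<le> a" "a \<le> s" "0 \<le> b" "b \<le> s" "v' = v \<and> w' = w \<or> v' = w \<and> w' = v" for a b v' w'
    proof -
      have "norm (a *\<^sub>R v' + b *\<^sub>R w') \<le> a * norm v' + b * norm w'"
        using norm_triangle_ineq[of "a *\<^sub>R v'" "b *\<^sub>R w'"] that by simp
      also have "\<dots> \<le> s * norm v' + s * norm w'"
        using that by (intro add_mono mult_right_mono) auto
      also have "\<dots> \<le> s * N"
        using that s by (auto simp: N_def algebra_simps)
      also have "\<dots> = d / 2" using np by (simp add: s_def)
      also have "\<dots> < d" using d by simp
      finally show ?thesis by (simp add: dist_norm add.assoc)
    qed
    have inS: "x + a *\<^sub>R v' + b *\<^sub>R w' \<in> S"
      if "0 \<le> a" "a \<le> s" "0 \<le> b" "b \<le> s" "v' = v \<and> w' = w \<or> v' = w \<and> w' = v" for a b v' w'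
      using near[OF that] d d3 by (auto simp: dist_commute intro!: subsetD[OF d3(2)])
    obtain a b where ab: "0 < a" "a < s" "0 < b" "b < s"
      and eq1: "f (x + s *\<^sub>R v + s *\<^sub>R w) - f (x + s *\<^sub>R v) - f (x + s *\<^sub>R w) + f x = s * s * ?P (x + a *\<^sub>R v + b *\<^sub>R w)"
      using second_difference[OF s f, of x v w] inS by blast
    obtain a' b' where ab': "0 < a'" "a' < s" "0 < b'" "b' < s"
      and eq2: "f (x + s *\<^sub>R w + s *\<^sub>R v) - f (x + s *\<^sub>R w) - f (x + s *\<^sub>R v) + f x = s * s * ?Q (x + a' *\<^sub>R w + b' *\<^sub>R v)"
      using second_difference[OF s f, of x w v] inS by blast
    have swap: "x + s *\<^sub>R w + s *\<^sub>R v = x + s *\<^sub>R v + s *\<^sub>R w" by (simp add: algebra_simps)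
    have "s * s * ?P (x + a *\<^sub>R v + b *\<^sub>R w) = s * s * ?Q (x + a' *\<^sub>R w + b' *\<^sub>R v)"
      using eq1 eq2 unfolding swap by linarith
    then have "?P (x + a *\<^sub>R v + b *\<^sub>R w) = ?Q (x + a' *\<^sub>R w + b' *\<^sub>R v)"
      using s by simp
    moreover have "dist (?P (x + a *\<^sub>R v + b *\<^sub>R w)) (?P x) < e/2"
      by (rule d12(3)) (use near[of a b v w] ab d in auto)
    moreover have "dist (?Q (x + a' *\<^sub>R w + b' *\<^sub>R v)) (?Q x) < e/2"
      by (rule d12(4)) (use near[of a' b' w v] ab' d in auto)
    ultimately show ?thesis unfolding dist_real_def by linarith
  qed
  then have "\<bar>?P x - ?Q x\<bar> \<le> 0" using field_le_epsilon[of "\<bar>?P x - ?Q x\<bar>" 0] by simp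
  then show ?thesis by simp
qed

text \<open>Three facts rest on this: \<open>d \<circ> d = 0\<close>, the chart independence of \<open>d\<close> (for the second derivative of
  a transition map), and the commutation of \<open>d\<close> with the parameter derivative.\<close>

lemma second_derivative_symmetric:
  fixes f :: "'a::real_normed_vector \<Rightarrow> 'b::euclidean_space"
  assumes "open S" "x \<in> S" and f: "smooth_on S f"
  shows "frechet_derivative (\<lambda>y. frechet_derivative f (at y) v) (at x) w =
    frechet_derivative (\<lambda>y. frechet_derivative f (at y) w) (at x) v"
proof (rule euclidean_eqI)
  fix b :: 'b assume "b \<in> Basis"
  have L: "bounded_linear (\<lambda>z::'b. z \<bullet> b)" by (rule bounded_linear_inner_left)
  have comp: "frechet_derivative (\<lambda>y. g y \<bullet> b) (at y) u = frechet_derivative g (at y) u \<bullet> b"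
    if "smooth_on S g" "y \<in> S" for g :: "'a \<Rightarrow> 'b" and y u
    using frechet_derivative_eqI[OF bounded_linear.has_derivative[OF L smooth_on_has_derivative[OF that]]]
    by simp
  have fb: "smooth_on S (\<lambda>y. f y \<bullet> b)"
    using f Ck_on_linear[OF L assms(1)] unfolding smooth_on_def by blast
  have 2: "frechet_derivative (\<lambda>y. frechet_derivative f (at y) u) (at x) u' \<bullet> b
    = frechet_derivative (\<lambda>y. frechet_derivative (\<lambda>y. f y \<bullet> b) (at y) u) (at x) u'" for u u'
  proof -
    have "frechet_derivative (\<lambda>y. frechet_derivative f (at y) u) (at x) u' \<bullet> b
        = frechet_derivative (\<lambda>y. frechet_derivative f (at y) u \<bullet> b) (at x) u'"
      by (rule comp[symmetric, OF smooth_on_frechet_derivative]) (use assms in auto)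
    also have "frechet_derivative (\<lambda>y. frechet_derivative f (at y) u \<bullet> b) (at x)
        = frechet_derivative (\<lambda>y. frechet_derivative (\<lambda>y. f y \<bullet> b) (at y) u) (at x)"
    proof (rule frechet_derivative_transform_within_open[OF _ assms(1,2)])
      show "(\<lambda>y. frechet_derivative f (at y) u \<bullet> b) differentiable at x"
        using bounded_linear.has_derivative[OF L
            smooth_on_has_derivative[OF smooth_on_frechet_derivative[OF f] assms(2)]] differentiableI by blast
    qed (simp add: comp[OF f])
    finally show ?thesis .
  qed
  show "frechet_derivative (\<lambda>y. frechet_derivative f (at y) v) (at x) w \<bullet> b =
    frechet_derivative (\<lambda>y. frechet_derivative f (at y) w) (at x) v \<bullet> b"
    unfolding 2 by (rule second_derivative_symmetric_real[OF assms(1,2) fb])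
qed

text \<open>A family of forms is, in a chart, a function of the pair \<open>(t, x)\<close>. The next three lemmas
  identify derivatives in \<open>x\<close> alone and in \<open>t\<close> alone with derivatives in the directions
  \<open>(0, v)\<close> and \<open>(1, 0)\<close>.\<close>

lemma smooth_on_snd_slice:
  fixes F :: "real \<times> 'a::euclidean_space \<Rightarrow> real"
  assumes "open J" "open U" "smooth_on (J \<times> U) F" "t \<in> J"
  shows "smooth_on U (\<lambda>x. F (t, x))"
proof (rule smooth_on_compose[OF assms(2) open_Times[OF assms(1,2)] _ assms(3)])
  have "smooth_on U (\<lambda>x. (t, 0) + (0::real, x))"
    by (intro smooth_on_add smooth_on_const smooth_on_linear assms) (simp add: bounded_linear_Pair)
  then show "smooth_on U (\<lambda>x. (t, x))" by simp
qed (use assms in auto)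

lemma frechet_derivative_snd_slice:
  fixes F :: "real \<times> 'a::euclidean_space \<Rightarrow> real"
  assumes "smooth_on (J \<times> U) F" "t \<in> J" "x \<in> U"
  shows "frechet_derivative (\<lambda>y. F (t, y)) (at x) v = frechet_derivative F (at (t, x)) (0, v)"
proof -
  have "((\<lambda>y. (t, y)) has_derivative (\<lambda>v. (0, v))) (at x)"
    by (auto intro!: derivative_eq_intros)
  from diff_chain_at[OF this smooth_on_has_derivative[OF assms(1)]] assms
  show ?thesis using frechet_derivative_eqI[of "\<lambda>y. F (t, y)"] by (simp add: o_def)
qed

lemma DERIV_fst_slice:
  fixes F :: "real \<times> 'a::euclidean_space \<Rightarrow> real"
  assumes "smooth_on (J \<times> U) F" "t \<in> J" "x \<in> U"
  shows "((\<lambda>s. F (s, x)) has_real_derivative frechet_derivative F (at (t, x)) (1, 0)) (at t)"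
proof -
  have F: "(F has_derivative frechet_derivative F (at (t, x))) (at (t, x))"
    using assms smooth_on_has_derivative by blast
  have "((\<lambda>s. (s, x)) has_derivative (\<lambda>h. (h, 0))) (at t)"
    by (auto intro!: derivative_eq_intros)
  from diff_chain_at[OF this F]
  have "((\<lambda>s. F (s, x)) has_derivative (\<lambda>h. frechet_derivative F (at (t, x)) (h *\<^sub>R (1, 0)))) (at t)"
    by (simp add: o_def)
  then show ?thesis
    using has_derivative_bounded_linear[OF F]
    by (simp only: has_field_derivative_def linear_simps(5) real_scaleR_def mult_commute_abs)
qed

section \<open>Antisymmetrisation and the pointwise wedge product\<close>

text \<open>Both the wedge product and the exterior derivative are, up to factorials, this antisymmetrisation of
  an expression that is not alternating. The rules for \<open>d\<close> and \<open>\<and>\<close> in all degrees thereby reduce to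
  reindexing sums over permutations.\<close>

definition Alt :: "nat \<Rightarrow> ((nat \<Rightarrow> 'e) \<Rightarrow> real) \<Rightarrow> (nat \<Rightarrow> 'e) \<Rightarrow> real" where
  "Alt n \<phi> v = (\<Sum>\<sigma> | \<sigma> permutes {..<n}. of_int (sign \<sigma>) * \<phi> (v \<circ> \<sigma>))"

definition tensor ::
    "nat \<Rightarrow> ((nat \<Rightarrow> 'e) \<Rightarrow> real) \<Rightarrow> ((nat \<Rightarrow> 'e) \<Rightarrow> real) \<Rightarrow> (nat \<Rightarrow> 'e) \<Rightarrow> real" where
  "tensor k \<phi> \<psi> v = \<phi> v * \<psi> (\<lambda>i. v (k + i))"

text \<open>Tuples are infinite sequences, so that a function really depends on \<open>k\<close> vectors has to be said. This is
  the part of \<^const>\<open>alternating\<close> that survives for expressions before antisymmetrisation.\<close>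

definition first_args :: "nat \<Rightarrow> ((nat \<Rightarrow> 'e) \<Rightarrow> real) \<Rightarrow> bool" where
  "first_args k \<phi> \<longleftrightarrow> (\<forall>v w. (\<forall>i<k. v i = w i) \<longrightarrow> \<phi> v = \<phi> w)"

lemma first_argsD: "first_args k \<phi> \<Longrightarrow> (\<And>i. i < k \<Longrightarrow> v i = w i) \<Longrightarrow> \<phi> v = \<phi> w"
  by (simp add: first_args_def)

lemma finite_perms: "finite {\<sigma>. \<sigma> permutes {..<n::nat}}"
  by (simp add: finite_permutations)

lemma card_perms: "card {\<sigma>. \<sigma> permutes {..<n::nat}} = fact n"
  using card_permutations[of "{..<n}" n] by simp

lemma sign_comp:
  "\<sigma> permutes {..<n::nat} \<Longrightarrow> \<tau> permutes {..<n} \<Longrightarrow> sign (\<sigma> \<circ> \<tau>) = sign \<sigma> * sign \<tau>"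
  by (meson finite_lessThan permutation_permutes sign_compose)

lemma Alt_cong: "(\<And>\<sigma>. \<sigma> permutes {..<n} \<Longrightarrow> \<phi> (v \<circ> \<sigma>) = \<psi> (v \<circ> \<sigma>)) \<Longrightarrow> Alt n \<phi> v = Alt n \<psi> v"
  unfolding Alt_def by (intro sum.cong) auto

lemma Alt_add: "Alt n (\<lambda>v. \<phi> v + \<psi> v) v = Alt n \<phi> v + Alt n \<psi> v"
  and Alt_scale: "Alt n (\<lambda>v. r * \<phi> v) v = r * Alt n \<phi> v"
  by (simp_all add: Alt_def sum.distrib sum_distrib_left algebra_simps)

lemma Alt_sum: "Alt n (\<lambda>v. \<Sum>i\<in>I. \<phi> i v) v = (\<Sum>i\<in>I. Alt n (\<phi> i) v)"
  unfolding Alt_def sum_distrib_left by (rule sum.swap)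

lemma Alt_reindex:
  assumes "\<tau> permutes {..<n}"
  shows "Alt n (\<lambda>w. \<phi> (w \<circ> \<tau>)) v = of_int (sign \<tau>) * Alt n \<phi> v"
proof -
  have s: "sign \<tau> * sign \<tau> = 1" by (simp add: sign_def)
  have "of_int (sign \<tau>) * Alt n \<phi> v
      = (\<Sum>\<sigma> | \<sigma> permutes {..<n}. of_int (sign \<tau>) * (of_int (sign (\<sigma> \<circ> \<tau>)) * \<phi> (v \<circ> (\<sigma> \<circ> \<tau>))))"
    unfolding Alt_def sum_distrib_left by (rule sum_permutations_compose_right[OF assms])
  also have "\<dots> = Alt n (\<lambda>w. \<phi> (w \<circ> \<tau>)) v"
    unfolding Alt_def
  proof (intro sum.cong refl)
    fix \<sigma> assume "\<sigma> \<in> {\<sigma>. \<sigma> permutes {..<n}}"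
    then have "sign \<tau> * sign (\<sigma> \<circ> \<tau>) = sign \<sigma>"
      using sign_comp assms s by (simp add: mult.left_commute)
    then have "of_int (sign \<tau>) * of_int (sign (\<sigma> \<circ> \<tau>)) = (of_int (sign \<sigma>) :: real)"
      by (metis of_int_mult)
    then show "of_int (sign \<tau>) * (of_int (sign (\<sigma> \<circ> \<tau>)) * \<phi> (v \<circ> (\<sigma> \<circ> \<tau>))) =
      of_int (sign \<sigma>) * \<phi> (v \<circ> \<sigma> \<circ> \<tau>)"
      by (simp add: o_assoc flip: mult.assoc)
  qed
  finally show ?thesis by simp
qed

lemma Alt_permuted_args:
  assumes "\<tau> permutes {..<n}"
  shows "Alt n \<phi> (v \<circ> \<tau>) = of_int (sign \<tau>) * Alt n \<phi> v"
proof -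
  have s: "sign \<tau> * sign \<tau> = 1" by (simp add: sign_def)
  have "of_int (sign \<tau>) * Alt n \<phi> v
      = (\<Sum>\<sigma> | \<sigma> permutes {..<n}. of_int (sign \<tau>) * (of_int (sign (\<tau> \<circ> \<sigma>)) * \<phi> (v \<circ> (\<tau> \<circ> \<sigma>))))"
    unfolding Alt_def sum_distrib_left by (rule setum_permutations_compose_left[OF assms])
  also have "\<dots> = Alt n \<phi> (v \<circ> \<tau>)"
    unfolding Alt_def
  proof (intro sum.cong refl)
    fix \<sigma> assume "\<sigma> \<in> {\<sigma>. \<sigma> permutes {..<n}}"
    then have "sign \<tau> * sign (\<tau> \<circ> \<sigma>) = sign \<sigma>"
      using sign_comp assms s by (simp flip: mult.assoc)
    then have "of_int (sign \<tau>) * of_int (sign (\<tau> \<circ> \<sigma>)) = (of_int (sign \<sigma>) :: real)"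
      by (metis of_int_mult)
    then show "of_int (sign \<tau>) * (of_int (sign (\<tau> \<circ> \<sigma>)) * \<phi> (v \<circ> (\<tau> \<circ> \<sigma>))) =
      of_int (sign \<sigma>) * \<phi> (v \<circ> \<tau> \<circ> \<sigma>)"
      by (simp add: o_assoc flip: mult.assoc)
  qed
  finally show ?thesis by simp
qed

text \<open>The way in which all terms with second derivatives disappear: they are symmetric in two of their
  arguments.\<close>

lemma Alt_symmetric_eq_0:
  assumes "i < n" "j < n" "i \<noteq> j"
    and "\<And>w. \<phi> (w \<circ> Transposition.transpose i j) = \<phi> w"
  shows "Alt n \<phi> v = 0"
proof -
  have "Transposition.transpose i j permutes {..<n}" using assms by (simp add: permutes_swap_id)
  from Alt_reindex[OF this, of \<phi> v] assms show ?thesis by (simp add: sign_swap_id)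
qed

lemma first_args_Alt: "first_args n \<phi> \<Longrightarrow> first_args n (Alt n \<phi>)"
  unfolding first_args_def
proof (intro allI impI)
  fix v w :: "nat \<Rightarrow> 'a"
  assume f: "\<forall>v w. (\<forall>i<n. v i = w i) \<longrightarrow> \<phi> v = \<phi> w" and e: "\<forall>i<n. v i = w i"
  show "Alt n \<phi> v = Alt n \<phi> w"
    unfolding Alt_def
  proof (intro sum.cong refl)
    fix \<sigma> assume "\<sigma> \<in> {\<sigma>. \<sigma> permutes {..<n}}"
    then have "\<forall>i<n. (v \<circ> \<sigma>) i = (w \<circ> \<sigma>) i"
      using e permutes_in_image[of \<sigma> "{..<n}"] by auto
    then show "of_int (sign \<sigma>) * \<phi> (v \<circ> \<sigma>) = of_int (sign \<sigma>) * \<phi> (w \<circ> \<sigma>)"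
      using f by metis
  qed
qed

definition shift_perm :: "nat \<Rightarrow> (nat \<Rightarrow> nat) \<Rightarrow> nat \<Rightarrow> nat" where
  "shift_perm k \<tau> i = (if i < k then i else k + \<tau> (i - k))"

lemma shift_perm_permutes_sign:
  assumes "\<tau> permutes {..<l}"
  shows "shift_perm k \<tau> permutes {..<k + l} \<and> sign (shift_perm k \<tau>) = sign \<tau>"
  using assms finite_lessThan
proof (induction rule: permutes_induct)
  case id
  have "shift_perm k id = id" by (auto simp: shift_perm_def fun_eq_iff)
  then show ?case using permutes_id sign_id unfolding id_def by auto
next
  case (swap a b p)
  have "shift_perm k (Transposition.transpose a b \<circ> p) = Transposition.transpose (k + a) (k + b) \<circ> shift_perm k p"
    by (auto simp: shift_perm_def fun_eq_iff Transposition.transpose_def)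
  moreover have "Transposition.transpose (k + a) (k + b) permutes {..<k + l}" "Transposition.transpose a b permutes {..<l}"
    using swap by (simp_all add: permutes_swap_id)
  ultimately have "shift_perm k (Transposition.transpose a b \<circ> p) permutes {..<k + l} \<and>
      sign (shift_perm k (Transposition.transpose a b \<circ> p)) = sign (Transposition.transpose a b \<circ> p)"
    using swap by (simp add: sign_comp permutes_compose sign_swap_id)
  then show ?case by (simp add: o_def)
qed

text \<open>The inner antisymmetrisation is a signed sum over permutations of the last \<open>l\<close> arguments, each of
  which the outer one absorbs at the price of its sign. That \<open>\<Psi>\<close> may depend on the first \<open>k\<close> arguments
  in any way covers both tensor products and derivatives of a form in the direction of the first
  argument.\<close>

lemma Alt_Alt_right:
  assumes "\<And>v. first_args k (\<lambda>u. \<Psi> u v)"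
  shows "Alt (k + l) (\<lambda>v. Alt l (\<Psi> v) (\<lambda>i. v (k + i))) v
    = fact l * Alt (k + l) (\<lambda>v. \<Psi> v (\<lambda>i. v (k + i))) v"
proof -
  let ?T = "\<lambda>v. \<Psi> v (\<lambda>i. v (k + i))"
  have term_eq: "Alt l (\<Psi> w) (\<lambda>i. w (k + i)) =
      (\<Sum>\<tau> | \<tau> permutes {..<l}. of_int (sign \<tau>) * ?T (w \<circ> shift_perm k \<tau>))" for w
    unfolding Alt_def
  proof (intro sum.cong refl)
    fix \<tau> :: "nat \<Rightarrow> nat"
    have "\<Psi> w = \<Psi> (w \<circ> shift_perm k \<tau>)"
      using first_argsD[OF assms] by (fastforce simp: shift_perm_def)
    then show "of_int (sign \<tau>) * \<Psi> w ((\<lambda>i. w (k + i)) \<circ> \<tau>) =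
        of_int (sign \<tau>) * \<Psi> (w \<circ> shift_perm k \<tau>) (\<lambda>i. (w \<circ> shift_perm k \<tau>) (k + i))"
      by (simp add: shift_perm_def o_def)
  qed
  have "Alt (k + l) (\<lambda>v. Alt l (\<Psi> v) (\<lambda>i. v (k + i))) v =
      (\<Sum>\<tau> | \<tau> permutes {..<l}. of_int (sign \<tau>) * Alt (k + l) (\<lambda>w. ?T (w \<circ> shift_perm k \<tau>)) v)"
    unfolding term_eq Alt_sum by (simp add: Alt_scale)
  also have "\<dots> = (\<Sum>\<tau> | \<tau> permutes {..<l}. Alt (k + l) ?T v)"
  proof (intro sum.cong refl)
    fix \<tau> assume "\<tau> \<in> {\<tau>. \<tau> permutes {..<l}}"
    then have "shift_perm k \<tau> permutes {..<k + l}" "sign (shift_perm k \<tau>) = sign \<tau>"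
      using shift_perm_permutes_sign by auto
    then show "of_int (sign \<tau>) * Alt (k + l) (\<lambda>w. ?T (w \<circ> shift_perm k \<tau>)) v = Alt (k + l) ?T v"
      using Alt_reindex[of "shift_perm k \<tau>" "k + l" ?T v] by (simp add: sign_def)
  qed
  finally show ?thesis by (simp add: card_perms)
qed

lemma Alt_Alt_left:
  "Alt (k + l) (tensor k (Alt k \<phi>) \<psi>) v = fact k * Alt (k + l) (tensor k \<phi> \<psi>) v"
proof -
  have term_eq: "tensor k (Alt k \<phi>) \<psi> w =
      (\<Sum>\<tau> | \<tau> permutes {..<k}. of_int (sign \<tau>) * tensor k \<phi> \<psi> (w \<circ> \<tau>))" for w
    unfolding Alt_def tensor_def sum_distrib_right
  proof (intro sum.cong refl)
    fix \<tau> assume "\<tau> \<in> {\<tau>. \<tau> permutes {..<k}}"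
    then have "\<tau> (k + i) = k + i" for i by (auto intro: permutes_not_in)
    then show "of_int (sign \<tau>) * \<phi> (w \<circ> \<tau>) * \<psi> (\<lambda>i. w (k + i)) =
        of_int (sign \<tau>) * (\<phi> (w \<circ> \<tau>) * \<psi> (\<lambda>i. (w \<circ> \<tau>) (k + i)))"
      by simp
  qed
  have "Alt (k + l) (tensor k (Alt k \<phi>) \<psi>) v =
      (\<Sum>\<tau> | \<tau> permutes {..<k}. of_int (sign \<tau>) * Alt (k + l) (\<lambda>w. tensor k \<phi> \<psi> (w \<circ> \<tau>)) v)"
    unfolding term_eq[abs_def] Alt_sum by (simp add: Alt_scale)
  also have "\<dots> = (\<Sum>\<tau> | \<tau> permutes {..<k}. Alt (k + l) (tensor k \<phi> \<psi>) v)"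
  proof (intro sum.cong refl)
    fix \<tau> assume "\<tau> \<in> {\<tau>. \<tau> permutes {..<k}}"
    then have "\<tau> permutes {..<k + l}" using permutes_subset[of \<tau> "{..<k}" "{..<k + l}"] by auto
    then show "of_int (sign \<tau>) * Alt (k + l) (\<lambda>w. tensor k \<phi> \<psi> (w \<circ> \<tau>)) v = Alt (k + l) (tensor k \<phi> \<psi>) v"
      using Alt_reindex[of \<tau> "k + l" "tensor k \<phi> \<psi>" v] by (simp add: sign_def)
  qed
  finally show ?thesis by (simp add: card_perms)
qed

text \<open>Exchanging two adjacent blocks of arguments is a power of this rotation, and so its sign is easy to find.\<close>

definition rot :: "nat \<Rightarrow> nat \<Rightarrow> nat" where
  "rot n i = (if i < n then Suc i mod n else i)"

text \<open>The rotation of \<open>n + 2\<close> points is the rotation of the first \<open>n + 1\<close> followed by one transposition.\<close>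

lemma rot_permutes_sign: "rot (Suc n) permutes {..<Suc n} \<and> sign (rot (Suc n)) = (-1) ^ n"
proof (induction n)
  case 0
  have "rot (Suc 0) = id" by (auto simp: rot_def)
  moreover have "id permutes {..<Suc 0}" by (rule permutes_id)
  ultimately show ?case by (simp only: sign_id power_0)
next
  case (Suc n)
  have eq: "rot (Suc (Suc n)) = Transposition.transpose 0 (Suc n) \<circ> rot (Suc n)"
  proof
    fix i
    consider "i < n" | "i = n" | "i = Suc n" | "i > Suc n" by linarith
    then show "rot (Suc (Suc n)) i = (Transposition.transpose 0 (Suc n) \<circ> rot (Suc n)) i"
      by cases (auto simp: rot_def Transposition.transpose_def)
  qed
  have "rot (Suc n) permutes {..<Suc (Suc n)}" "Transposition.transpose 0 (Suc n) permutes {..<Suc (Suc n)}"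
    using Suc permutes_subset[of _ "{..<Suc n}" "{..<Suc (Suc n)}"] by (auto simp: permutes_swap_id)
  then show ?case
    unfolding eq using Suc by (simp only: sign_comp permutes_compose sign_swap_id) simp
qed

lemma rot_power: "(rot n ^^ k) i = (if i < n then (i + k) mod n else i)"
  by (induction k) (auto simp: rot_def mod_Suc_eq)

lemma rot_power_permutes_sign:
  "(rot (Suc n) ^^ k) permutes {..<Suc n} \<and> sign (rot (Suc n) ^^ k) = (-1) ^ (n * k)"
proof (induction k)
  case 0
  show ?case by (simp add: permutes_id flip: id_def)
next
  case (Suc k)
  have r: "rot (Suc n) permutes {..<Suc n}" "rot (Suc n) ^^ k permutes {..<Suc n}"
    using Suc rot_permutes_sign[of n] by blast+
  have "rot (Suc n) ^^ Suc k = rot (Suc n) \<circ> rot (Suc n) ^^ k" by simp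
  then show ?case
    using sign_comp[OF r] permutes_compose[OF r(2,1)] Suc rot_permutes_sign[of n]
    by (simp only: power_add mult_Suc_right)
qed

text \<open>The blocks are exchanged by the \<open>l\<close>-th power of the rotation of \<open>k + l = m + 1\<close> points. Its sign
  \<open>(-1)\<close> to the power \<open>m * l\<close> is that of \<open>k * l\<close>, since \<open>m * l + l = k * l + l * l\<close>.\<close>

lemma Alt_tensor_commute:
  assumes "first_args k \<phi>" "first_args l \<psi>"
  shows "Alt (k + l) (tensor k \<phi> \<psi>) v = (-1) ^ (k * l) * Alt (l + k) (tensor l \<psi> \<phi>) v"
proof (cases "k + l")
  case 0
  then have "tensor k \<phi> \<psi> = tensor l \<psi> \<phi>"
    by (simp add: tensor_def mult.commute fun_eq_iff)
  then show ?thesis using 0 by simp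
next
  case (Suc m)
  \<comment> \<open>slot \<open>i\<close> receives the argument \<open>i + l\<close>, cyclically; so the first \<open>k\<close> slots receive the last \<open>k\<close> arguments\<close>
  let ?\<rho> = "rot (Suc m) ^^ l"
  have "tensor k \<phi> \<psi> (w \<circ> ?\<rho>) = tensor l \<psi> \<phi> w" for w
  proof -
    have "\<phi> (w \<circ> ?\<rho>) = \<phi> (\<lambda>i. w (l + i))"
      by (rule first_argsD[OF assms(1)]) (use Suc in \<open>simp add: rot_power add.commute\<close>)
    moreover have "\<psi> (\<lambda>i. (w \<circ> ?\<rho>) (k + i)) = \<psi> w"
    proof (rule first_argsD[OF assms(2)])
      fix i assume "i < l"
      moreover have "(k + i + l) mod (k + l) = i mod (k + l)"
        by (metis add.assoc add.commute mod_add_self2)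
      ultimately show "(w \<circ> ?\<rho>) (k + i) = w i"
        using Suc by (simp add: rot_power)
    qed
    ultimately show ?thesis by (simp add: tensor_def)
  qed
  then have "Alt (k + l) (tensor l \<psi> \<phi>) v = of_int (sign ?\<rho>) * Alt (k + l) (tensor k \<phi> \<psi>) v"
    using Alt_reindex[of ?\<rho> "k + l" "tensor k \<phi> \<psi>" v] rot_power_permutes_sign[where n=m and k=l] Suc by simp
  moreover have "(-1) ^ (m * l) = ((-1) ^ (k * l) :: int)"
  proof -
    have "m * l + l = k * l + l * l" using Suc by (metis add_mult_distrib mult_Suc add.commute)
    then have "even (m * l) \<longleftrightarrow> even (k * l)" by (metis even_add even_mult_iff)
    then show ?thesis by (simp add: minus_one_power_iff)
  qed
  ultimately have "Alt (k + l) (tensor l \<psi> \<phi>) v = (-1) ^ (k * l) * Alt (k + l) (tensor k \<phi> \<psi>) v"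
    using rot_power_permutes_sign[where n=m and k=l] by simp
  then show ?thesis by (simp add: add.commute flip: mult.assoc power_add)
qed

lemma alternating_first_args: "alternating k \<phi> \<Longrightarrow> first_args k \<phi>"
  by (simp add: alternating_def first_args_def)

lemma alternating_linear: "alternating k \<phi> \<Longrightarrow> i < k \<Longrightarrow> linear (\<lambda>u. \<phi> (v(i := u)))"
  by (simp add: alternating_def)

lemma alternating_eq_0: "alternating k \<phi> \<Longrightarrow> i < k \<Longrightarrow> j < k \<Longrightarrow> i \<noteq> j \<Longrightarrow> v i = v j \<Longrightarrow> \<phi> v = 0"
  unfolding alternating_def by blast

text \<open>Polarisation: expand the vanishing value with \<open>v i + v j\<close> in both places.\<close>

lemma alternating_transpose:
  assumes "alternating k \<phi>" "i < k" "j < k" "i \<noteq> j"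
  shows "\<phi> (v \<circ> Transposition.transpose i j) = - \<phi> v"
proof -
  let ?f = "\<lambda>a b. \<phi> (v(i := a, j := b))"
  have add2: "?f a (b + c) = ?f a b + ?f a c" for a b c
    using linear_add[OF alternating_linear[OF assms(1,3)]] .
  have swap: "v(i := a, j := b) = v(j := b, i := a)" for a b
    using assms by (simp add: fun_upd_twist)
  have add1: "?f (a + b) c = ?f a c + ?f b c" for a b c
    unfolding swap using linear_add[OF alternating_linear[OF assms(1,2)]] .
  have diag: "?f a a = 0" for a
    by (rule alternating_eq_0[OF assms]) (use assms in simp)
  have "?f (v i + v j) (v i + v j) = ?f (v i) (v j) + ?f (v j) (v i)"
    using add1 add2 diag by (metis add.left_neutral add.right_neutral add.commute)
  moreover have "v(i := v j, j := v i) = v \<circ> Transposition.transpose i j"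
    by (auto simp: Transposition.transpose_def fun_eq_iff)
  ultimately show ?thesis using diag[of "v i + v j"] by (simp only: fun_upd_triv)
qed

lemma alternating_permute:
  assumes "alternating k \<phi>" "\<sigma> permutes {..<k}"
  shows "\<phi> (v \<circ> \<sigma>) = of_int (sign \<sigma>) * \<phi> v"
  using finite_lessThan assms(2)
proof (induction rule: permutes_rev_induct)
  case (swap a b p)
  then have "Transposition.transpose a b permutes {..<k}" by (simp add: permutes_swap_id)
  then have "\<phi> (v \<circ> (p \<circ> Transposition.transpose a b))
      = of_int (sign (p \<circ> Transposition.transpose a b)) * \<phi> v"
    using swap alternating_transpose[OF assms(1), of a b "v \<circ> p"] sign_comp[of p k "Transposition.transpose a b"]
    by (simp add: sign_swap_id o_assoc) (simp add: o_def)
  then show ?case by (simp add: o_def)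
qed simp

lemma Alt_alternating:
  assumes "alternating k \<phi>"
  shows "Alt k \<phi> v = fact k * \<phi> v"
proof -
  have "Alt k \<phi> v = (\<Sum>\<sigma> | \<sigma> permutes {..<k}. \<phi> v)"
    unfolding Alt_def
    by (intro sum.cong refl) (simp add: alternating_permute[OF assms] sign_def)
  then show ?thesis by (simp add: card_perms)
qed

lemma alternating_Alt:
  fixes \<phi> :: "(nat \<Rightarrow> 'e::real_vector) \<Rightarrow> real"
  assumes loc: "first_args n \<phi>" and lin: "\<And>v i. i < n \<Longrightarrow> linear (\<lambda>u. \<phi> (v(i := u)))"
  shows "alternating n (Alt n \<phi>)"
  unfolding alternating_def
proof (intro conjI allI impI)
  show "Alt n \<phi> v = Alt n \<phi> w" if "\<forall>i<n. v i = w i" for v w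
    using first_args_Alt[OF loc] that by (simp add: first_args_def)
next
  fix v :: "nat \<Rightarrow> 'e" and i assume i: "i < n"
  have "linear (\<lambda>u. of_int (sign \<sigma>) * \<phi> (v(i := u) \<circ> \<sigma>))" if "\<sigma> permutes {..<n}" for \<sigma>
  proof -
    have inj: "inj \<sigma>" and bij: "bij \<sigma>" using that permutes_inj permutes_bij by blast+
    have lt: "inv_into UNIV \<sigma> i < n" using i permutes_in_image[OF permutes_inv[OF that]] by simp
    have "v(i := u) \<circ> \<sigma> = (v \<circ> \<sigma>)(inv_into UNIV \<sigma> i := u)" for u
      using bij by (auto simp: fun_eq_iff bij_inv_eq_iff bij_is_surj surj_f_inv_f)
    then show ?thesis
      using linear_compose_scale_right[OF lin[OF lt], of "of_int (sign \<sigma>)" "v \<circ> \<sigma>"] by simp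
  qed
  then show "linear (\<lambda>u. Alt n \<phi> (v(i := u)))"
    unfolding Alt_def by (intro linear_compose_sum) auto
next
  fix v :: "nat \<Rightarrow> 'e" and i j assume "i < n" "j < n" "i \<noteq> j \<and> v i = v j"
  moreover from this have "v \<circ> Transposition.transpose i j = v" by (auto simp: Transposition.transpose_def fun_eq_iff)
  ultimately show "Alt n \<phi> v = 0"
    using Alt_permuted_args[of "Transposition.transpose i j" n \<phi> v] by (simp add: permutes_swap_id sign_swap_id)
qed

text \<open>Moving one vector from the front to position \<open>m\<close> takes \<open>m\<close> adjacent transpositions.\<close>

lemma alternating_insert:
  assumes "alternating k \<phi>" "m < k"
  shows "\<phi> (\<lambda>j. if j < m then w j else if j = m then x else w (j - 1))
    = (-1) ^ m * \<phi> (\<lambda>j. if j = 0 then x else w (j - 1))"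
  using assms(2)
proof (induction m)
  case 0
  then show ?case by simp
next
  case (Suc m)
  let ?u = "\<lambda>m j. if j < m then w j else if j = m then x else w (j - 1)"
  have "?u (Suc m) = ?u m \<circ> Transposition.transpose m (Suc m)"
    by (auto simp: fun_eq_iff Transposition.transpose_def)
  then have "\<phi> (?u (Suc m)) = - \<phi> (?u m)"
    using alternating_transpose[OF assms(1), of m "Suc m" "?u m"] Suc.prems by simp
  then show ?case using Suc by simp
qed

lemma alternating_tail_permute:
  assumes "alternating k \<phi>" "q permutes {1..k}"
  shows "\<phi> (\<lambda>i. u (q (Suc i))) = of_int (sign q) * \<phi> (\<lambda>i. u (Suc i))"
  using finite_atLeastAtMost assms(2)
proof (induction rule: permutes_rev_induct)
  case (swap a b p)
  then obtain a' b' where ab: "a = Suc a'" "b = Suc b'" "a' < k" "b' < k" "a' \<noteq> b'"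
    by (cases a; cases b) auto
  have "(\<lambda>i. u ((p \<circ> Transposition.transpose a b) (Suc i))) = (\<lambda>i. u (p (Suc i))) \<circ> Transposition.transpose a' b'"
    by (auto simp: fun_eq_iff ab Transposition.transpose_def)
  moreover have "sign (p \<circ> Transposition.transpose a b) = - sign p"
    using swap by (simp add: sign_compose permutation_permutes[of p] sign_swap_id permutation_swap_id
        exI[of "\<lambda>S. finite S \<and> p permutes S" "{1..k}"])
  ultimately have "\<phi> (\<lambda>i. u ((p \<circ> Transposition.transpose a b) (Suc i)))
      = of_int (sign (p \<circ> Transposition.transpose a b)) * \<phi> (\<lambda>i. u (Suc i))"
    using alternating_transpose[OF assms(1) ab(3-5)] swap by simp
  then show ?case by (simp add: o_def)
qed simp

text \<open>The alternating sum over the vector singled out, by which \<^const>\<open>ext_d\<close> is defined, agrees with the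
  full antisymmetrisation: sort the permutations by the image \<open>b\<close> of \<open>0\<close>; each of the \<open>k!\<close> permutations in
  a class contributes the same term.\<close>

lemma Alt_head_tail:
  assumes "\<And>u. alternating k (\<theta> u)"
  shows "Alt (Suc k) (\<lambda>v. \<theta> (v 0) (\<lambda>i. v (Suc i))) v
    = fact k * (\<Sum>i\<le>k. (-1) ^ i * \<theta> (v i) (\<lambda>j. if j < i then v j else v (Suc j)))"
proof -
  let ?f = "\<lambda>\<sigma>. of_int (sign \<sigma>) * \<theta> (v (\<sigma> 0)) (\<lambda>i. v (\<sigma> (Suc i)))"
  let ?g = "\<lambda>b. (-1) ^ b * \<theta> (v b) (\<lambda>j. if j < b then v j else v (Suc j))"
  \<comment> \<open>each \<open>q\<close> fixing \<open>0\<close> is absorbed by the form, and then \<open>v 0\<close> is moved from place \<open>b - 1\<close> to the front\<close>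
  have inner: "?f (Transposition.transpose 0 b \<circ> q) = ?g b" if b: "b \<le> k" and q: "q permutes {1..k}" for b q
  proof -
    have q0: "q 0 = 0" using permutes_not_in[OF q] by simp
    have sgn: "sign (Transposition.transpose 0 b \<circ> q) = (if b = 0 then sign q else - sign q)"
      using q by (simp add: sign_compose permutation_permutes[of q] sign_swap_id permutation_swap_id
        exI[of "\<lambda>S. finite S \<and> q permutes S" "{1..k}"])
    have tail: "\<theta> (v b) (\<lambda>i. v (Transposition.transpose 0 b (q (Suc i))))
        = of_int (sign q) * \<theta> (v b) (\<lambda>i. v (Transposition.transpose 0 b (Suc i)))"
      using alternating_tail_permute[OF assms q, where u="\<lambda>i. v (Transposition.transpose 0 b i)"] .
    show ?thesis
    proof (cases b)
      case 0
      then show ?thesis using tail q0 sgn by (simp add: sign_def)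
    next
      case (Suc m)
      let ?w = "\<lambda>j. if Suc j < b then v (Suc j) else v (Suc (Suc j))"
      have "(\<lambda>i. v (Transposition.transpose 0 b (Suc i))) = (\<lambda>j. if j < m then ?w j else if j = m then v 0 else ?w (j - 1))"
        using Suc by (auto simp: fun_eq_iff Transposition.transpose_def)
      moreover have "(\<lambda>j. if j < b then v j else v (Suc j)) = (\<lambda>j. if j = 0 then v 0 else ?w (j - 1))"
        using Suc by (auto simp: fun_eq_iff)
      ultimately have "\<theta> (v b) (\<lambda>i. v (Transposition.transpose 0 b (Suc i)))
          = (-1) ^ m * \<theta> (v b) (\<lambda>j. if j < b then v j else v (Suc j))"
        using alternating_insert[OF assms, where m=m and w="?w" and x="v 0"] b Suc by simp
      then show ?thesis using tail q0 sgn Suc by (simp add: sign_def)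
    qed
  qed
  have "Alt (Suc k) (\<lambda>v. \<theta> (v 0) (\<lambda>i. v (Suc i))) v = sum ?f {\<sigma>. \<sigma> permutes (insert 0 {1..k})}"
  proof -
    have "{..<Suc k} = insert 0 {1..k}" by auto
    then show ?thesis by (simp add: Alt_def)
  qed
  also have "\<dots> = (\<Sum>b\<in>insert 0 {1..k}. \<Sum>q | q permutes {1..k}. ?f (Transposition.transpose 0 b \<circ> q))"
    by (rule sum_over_permutations_insert) auto
  also have "\<dots> = (\<Sum>b\<in>insert 0 {1..k}. \<Sum>q | q permutes {1..k}. ?g b)"
    by (intro sum.cong refl inner) auto
  also have "insert 0 {1..k} = {..k}" by auto
  finally show ?thesis
    by (simp add: card_permutations sum_distrib_left)
qed

definition pwedge ::
    "nat \<Rightarrow> nat \<Rightarrow> ((nat \<Rightarrow> 'e) \<Rightarrow> real) \<Rightarrow> ((nat \<Rightarrow> 'e) \<Rightarrow> real) \<Rightarrow> (nat \<Rightarrow> 'e) \<Rightarrow> real" where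
  "pwedge k l \<phi> \<psi> v = 1 / (fact k * fact l) * Alt (k + l) (tensor k \<phi> \<psi>) v"

lemma wedge_eq_pwedge: "wedge k l \<omega> \<eta> c x = pwedge k l (\<omega> c x) (\<eta> c x)"
  by (simp add: wedge_def pwedge_def Alt_def tensor_def o_def fun_eq_iff mult.assoc)

lemma first_args_tensor:
  assumes "first_args k \<phi>" "first_args l \<psi>"
  shows "first_args (k + l) (tensor k \<phi> \<psi>)"
  unfolding first_args_def tensor_def
  using first_argsD[OF assms(1)] first_argsD[OF assms(2)] by (metis nat_add_left_cancel_less trans_less_add1)

lemma tensor_linear:
  assumes "alternating k \<phi>" "alternating l \<psi>" "i < k + l"
  shows "linear (\<lambda>u. tensor k \<phi> \<psi> (v(i := u)))"
proof (cases "i < k")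
  case True
  have "tensor k \<phi> \<psi> (v(i := u)) = \<psi> (\<lambda>j. v (k + j)) * \<phi> (v(i := u))" for u
    using True by (simp add: tensor_def)
  then show ?thesis
    using linear_compose_scale_right[OF alternating_linear[OF assms(1) True], of "\<psi> (\<lambda>j. v (k + j))" v] by simp
next
  case False
  then have "(\<lambda>j. (v(i := u)) (k + j)) = (\<lambda>j. v (k + j))(i - k := u)" for u
    by (auto simp: fun_eq_iff)
  moreover have "\<phi> (v(i := u)) = \<phi> v" for u
    by (rule first_argsD[OF alternating_first_args[OF assms(1)]]) (use False in simp)
  ultimately have "tensor k \<phi> \<psi> (v(i := u)) = \<phi> v * \<psi> ((\<lambda>j. v (k + j))(i - k := u))" for u
    by (simp add: tensor_def)
  moreover have "i - k < l" using False assms by simp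
  ultimately show ?thesis
    using linear_compose_scale_right[OF alternating_linear[OF assms(2)], of "i - k" "\<phi> v" "\<lambda>j. v (k + j)"] by simp
qed

lemma alternating_scale: "alternating k \<phi> \<Longrightarrow> alternating k (\<lambda>v. r * \<phi> v)"
  by (simp add: alternating_def linear_compose_scale_right flip: real_scaleR_def)

lemma alternating_add: "alternating k \<phi> \<Longrightarrow> alternating k \<psi> \<Longrightarrow> alternating k (\<lambda>v. \<phi> v + \<psi> v)"
  unfolding alternating_def by (auto intro!: linear_compose_add) metis+

lemma alternating_pwedge:
  assumes "alternating k \<phi>" "alternating l \<psi>"
  shows "alternating (k + l) (pwedge k l \<phi> \<psi>)"
  unfolding pwedge_def
  using assms by (intro alternating_scale alternating_Alt first_args_tensor tensor_linear alternating_first_args)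

lemma tensor_scale: "tensor k (\<lambda>v. r * \<phi> v) \<psi> = (\<lambda>v. r * tensor k \<phi> \<psi> v)"
  "tensor k \<phi> (\<lambda>v. r * \<psi> v) = (\<lambda>v. r * tensor k \<phi> \<psi> v)"
  by (simp_all add: tensor_def fun_eq_iff)

text \<open>Both sides are multiples of the antisymmetrisation of the triple tensor product.\<close>

lemma pwedge_assoc:
  assumes "first_args k \<phi>"
  shows "pwedge (k + l) m (pwedge k l \<phi> \<psi>) \<zeta> = pwedge k (l + m) \<phi> (pwedge l m \<psi> \<zeta>)"
proof
  fix v
  have "Alt (k + (l + m)) (tensor k \<phi> (Alt (l + m) (tensor l \<psi> \<zeta>))) v
      = fact (l + m) * Alt (k + (l + m)) (tensor k \<phi> (tensor l \<psi> \<zeta>)) v"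
    using Alt_Alt_right[of k "\<lambda>u w. \<phi> u * tensor l \<psi> \<zeta> w" "l + m" v] assms
    by (simp add: Alt_scale tensor_def[of k, abs_def] first_args_def)
  moreover have "Alt (k + l + m) (tensor (k + l) (Alt (k + l) (tensor k \<phi> \<psi>)) \<zeta>) v
      = fact (k + l) * Alt (k + l + m) (tensor (k + l) (tensor k \<phi> \<psi>) \<zeta>) v"
    by (rule Alt_Alt_left)
  moreover have "tensor (k + l) (tensor k \<phi> \<psi>) \<zeta> = tensor k \<phi> (tensor l \<psi> \<zeta>)"
    by (simp add: tensor_def fun_eq_iff add.assoc)
  ultimately show "pwedge (k + l) m (pwedge k l \<phi> \<psi>) \<zeta> v = pwedge k (l + m) \<phi> (pwedge l m \<psi> \<zeta>) v"
    unfolding pwedge_def[abs_def] tensor_scale Alt_scale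
    by (simp add: add.assoc)
qed

lemma pwedge_commute:
  assumes "first_args k \<phi>" "first_args l \<psi>"
  shows "pwedge k l \<phi> \<psi> v = (-1) ^ (k * l) * pwedge l k \<psi> \<phi> v"
  using Alt_tensor_commute[OF assms, of v] by (simp add: pwedge_def mult.commute)

lemma pwedge_add_left: "pwedge k l (\<lambda>v. \<phi> v + \<xi> v) \<psi> v = pwedge k l \<phi> \<psi> v + pwedge k l \<xi> \<psi> v"
  and pwedge_add_right: "pwedge k l \<phi> (\<lambda>v. \<psi> v + \<xi> v) v = pwedge k l \<phi> \<psi> v + pwedge k l \<phi> \<xi> v"
  by (simp_all add: pwedge_def tensor_def[abs_def] Alt_add add_divide_distrib distrib_left distrib_right)

lemma pwedge_scale_left: "pwedge k l (\<lambda>v. r * \<phi> v) \<psi> v = r * pwedge k l \<phi> \<psi> v"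
  and pwedge_scale_right: "pwedge k l \<phi> (\<lambda>v. r * \<psi> v) v = r * pwedge k l \<phi> \<psi> v"
  by (simp_all add: pwedge_def tensor_scale Alt_scale)

lemma pwedge_0:
  assumes "first_args 0 \<phi>" "alternating l \<psi>"
  shows "pwedge 0 l \<phi> \<psi> v = \<phi> v * \<psi> v"
proof -
  have "\<phi> w = \<phi> v" for w by (rule first_argsD[OF assms(1)]) simp
  then have "tensor 0 \<phi> \<psi> = (\<lambda>w. \<phi> v * \<psi> w)" by (simp add: tensor_def fun_eq_iff)
  then show ?thesis by (simp add: pwedge_def Alt_scale Alt_alternating[OF assms(2)])
qed

text \<open>For a one-form on the left, the sum over permutations collapses to one over the argument that the
  one-form receives.\<close>

lemma pwedge_1:
  assumes "first_args 1 a" "alternating l \<psi>"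
  shows "pwedge 1 l a \<psi> v = (\<Sum>i\<le>l. (-1) ^ i * (a (\<lambda>_. v i) * \<psi> (\<lambda>j. if j < i then v j else v (Suc j))))"
proof -
  have "tensor 1 a \<psi> = (\<lambda>v. a (\<lambda>_. v 0) * \<psi> (\<lambda>i. v (Suc i)))"
  proof
    fix v
    have "a v = a (\<lambda>_. v 0)" by (rule first_argsD[OF assms(1)]) simp
    then show "tensor 1 a \<psi> v = a (\<lambda>_. v 0) * \<psi> (\<lambda>i. v (Suc i))" by (simp add: tensor_def)
  qed
  then show ?thesis
    using Alt_head_tail[of l "\<lambda>u w. a (\<lambda>_. u) * \<psi> w" v] alternating_scale[OF assms(2)]
    by (simp add: pwedge_def)
qed

section \<open>Differential forms and the exterior derivative\<close>

lemma smooth_on_Alt: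
  assumes "open S" "\<And>v. smooth_on S (\<lambda>z. \<phi> z v)"
  shows "smooth_on S (\<lambda>z. Alt n (\<phi> z) v)"
  unfolding Alt_def by (intro smooth_on_sum smooth_on_mult smooth_on_const assms finite_perms)

lemma smooth_on_pwedge:
  assumes "open S" "\<And>v. smooth_on S (\<lambda>z. \<phi> z v)" "\<And>v. smooth_on S (\<lambda>z. \<psi> z v)"
  shows "smooth_on S (\<lambda>z. pwedge k l (\<phi> z) (\<psi> z) v)"
  unfolding pwedge_def tensor_def
  by (intro smooth_on_Alt[where \<phi>="\<lambda>z v. \<phi> z v * \<psi> z (\<lambda>i. v (k + i))"] smooth_on_mult smooth_on_const assms)

lemma Alt_divide: "Alt n (\<lambda>v. \<phi> v / r) v = Alt n \<phi> v / r"
  using Alt_scale[of n "inverse r" \<phi> v] by (simp add: divide_inverse mult.commute)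

lemma Alt_0 [simp]: "Alt n (\<lambda>v. 0) v = 0" by (simp add: Alt_def)

lemma alternating_0: "alternating k (\<lambda>v. 0)"
  by (simp add: alternating_def linear_zero)

lemma alternating_expand:
  fixes \<phi> :: "(nat \<Rightarrow> 'e::euclidean_space) \<Rightarrow> real"
  assumes "alternating k \<phi>" "m < k"
  shows "\<phi> (v(m := w)) = (\<Sum>b\<in>Basis. (w \<bullet> b) * \<phi> (v(m := b)))"
proof -
  interpret linear "\<lambda>u. \<phi> (v(m := u))" by (rule alternating_linear[OF assms])
  show ?thesis
    by (subst euclidean_representation[of w, symmetric]) (simp only: sum scaleR real_scaleR_def)
qed

text \<open>The product rule for a multilinear form whose base point and arguments all move, as happens when
  a form is pulled back. It is proved by letting one more argument vary at a time; expanding that argument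
  in a basis reduces each step to the product rule for functions.\<close>

lemma has_derivative_alternating_args:
  fixes \<Phi> :: "'e::euclidean_space \<Rightarrow> (nat \<Rightarrow> 'e) \<Rightarrow> real" and \<phi> :: "'a::real_normed_vector \<Rightarrow> 'e"
  assumes alt: "\<And>y. alternating k (\<Phi> y)" and altD: "\<And>h. alternating k (D\<Phi> h)"
    and \<Phi>: "\<And>v. ((\<lambda>y. \<Phi> y v) has_derivative (\<lambda>h. D\<Phi> h v)) (at (\<phi> x))"
    and \<phi>: "(\<phi> has_derivative \<phi>') (at x)"
    and W: "\<And>j. (W j has_derivative W' j) (at x)"
  shows "((\<lambda>z. \<Phi> (\<phi> z) (\<lambda>j. W j z)) has_derivative
    (\<lambda>h. D\<Phi> (\<phi>' h) (\<lambda>j. W j x) + (\<Sum>j<k. \<Phi> (\<phi> x) ((\<lambda>i. W i x)(j := W' j h))))) (at x)"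
proof -
  let ?v = "\<lambda>m u z j. if j < m then W j z else (u j :: 'e)"
  \<comment> \<open>only the first \<open>m\<close> arguments vary, the others are constants \<open>u\<close>\<close>
  have part: "((\<lambda>z. \<Phi> (\<phi> z) (?v m u z)) has_derivative
    (\<lambda>h. D\<Phi> (\<phi>' h) (?v m u x) + (\<Sum>j<m. \<Phi> (\<phi> x) ((?v m u x)(j := W' j h))))) (at x)"
    if "m \<le> k" for m u
    using that
  proof (induction m arbitrary: u)
    case 0
    then show ?case using diff_chain_at[OF \<phi> \<Phi>[of u]] by (simp add: o_def)
  next
    case (Suc m)
    then have m: "m < k" by simp
    have upd: "?v (Suc m) u z = (?v m u z)(m := W m z)" "?v m (u(m := b)) z = (?v m u z)(m := b)" for z b
      by (auto simp: fun_eq_iff less_Suc_eq)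
    let ?G = "\<lambda>b h. D\<Phi> (\<phi>' h) ((?v m u x)(m := b)) + (\<Sum>j<m. \<Phi> (\<phi> x) ((?v m u x)(m := b, j := W' j h)))"
    have IH: "((\<lambda>z. \<Phi> (\<phi> z) ((?v m u z)(m := b))) has_derivative ?G b) (at x)" for b
      unfolding upd(2)[symmetric] by (rule Suc.IH) (use m in simp)
    have "((\<lambda>z. \<Sum>b\<in>Basis. (W m z \<bullet> b) * \<Phi> (\<phi> z) ((?v m u z)(m := b))) has_derivative
        (\<lambda>h. \<Sum>b\<in>Basis. (W m x \<bullet> b) * ?G b h + (W' m h \<bullet> b) * \<Phi> (\<phi> x) ((?v m u x)(m := b)))) (at x)"
      by (intro has_derivative_sum has_derivative_mult IH
          bounded_linear.has_derivative[OF bounded_linear_inner_left W])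
    moreover have "(\<lambda>z. \<Sum>b\<in>Basis. (W m z \<bullet> b) * \<Phi> (\<phi> z) ((?v m u z)(m := b))) = (\<lambda>z. \<Phi> (\<phi> z) (?v (Suc m) u z))"
      unfolding upd(1) by (intro ext alternating_expand[OF alt m, symmetric])
    moreover have "(\<Sum>b\<in>Basis. (W m x \<bullet> b) * ?G b h + (W' m h \<bullet> b) * \<Phi> (\<phi> x) ((?v m u x)(m := b)))
        = D\<Phi> (\<phi>' h) (?v (Suc m) u x) + (\<Sum>j<Suc m. \<Phi> (\<phi> x) ((?v (Suc m) u x)(j := W' j h)))" for h
    proof -
      have 1: "(\<Sum>b\<in>Basis. (W m x \<bullet> b) * D\<Phi> (\<phi>' h) ((?v m u x)(m := b))) = D\<Phi> (\<phi>' h) (?v (Suc m) u x)"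
        unfolding upd(1) by (rule alternating_expand[OF altD m, symmetric])
      have "(\<Sum>b\<in>Basis. (W m x \<bullet> b) * (\<Sum>j<m. \<Phi> (\<phi> x) ((?v m u x)(m := b, j := W' j h))))
          = (\<Sum>j<m. \<Sum>b\<in>Basis. (W m x \<bullet> b) * \<Phi> (\<phi> x) ((?v m u x)(m := b, j := W' j h)))"
        unfolding sum_distrib_left by (rule sum.swap)
      also have "\<dots> = (\<Sum>j<m. \<Phi> (\<phi> x) ((?v (Suc m) u x)(j := W' j h)))"
      proof (intro sum.cong refl)
        fix j assume "j \<in> {..<m}"
        then have tw: "f(m := b, j := c) = f(j := c, m := b)" for f :: "nat \<Rightarrow> 'e" and b c
          by (simp add: fun_upd_twist)
        show "(\<Sum>b\<in>Basis. (W m x \<bullet> b) * \<Phi> (\<phi> x) ((?v m u x)(m := b, j := W' j h)))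
            = \<Phi> (\<phi> x) ((?v (Suc m) u x)(j := W' j h))"
          unfolding upd(1) tw by (rule alternating_expand[OF alt m, symmetric])
      qed
      finally have 2: "(\<Sum>b\<in>Basis. (W m x \<bullet> b) * (\<Sum>j<m. \<Phi> (\<phi> x) ((?v m u x)(m := b, j := W' j h))))
          = (\<Sum>j<m. \<Phi> (\<phi> x) ((?v (Suc m) u x)(j := W' j h)))" .
      have 3: "(\<Sum>b\<in>Basis. (W' m h \<bullet> b) * \<Phi> (\<phi> x) ((?v m u x)(m := b)))
          = \<Phi> (\<phi> x) ((?v (Suc m) u x)(m := W' m h))"
        unfolding upd(1) fun_upd_upd by (rule alternating_expand[OF alt m, symmetric])
      show ?thesis
        by (simp only: sum.distrib distrib_left 1 2 3 sum.lessThan_Suc add.assoc)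
    qed
    ultimately show ?case by (simp only:)
  qed
  have eq: "\<Theta> (?v k (\<lambda>_. 0) z) = \<Theta> (\<lambda>j. W j z)" if "alternating k \<Theta>" for \<Theta> z
    by (rule first_argsD[OF alternating_first_args[OF that]]) simp
  have eq2: "\<Theta> ((?v k (\<lambda>_. 0) z)(j := w)) = \<Theta> ((\<lambda>j. W j z)(j := w))" if "alternating k \<Theta>" for \<Theta> z j w
    by (rule first_argsD[OF alternating_first_args[OF that]]) simp
  show ?thesis
    using part[OF order_refl, of "\<lambda>_. 0"] by (simp only: eq[OF alt] eq[OF altD] eq2[OF alt])
qed

lemma im_chart_point:
  assumes "x \<in> im_chart c"
  obtains p where "p \<in> dom_chart c" "x = coord c p"
  using assms by (auto simp: im_chart_def)

text \<open>Since forms vanish outside their charts, the algebraic identities hold at every point and can be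
  differentiated without restricting to a neighbourhood.\<close>

lemma forms_alternating: "\<omega> \<in> forms A k \<Longrightarrow> alternating k (\<omega> c x)"
proof (cases "c \<in> A \<and> x \<in> im_chart c")
  case False
  assume "\<omega> \<in> forms A k"
  then have "\<omega> c x v = 0" for v using False unfolding forms_def by blast
  then have "\<omega> c x = (\<lambda>v. 0)" by (rule ext)
  then show ?thesis using alternating_0 by metis
next
  case True
  then show "\<omega> \<in> forms A k \<Longrightarrow> ?thesis" unfolding forms_def by blast
qed

lemma forms_smooth: "\<omega> \<in> forms A k \<Longrightarrow> c \<in> A \<Longrightarrow> smooth_on (im_chart c) (\<lambda>x. \<omega> c x v)"
  unfolding forms_def by blast

lemma forms_transition:
  "\<omega> \<in> forms A k \<Longrightarrow> c \<in> A \<Longrightarrow> c' \<in> A \<Longrightarrow> p \<in> dom_chart c \<Longrightarrow> p \<in> dom_chart c' \<Longrightarrow>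
    \<omega> c (coord c p) v = \<omega> c' (coord c' p) (\<lambda>i. frechet_derivative (transition c c') (at (coord c p)) (v i))"
  unfolding forms_def by blast

lemma forms_outside: "\<omega> \<in> forms A k \<Longrightarrow> c \<notin> A \<or> x \<notin> im_chart c \<Longrightarrow> \<omega> c x v = 0"
  unfolding forms_def by blast

lemma formsI:
  assumes "\<And>c x. c \<in> A \<Longrightarrow> x \<in> im_chart c \<Longrightarrow> alternating k (\<omega> c x)"
    and "\<And>c v. c \<in> A \<Longrightarrow> smooth_on (im_chart c) (\<lambda>x. \<omega> c x v)"
    and "\<And>c c' p v. c \<in> A \<Longrightarrow> c' \<in> A \<Longrightarrow> p \<in> dom_chart c \<Longrightarrow> p \<in> dom_chart c' \<Longrightarrow>
      \<omega> c (coord c p) v = \<omega> c' (coord c' p) (\<lambda>i. frechet_derivative (transition c c') (at (coord c p)) (v i))"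
    and "\<And>c x v. c \<notin> A \<or> x \<notin> im_chart c \<Longrightarrow> \<omega> c x v = 0"
  shows "\<omega> \<in> forms A k"
  using assms unfolding forms_def by blast

lemma forms_eqI:
  assumes "\<omega> \<in> forms A k" "\<eta> \<in> forms A l"
    and "\<And>c x v. c \<in> A \<Longrightarrow> x \<in> im_chart c \<Longrightarrow> \<omega> c x v = \<eta> c x v"
  shows "\<omega> = \<eta>"
proof (intro ext)
  fix c x v
  show "\<omega> c x v = \<eta> c x v"
    using assms(3) forms_outside[OF assms(1)] forms_outside[OF assms(2)] by metis
qed

text \<open>The derivative of the coordinate expression with its arguments held fixed. It depends on the
  chart; only its antisymmetrisation is a form.\<close>

definition dir_D :: "('m, 'e::euclidean_space) form \<Rightarrow> ('m, 'e) chart \<Rightarrow> 'e \<Rightarrow> 'e \<Rightarrow> (nat \<Rightarrow> 'e) \<Rightarrow> real" where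
  "dir_D \<omega> c x u w = frechet_derivative (\<lambda>y. \<omega> c y w) (at x) u"

locale manifold =
  fixes A :: "('m::{t2_space,second_countable_topology}, 'e::euclidean_space) atlas"
  assumes atlas: "smooth_atlas A"
begin

lemma open_im: "c \<in> A \<Longrightarrow> open (im_chart c)"
  using atlas by (simp add: smooth_atlas_def)

lemma open_dom: "c \<in> A \<Longrightarrow> open (dom_chart c)"
  using atlas by (simp add: smooth_atlas_def)

lemma chart_homeomorphism: "c \<in> A \<Longrightarrow> homeomorphism (dom_chart c) (im_chart c) (coord c) (inv_chart c)"
  using atlas by (simp add: smooth_atlas_def)

lemma inv_chart_coord: "c \<in> A \<Longrightarrow> p \<in> dom_chart c \<Longrightarrow> inv_chart c (coord c p) = p"
  using chart_homeomorphism by (simp add: homeomorphism_def)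

lemma coord_in_im: "p \<in> dom_chart c \<Longrightarrow> coord c p \<in> im_chart c"
  by (simp add: im_chart_def)

lemma open_coord_image:
  assumes "c \<in> A" "open U"
  shows "open (coord c ` (U \<inter> dom_chart c))"
proof -
  have "openin (top_of_set (dom_chart c)) (U \<inter> dom_chart c)"
    using assms by (metis inf_commute openin_open_Int)
  then have "openin (top_of_set (im_chart c)) (coord c ` (U \<inter> dom_chart c))"
    using homeomorphism_imp_open_map[OF chart_homeomorphism[OF assms(1)]] by blast
  then show ?thesis using open_im[OF assms(1)] openin_open_trans by blast
qed

lemma form_has_derivative:
  "\<omega> \<in> forms A k \<Longrightarrow> c \<in> A \<Longrightarrow> x \<in> im_chart c \<Longrightarrow>
    ((\<lambda>y. \<omega> c y w) has_derivative (\<lambda>u. dir_D \<omega> c x u w)) (at x)"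
  unfolding dir_D_def using smooth_on_has_derivative[OF forms_smooth] by blast

lemma dir_D_eqI: "((\<lambda>y. \<omega> c y w) has_derivative D) (at x) \<Longrightarrow> dir_D \<omega> c x u w = D u"
  unfolding dir_D_def using frechet_derivative_eqI by metis

lemma dir_D_linear:
  assumes "\<omega> \<in> forms A k" "c \<in> A" "x \<in> im_chart c"
  shows "linear (\<lambda>u. dir_D \<omega> c x u w)"
  using form_has_derivative[OF assms] has_derivative_linear by blast

lemma alternating_dir_D:
  assumes "\<omega> \<in> forms A k" "c \<in> A" "x \<in> im_chart c"
  shows "alternating k (dir_D \<omega> c x u)"
  unfolding alternating_def
proof (intro conjI allI impI)
  note der = form_has_derivative[OF assms]
  note alt = forms_alternating[OF assms(1)]
  fix v w :: "nat \<Rightarrow> 'e" and i j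
  show "dir_D \<omega> c x u v = dir_D \<omega> c x u w" if "\<forall>i<k. v i = w i"
  proof -
    have "\<omega> c y v = \<omega> c y w" for y
      using first_argsD[OF alternating_first_args[OF alt]] that by blast
    then show ?thesis by (simp add: dir_D_def)
  qed
  show "linear (\<lambda>a. dir_D \<omega> c x u (v(i := a)))" if "i < k"
  proof (rule linearI)
    note lin = alternating_linear[OF alt that]
    show "dir_D \<omega> c x u (v(i := a + b)) = dir_D \<omega> c x u (v(i := a)) + dir_D \<omega> c x u (v(i := b))" for a b
      unfolding dir_D_def[of \<omega> c x u "v(i := a + b)"] linear_add[OF lin]
      by (subst frechet_derivative_eqI[OF has_derivative_add[OF der der]]) (rule refl)
    show "dir_D \<omega> c x u (v(i := r *\<^sub>R a)) = r *\<^sub>R dir_D \<omega> c x u (v(i := a))" for r a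
      unfolding dir_D_def[of \<omega> c x u "v(i := r *\<^sub>R a)"] linear_scale[OF lin]
      by (subst frechet_derivative_eqI[OF has_derivative_scaleR_right[OF der]]) (rule refl)
  qed
  show "dir_D \<omega> c x u v = 0" if "i < k" "j < k" "i \<noteq> j \<and> v i = v j"
  proof -
    have "\<omega> c y v = 0" for y using alternating_eq_0[OF alt] that by blast
    then show ?thesis by (simp add: dir_D_def)
  qed
qed

lemma ext_d_outside: "c \<notin> A \<or> x \<notin> im_chart c \<Longrightarrow> ext_d A k \<omega> c x v = 0"
  by (auto simp: ext_d_def)

lemma ext_d_sum:
  "c \<in> A \<Longrightarrow> x \<in> im_chart c \<Longrightarrow>
    ext_d A k \<omega> c x v = (\<Sum>i\<le>k. (-1) ^ i * dir_D \<omega> c x (v i) (\<lambda>j. if j < i then v j else v (Suc j)))"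
  by (simp add: ext_d_def dir_D_def)

text \<open>The description of \<open>d\<close> from which its properties follow.\<close>

lemma ext_d_Alt:
  assumes "\<omega> \<in> forms A k" "c \<in> A" "x \<in> im_chart c"
  shows "ext_d A k \<omega> c x v = 1 / fact k * Alt (Suc k) (\<lambda>v. dir_D \<omega> c x (v 0) (\<lambda>i. v (Suc i))) v"
  using Alt_head_tail[of k "dir_D \<omega> c x" v, OF alternating_dir_D[OF assms]] ext_d_sum[OF assms(2,3), of k \<omega> v]
  by simp

lemma first_args_dir_D:
  assumes "\<omega> \<in> forms A k" "c \<in> A" "x \<in> im_chart c"
  shows "first_args (Suc k) (\<lambda>v. dir_D \<omega> c x (v 0) (\<lambda>i. v (Suc i)))"
  unfolding first_args_def
proof (intro allI impI)
  fix v w :: "nat \<Rightarrow> 'e" assume e: "\<forall>i<Suc k. v i = w i"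
  have "dir_D \<omega> c x u (\<lambda>i. v (Suc i)) = dir_D \<omega> c x u (\<lambda>i. w (Suc i))" for u
    by (rule first_argsD[OF alternating_first_args[OF alternating_dir_D[OF assms]]]) (use e in auto)
  then show "dir_D \<omega> c x (v 0) (\<lambda>i. v (Suc i)) = dir_D \<omega> c x (w 0) (\<lambda>i. w (Suc i))" using e by simp
qed

lemma alternating_ext_d:
  assumes "\<omega> \<in> forms A k"
  shows "alternating (Suc k) (ext_d A k \<omega> c x)"
proof (cases "c \<in> A \<and> x \<in> im_chart c")
  case True
  then have cx: "c \<in> A" "x \<in> im_chart c" by auto
  have "linear (\<lambda>u. dir_D \<omega> c x ((v(i := u)) 0) (\<lambda>j. (v(i := u)) (Suc j)))" if "i < Suc k" for v i
  proof (cases i)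
    case 0
    then show ?thesis using dir_D_linear[OF assms cx] by simp
  next
    case (Suc j)
    then have "(\<lambda>l. (v(i := u)) (Suc l)) = (\<lambda>l. v (Suc l))(j := u)" for u by auto
    then show ?thesis using Suc that alternating_linear[OF alternating_dir_D[OF assms cx]] by simp
  qed
  then have "alternating (Suc k) (\<lambda>v. 1 / fact k * Alt (Suc k) (\<lambda>v. dir_D \<omega> c x (v 0) (\<lambda>i. v (Suc i))) v)"
    by (intro alternating_scale alternating_Alt first_args_dir_D[OF assms cx])
  then show ?thesis using ext_d_Alt[OF assms cx] by presburger
next
  case False
  then have "ext_d A k \<omega> c x = (\<lambda>v. 0)" by (auto simp: ext_d_outside)
  then show ?thesis using alternating_0 by metis
qed

lemma smooth_ext_d:
  assumes "\<omega> \<in> forms A k" "c \<in> A"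
  shows "smooth_on (im_chart c) (\<lambda>x. ext_d A k \<omega> c x v)"
proof (rule smooth_on_cong)
  show "smooth_on (im_chart c)
      (\<lambda>x. \<Sum>i\<le>k. (-1) ^ i * frechet_derivative (\<lambda>y. \<omega> c y (\<lambda>j. if j < i then v j else v (Suc j))) (at x) (v i))"
    using open_im[OF assms(2)] forms_smooth[OF assms]
    by (intro smooth_on_sum smooth_on_mult smooth_on_const smooth_on_frechet_derivative) auto
qed (use assms open_im in \<open>simp_all add: ext_d_def\<close>)

lemma transition_smooth:
  "c \<in> A \<Longrightarrow> c' \<in> A \<Longrightarrow> smooth_on (coord c ` (dom_chart c \<inter> dom_chart c')) (transition c c')"
  using atlas by (simp add: smooth_atlas_def)

lemma transition_coord: "c \<in> A \<Longrightarrow> p \<in> dom_chart c \<Longrightarrow> transition c c' (coord c p) = coord c' p"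
  by (simp add: transition_def inv_chart_coord)

text \<open>Differentiating the pullback produces the wanted term and, for each argument, one with the second
  derivative of the transition map. The latter is symmetric in the direction of differentiation and
  that argument, so it does not survive antisymmetrisation.\<close>

lemma ext_d_transition:
  assumes \<omega>: "\<omega> \<in> forms A k" and c: "c \<in> A" "c' \<in> A" and p: "p \<in> dom_chart c" "p \<in> dom_chart c'"
  defines "T \<equiv> frechet_derivative (transition c c') (at (coord c p))"
  shows "ext_d A k \<omega> c (coord c p) v = ext_d A k \<omega> c' (coord c' p) (\<lambda>i. T (v i))"
proof -
  let ?\<phi> = "transition c c'"
  let ?U = "coord c ` (dom_chart c \<inter> dom_chart c')"
  let ?x = "coord c p" and ?y = "coord c' p"
  have U: "open ?U" "?x \<in> ?U"
    using open_coord_image[OF c(1) open_dom[OF c(2)]] p by (auto simp: Int_commute)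
  have sm: "smooth_on ?U ?\<phi>" by (rule transition_smooth[OF c])
  have im: "?x \<in> im_chart c" "?y \<in> im_chart c'" using coord_in_im[OF p(1)] coord_in_im[OF p(2)] by blast+
  have \<phi>x: "?\<phi> ?x = ?y" using transition_coord c p by blast
  \<comment> \<open>the second derivative of the transition map\<close>
  define S where "S w u = frechet_derivative (\<lambda>y. frechet_derivative ?\<phi> (at y) w) (at ?x) u" for w u
  have S_sym: "S w u = S u w" for u w
    unfolding S_def by (rule second_derivative_symmetric[OF U sm])
  let ?R = "\<lambda>j u w. \<omega> c' ?y ((\<lambda>i. T (w i))(j := S (w j) u))"
  have D: "dir_D \<omega> c ?x u w = dir_D \<omega> c' ?y (T u) (\<lambda>i. T (w i)) + (\<Sum>j<k. ?R j u w)" for u w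
  proof (rule dir_D_eqI)
    have "((\<lambda>z. \<omega> c' (?\<phi> z) (\<lambda>j. frechet_derivative ?\<phi> (at z) (w j))) has_derivative
      (\<lambda>h. dir_D \<omega> c' ?y (T h) (\<lambda>i. T (w i)) + (\<Sum>j<k. ?R j h w))) (at ?x)"
      unfolding T_def S_def \<phi>x[symmetric]
    proof (rule has_derivative_alternating_args)
      show "(?\<phi> has_derivative frechet_derivative ?\<phi> (at ?x)) (at ?x)"
        using smooth_on_has_derivative[OF sm U(2)] .
      show "((\<lambda>z. frechet_derivative ?\<phi> (at z) (w j)) has_derivative
         frechet_derivative (\<lambda>y. frechet_derivative ?\<phi> (at y) (w j)) (at ?x)) (at ?x)" for j
        using smooth_on_has_derivative[OF smooth_on_frechet_derivative[OF sm] U(2)] .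
    qed (use \<omega> c im in \<open>auto simp: \<phi>x intro: forms_alternating alternating_dir_D form_has_derivative\<close>)
    then show "((\<lambda>z. \<omega> c z w) has_derivative
      (\<lambda>h. dir_D \<omega> c' ?y (T h) (\<lambda>i. T (w i)) + (\<Sum>j<k. ?R j h w))) (at ?x)"
    proof (rule has_derivative_transform_within_open[OF _ U])
      show "\<omega> c' (?\<phi> z) (\<lambda>j. frechet_derivative ?\<phi> (at z) (w j)) = \<omega> c z w" if "z \<in> ?U" for z
      proof -
        obtain q where q: "q \<in> dom_chart c" "q \<in> dom_chart c'" and z: "z = coord c q"
          using \<open>z \<in> ?U\<close> by blast
        show ?thesis
          unfolding z transition_coord[OF c(1) q(1)] by (rule forms_transition[OF \<omega> c q, symmetric])
      qed
    qed
  qed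
  have "Alt (Suc k) (\<lambda>v. ?R j (v 0) (\<lambda>i. v (Suc i))) v = 0" if "j < k" for j v
  proof (rule Alt_symmetric_eq_0[of 0 _ "Suc j"])
    fix w :: "nat \<Rightarrow> 'e"
    have "(\<lambda>i. T ((w \<circ> Transposition.transpose 0 (Suc j)) (Suc i)))
        (j := S ((w \<circ> Transposition.transpose 0 (Suc j)) (Suc j)) ((w \<circ> Transposition.transpose 0 (Suc j)) 0))
      = (\<lambda>i. T (w (Suc i)))(j := S (w (Suc j)) (w 0))"
      using S_sym[of "w 0" "w (Suc j)"] by (auto simp: fun_eq_iff Transposition.transpose_def)
    then show "?R j ((w \<circ> Transposition.transpose 0 (Suc j)) 0) (\<lambda>i. (w \<circ> Transposition.transpose 0 (Suc j)) (Suc i))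
      = ?R j (w 0) (\<lambda>i. w (Suc i))"
      by simp
  qed (use that in auto)
  then have "Alt (Suc k) (\<lambda>v. dir_D \<omega> c ?x (v 0) (\<lambda>i. v (Suc i))) v
      = Alt (Suc k) (\<lambda>v. dir_D \<omega> c' ?y (T (v 0)) (\<lambda>i. T (v (Suc i)))) v"
    by (simp add: D Alt_add Alt_sum)
  also have "\<dots> = Alt (Suc k) (\<lambda>v. dir_D \<omega> c' ?y (v 0) (\<lambda>i. v (Suc i))) (\<lambda>i. T (v i))"
    by (simp add: Alt_def)
  finally show ?thesis
    by (simp add: ext_d_Alt[OF \<omega> c(1) im(1)] ext_d_Alt[OF \<omega> c(2) im(2)])
qed

lemma ext_d_forms: "\<omega> \<in> forms A k \<Longrightarrow> ext_d A k \<omega> \<in> forms A (Suc k)"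
  by (rule formsI) (blast intro: alternating_ext_d smooth_ext_d ext_d_transition ext_d_outside)+

lemma wedge_forms:
  assumes \<omega>: "\<omega> \<in> forms A k" and \<eta>: "\<eta> \<in> forms A l"
  shows "wedge k l \<omega> \<eta> \<in> forms A (k + l)"
proof (rule formsI)
  show "alternating (k + l) (wedge k l \<omega> \<eta> c x)" for c x
    using alternating_pwedge[OF forms_alternating[OF \<omega>] forms_alternating[OF \<eta>]] by (simp add: wedge_eq_pwedge)
  show "smooth_on (im_chart c) (\<lambda>x. wedge k l \<omega> \<eta> c x v)" if "c \<in> A" for c v
    unfolding wedge_eq_pwedge
    by (intro smooth_on_pwedge forms_smooth[OF \<omega>] forms_smooth[OF \<eta>] open_im that)
  show "wedge k l \<omega> \<eta> c x v = 0" if "c \<notin> A \<or> x \<notin> im_chart c" for c x v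
    using forms_outside[OF \<omega> that] by (simp add: wedge_def)
  show "wedge k l \<omega> \<eta> c (coord c p) v = wedge k l \<omega> \<eta> c' (coord c' p)
      (\<lambda>i. frechet_derivative (transition c c') (at (coord c p)) (v i))"
    if "c \<in> A" "c' \<in> A" "p \<in> dom_chart c" "p \<in> dom_chart c'" for c c' p v
    using forms_transition[OF \<omega> that] forms_transition[OF \<eta> that] by (simp add: wedge_def)
qed

lemma form_add: "\<omega> \<in> forms A k \<Longrightarrow> \<eta> \<in> forms A k \<Longrightarrow> \<omega> + \<eta> \<in> forms A k"
proof (rule formsI)
  assume \<omega>: "\<omega> \<in> forms A k" and \<eta>: "\<eta> \<in> forms A k"
  show "alternating k ((\<omega> + \<eta>) c x)" for c x
    using alternating_add[OF forms_alternating[OF \<omega>] forms_alternating[OF \<eta>], of c x c x]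
    by (simp add: plus_fun_def)
  show "smooth_on (im_chart c) (\<lambda>x. (\<omega> + \<eta>) c x v)" if "c \<in> A" for c v
    unfolding plus_fun_apply
    by (intro smooth_on_add forms_smooth[OF \<omega>] forms_smooth[OF \<eta>] open_im that)
  show "(\<omega> + \<eta>) c x v = 0" if "c \<notin> A \<or> x \<notin> im_chart c" for c x v
    using forms_outside[OF \<omega> that] forms_outside[OF \<eta> that] by simp
  show "(\<omega> + \<eta>) c (coord c p) v = (\<omega> + \<eta>) c' (coord c' p)
      (\<lambda>i. frechet_derivative (transition c c') (at (coord c p)) (v i))"
    if "c \<in> A" "c' \<in> A" "p \<in> dom_chart c" "p \<in> dom_chart c'" for c c' p v
    using forms_transition[OF \<omega> that] forms_transition[OF \<eta> that] by simp
qed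

lemma form_scale_forms: "\<omega> \<in> forms A k \<Longrightarrow> form_scale r \<omega> \<in> forms A k"
proof (rule formsI)
  assume \<omega>: "\<omega> \<in> forms A k"
  show "alternating k (form_scale r \<omega> c x)" for c x
    using alternating_scale[OF forms_alternating[OF \<omega>], of r c x] by (simp add: form_scale_def)
  show "smooth_on (im_chart c) (\<lambda>x. form_scale r \<omega> c x v)" if "c \<in> A" for c v
    unfolding form_scale_def
    by (intro smooth_on_mult smooth_on_const forms_smooth[OF \<omega>] open_im that)
  show "form_scale r \<omega> c x v = 0" if "c \<notin> A \<or> x \<notin> im_chart c" for c x v
    using forms_outside[OF \<omega> that] by (simp add: form_scale_def)
  show "form_scale r \<omega> c (coord c p) v = form_scale r \<omega> c' (coord c' p)
      (\<lambda>i. frechet_derivative (transition c c') (at (coord c p)) (v i))"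
    if "c \<in> A" "c' \<in> A" "p \<in> dom_chart c" "p \<in> dom_chart c'" for c c' p v
    using forms_transition[OF \<omega> that] by (simp add: form_scale_def)
qed

text \<open>Up to a factor, \<open>d (d \<omega>)\<close> antisymmetrises the second derivative of \<open>\<omega>\<close>, which is symmetric in its
  first two arguments.\<close>

lemma ext_d_ext_d:
  assumes \<omega>: "\<omega> \<in> forms A k"
  shows "ext_d A (Suc k) (ext_d A k \<omega>) = 0"
proof (intro ext)
  fix c x v
  show "ext_d A (Suc k) (ext_d A k \<omega>) c x v = 0 c x v"
  proof (cases "c \<in> A \<and> x \<in> im_chart c")
    case True
    then have cx: "c \<in> A" "x \<in> im_chart c" by auto
    define H where "H u a w = frechet_derivative (\<lambda>y. frechet_derivative (\<lambda>y. \<omega> c y w) (at y) a) (at x) u" for u a w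
    have H_sym: "H u a w = H a u w" for u a w
      unfolding H_def by (rule second_derivative_symmetric[OF open_im[OF cx(1)] cx(2) forms_smooth[OF \<omega> cx(1)]])
    have HD: "((\<lambda>y. dir_D \<omega> c y a w) has_derivative (\<lambda>u. H u a w)) (at x)" for a w
      unfolding H_def dir_D_def
      by (rule smooth_on_has_derivative[OF smooth_on_frechet_derivative[OF forms_smooth[OF \<omega> cx(1)]] cx(2)])
    have D: "dir_D (ext_d A k \<omega>) c x u w = 1 / fact k * Alt (Suc k) (\<lambda>w. H u (w 0) (\<lambda>i. w (Suc i))) w" for u w
    proof (rule dir_D_eqI)
      have "((\<lambda>y. 1 / fact k * Alt (Suc k) (\<lambda>w. dir_D \<omega> c y (w 0) (\<lambda>i. w (Suc i))) w) has_derivative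
          (\<lambda>u. 1 / fact k * Alt (Suc k) (\<lambda>w. H u (w 0) (\<lambda>i. w (Suc i))) w)) (at x)"
        unfolding Alt_def by (intro has_derivative_mult_right has_derivative_sum HD)
      then show "((\<lambda>y. ext_d A k \<omega> c y w) has_derivative
          (\<lambda>u. 1 / fact k * Alt (Suc k) (\<lambda>w. H u (w 0) (\<lambda>i. w (Suc i))) w)) (at x)"
        by (rule has_derivative_transform_within_open[OF _ open_im[OF cx(1)] cx(2)])
          (simp add: ext_d_Alt[OF \<omega> cx(1)])
    qed
    have "Alt (1 + Suc k) (\<lambda>v. Alt (Suc k) (\<lambda>w. H (v 0) (w 0) (\<lambda>i. w (Suc i))) (\<lambda>i. v (1 + i))) v
        = fact (Suc k) * Alt (1 + Suc k) (\<lambda>v. H (v 0) (v (1 + 0)) (\<lambda>i. v (1 + Suc i))) v"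
      by (rule Alt_Alt_right[of 1 "\<lambda>v w. H (v 0) (w 0) (\<lambda>i. w (Suc i))"]) (simp add: first_args_def)
    moreover have "Alt (1 + Suc k) (\<lambda>v. H (v 0) (v (1 + 0)) (\<lambda>i. v (1 + Suc i))) v = 0"
      by (rule Alt_symmetric_eq_0[of 0 _ 1]) (auto simp: Transposition.transpose_def intro: H_sym)
    ultimately show ?thesis
      using ext_d_Alt[OF ext_d_forms[OF \<omega>] cx, of v] by (simp add: D Alt_divide)
  qed (simp add: ext_d_outside)
qed

lemma wedge_dir_D:
  assumes \<omega>: "\<omega> \<in> forms A k" and \<eta>: "\<eta> \<in> forms A l" and cx: "c \<in> A" "x \<in> im_chart c"
  shows "dir_D (wedge k l \<omega> \<eta>) c x u w = 1 / (fact k * fact l) * Alt (k + l) (\<lambda>w.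
    dir_D \<omega> c x u w * \<eta> c x (\<lambda>i. w (k + i)) + \<omega> c x w * dir_D \<eta> c x u (\<lambda>i. w (k + i))) w"
proof (rule dir_D_eqI)
  show "((\<lambda>y. wedge k l \<omega> \<eta> c y w) has_derivative (\<lambda>u. 1 / (fact k * fact l) * Alt (k + l) (\<lambda>w.
    dir_D \<omega> c x u w * \<eta> c x (\<lambda>i. w (k + i)) + \<omega> c x w * dir_D \<eta> c x u (\<lambda>i. w (k + i))) w)) (at x)"
    unfolding wedge_eq_pwedge pwedge_def Alt_def tensor_def
    by (subst (2) add.commute)
      (intro has_derivative_mult_right has_derivative_sum has_derivative_mult
        form_has_derivative[OF \<omega> cx] form_has_derivative[OF \<eta> cx])
qed

text \<open>The derivative of \<open>\<omega> \<otimes> \<eta>\<close> has two terms. In the one that differentiates \<open>\<eta>\<close>, the direction of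
  differentiation stands in front of the \<open>k\<close> arguments of \<open>\<omega>\<close>; moving it past them is a rotation of
  \<open>k + 1\<close> places, whose sign is the factor \<open>(-1) ^ k\<close>.\<close>

lemma leibniz:
  assumes \<omega>: "\<omega> \<in> forms A k" and \<eta>: "\<eta> \<in> forms A l"
  shows "ext_d A (k + l) (wedge k l \<omega> \<eta>) =
    wedge (Suc k) l (ext_d A k \<omega>) \<eta> + form_scale ((-1) ^ k) (wedge k (Suc l) \<omega> (ext_d A l \<eta>))"
proof (rule forms_eqI)
  show "ext_d A (k + l) (wedge k l \<omega> \<eta>) \<in> forms A (Suc (k + l))"
    by (intro ext_d_forms wedge_forms \<omega> \<eta>)
  show "wedge (Suc k) l (ext_d A k \<omega>) \<eta> + form_scale ((-1) ^ k) (wedge k (Suc l) \<omega> (ext_d A l \<eta>)) \<in> forms A (Suc (k + l))"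
    using wedge_forms[OF ext_d_forms[OF \<omega>] \<eta>] wedge_forms[OF \<omega> ext_d_forms[OF \<eta>]]
    by (intro form_add form_scale_forms) auto
  fix c x v assume cx: "c \<in> A" "x \<in> im_chart c"
  let ?\<omega>' = "\<lambda>v. dir_D \<omega> c x (v 0) (\<lambda>i. v (Suc i))" and ?\<eta>' = "\<lambda>v. dir_D \<eta> c x (v 0) (\<lambda>i. v (Suc i))"
  let ?C = "1 / (fact k * fact l) :: real"
  let ?\<Psi> = "\<lambda>v w. dir_D \<omega> c x (v 0) w * \<eta> c x (\<lambda>i. w (k + i)) + \<omega> c x w * dir_D \<eta> c x (v 0) (\<lambda>i. w (k + i))"
  have "ext_d A (k + l) (wedge k l \<omega> \<eta>) c x v
      = ?C / fact (k + l) * Alt (1 + (k + l)) (\<lambda>v. Alt (k + l) (?\<Psi> v) (\<lambda>i. v (1 + i))) v"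
    by (simp add: ext_d_Alt[OF wedge_forms[OF \<omega> \<eta>] cx] wedge_dir_D[OF \<omega> \<eta> cx] Alt_divide)
  also have "\<dots> = ?C * Alt (1 + (k + l)) (\<lambda>v. ?\<Psi> v (\<lambda>i. v (1 + i))) v"
    by (subst Alt_Alt_right) (simp_all add: first_args_def)
  also have "(\<lambda>v. ?\<Psi> v (\<lambda>i. v (1 + i))) = (\<lambda>v. tensor (Suc k) ?\<omega>' (\<eta> c x) v
      + tensor k (\<omega> c x) ?\<eta>' (v \<circ> rot (Suc k)))"
  proof
    fix v
    have "\<omega> c x (v \<circ> rot (Suc k)) = \<omega> c x (\<lambda>i. v (Suc i))"
      by (rule first_argsD[OF alternating_first_args[OF forms_alternating[OF \<omega>]]]) (simp add: rot_def)
    then show "?\<Psi> v (\<lambda>i. v (1 + i)) = tensor (Suc k) ?\<omega>' (\<eta> c x) v + tensor k (\<omega> c x) ?\<eta>' (v \<circ> rot (Suc k))"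
      by (simp add: tensor_def rot_def)
  qed
  also have "?C * Alt (1 + (k + l)) (\<lambda>v. tensor (Suc k) ?\<omega>' (\<eta> c x) v + tensor k (\<omega> c x) ?\<eta>' (v \<circ> rot (Suc k))) v
      = ?C * Alt (Suc k + l) (tensor (Suc k) ?\<omega>' (\<eta> c x)) v
        + (-1) ^ k * (?C * Alt (k + Suc l) (tensor k (\<omega> c x) ?\<eta>') v)"
  proof -
    have "rot (Suc k) permutes {..<k + Suc l}"
      using rot_permutes_sign[of k] permutes_subset[of _ "{..<Suc k}" "{..<k + Suc l}"] by auto
    from Alt_reindex[OF this, of "tensor k (\<omega> c x) ?\<eta>'" v] show ?thesis
      using rot_permutes_sign[of k] by (simp add: Alt_add distrib_left)
  qed
  also have "?C * Alt (Suc k + l) (tensor (Suc k) ?\<omega>' (\<eta> c x)) v = wedge (Suc k) l (ext_d A k \<omega>) \<eta> c x v"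
    unfolding wedge_eq_pwedge pwedge_def ext_d_Alt[OF \<omega> cx, abs_def] tensor_scale Alt_scale Alt_Alt_left
    by (simp del: fact_Suc)
  also have "?C * Alt (k + Suc l) (tensor k (\<omega> c x) ?\<eta>') v = wedge k (Suc l) \<omega> (ext_d A l \<eta>) c x v"
  proof -
    have "Alt (k + Suc l) (tensor k (\<omega> c x) (Alt (Suc l) ?\<eta>')) v
        = fact (Suc l) * Alt (k + Suc l) (tensor k (\<omega> c x) ?\<eta>') v"
      using Alt_Alt_right[of k "\<lambda>u w. \<omega> c x u * ?\<eta>' w" "Suc l" v]
        alternating_first_args[OF forms_alternating[OF \<omega>]]
      by (simp add: Alt_scale tensor_def[abs_def] first_args_def del: fact_Suc)
    then show ?thesis
      unfolding wedge_eq_pwedge pwedge_def ext_d_Alt[OF \<eta> cx, abs_def] tensor_scale Alt_scale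
      by (simp del: fact_Suc)
  qed
  finally show "ext_d A (k + l) (wedge k l \<omega> \<eta>) c x v = (wedge (Suc k) l (ext_d A k \<omega>) \<eta>
      + form_scale ((-1) ^ k) (wedge k (Suc l) \<omega> (ext_d A l \<eta>))) c x v"
    by (simp add: form_scale_def)
qed

section \<open>Families of forms and their parameter derivative\<close>

lemma family_forms: "smooth_form_family A J k \<omega> \<Longrightarrow> t \<in> J \<Longrightarrow> \<omega> t \<in> forms A k"
  by (simp add: smooth_form_family_def)

lemma family_smooth:
  "smooth_form_family A J k \<omega> \<Longrightarrow> c \<in> A \<Longrightarrow> smooth_on (J \<times> im_chart c) (\<lambda>z. \<omega> (fst z) c (snd z) v)"
  by (simp add: smooth_form_family_def case_prod_beta')

lemma familyI:
  "(\<And>t. t \<in> J \<Longrightarrow> \<omega> t \<in> forms A k) \<Longrightarrow>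
    (\<And>c v. c \<in> A \<Longrightarrow> smooth_on (J \<times> im_chart c) (\<lambda>z. \<omega> (fst z) c (snd z) v)) \<Longrightarrow>
    smooth_form_family A J k \<omega>"
  by (simp add: smooth_form_family_def case_prod_beta')

lemma family_slice:
  fixes F :: "real \<times> 'e \<Rightarrow> real"
  assumes "open J" "c \<in> A" "smooth_on (J \<times> im_chart c) F" "t \<in> J"
  shows "smooth_on (im_chart c) (\<lambda>x. F (t, x))"
  using smooth_on_snd_slice[OF assms(1) open_im[OF assms(2)] assms(3,4)] .

lemma open_prod: "open J \<Longrightarrow> c \<in> A \<Longrightarrow> open (J \<times> im_chart c)"
  by (intro open_Times open_im)

text \<open>Constant families make the comparison of two defining pairs of one foliation a case of that for families.\<close>

lemma family_const:
  assumes J: "open J" and "\<omega> \<in> forms A k"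
  shows "smooth_form_family A J k (\<lambda>_. \<omega>)"
proof (rule familyI)
  fix c v assume c: "c \<in> A"
  show "smooth_on (J \<times> im_chart c) (\<lambda>z. \<omega> c (snd z) v)"
    by (rule smooth_on_compose[OF open_prod[OF J c] open_im[OF c] _ forms_smooth[OF assms(2) c]])
      (use open_prod[OF J c] in \<open>auto intro: smooth_on_linear bounded_linear_snd\<close>)
qed (use assms in auto)

text \<open>The derivative exists for all charts and points: outside the charts of the atlas the family is
  constantly zero on \<open>J\<close>.\<close>

lemma family_DERIV:
  assumes J: "open J" and \<omega>: "smooth_form_family A J k \<omega>" and t: "t \<in> J"
  shows "((\<lambda>s. \<omega> s c x v) has_real_derivative form_dot \<omega> t c x v) (at t)"
proof -
  have "\<exists>D. ((\<lambda>s. \<omega> s c x v) has_real_derivative D) (at t)"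
  proof (cases "c \<in> A \<and> x \<in> im_chart c")
    case True
    then have cx: "c \<in> A" "x \<in> im_chart c" by auto
    show ?thesis using DERIV_fst_slice[OF family_smooth[OF \<omega> cx(1), of v] t cx(2)] by auto
  next
    case False
    have "((\<lambda>s. \<omega> s c x v) has_real_derivative 0) (at t)"
    proof (rule has_field_derivative_transform_within_open[OF DERIV_const J t])
      show "0 = \<omega> s c x v" if "s \<in> J" for s
        using forms_outside[OF family_forms[OF \<omega> that]] False by metis
    qed
    then show ?thesis ..
  qed
  then show ?thesis unfolding form_dot_def using DERIV_imp_deriv by blast
qed

text \<open>As \<open>J\<close> is open, an identity valid for all parameters in \<open>J\<close> may be differentiated.\<close>

lemma form_dot_eqI:
  assumes "open J" "t \<in> J" "\<And>s. s \<in> J \<Longrightarrow> \<omega> s c x v = f s" "(f has_real_derivative D) (at t)"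
  shows "form_dot \<omega> t c x v = D"
  unfolding form_dot_def
  by (rule DERIV_imp_deriv, rule has_field_derivative_transform_within_open[OF assms(4,1,2)])
    (simp add: assms(3))

lemma form_dot_family_eq:
  assumes "smooth_form_family A J k \<omega>" "t \<in> J" "c \<in> A" "x \<in> im_chart c"
  shows "form_dot \<omega> t c x v = frechet_derivative (\<lambda>z. \<omega> (fst z) c (snd z) v) (at (t, x)) (1, 0)"
  unfolding form_dot_def
  using DERIV_imp_deriv[OF DERIV_fst_slice[OF family_smooth[OF assms(1,3)] assms(2,4)]] by simp

lemma smooth_form_dot:
  assumes J: "open J" and \<omega>: "smooth_form_family A J k \<omega>" and c: "c \<in> A"
  shows "smooth_on (J \<times> im_chart c) (\<lambda>z. form_dot \<omega> (fst z) c (snd z) v)"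
  by (rule smooth_on_cong[OF open_prod[OF J c] _ smooth_on_frechet_derivative[OF family_smooth[OF \<omega> c]]])
    (auto simp: form_dot_family_eq[OF \<omega> _ c])

lemma form_dot_forms:
  assumes J: "open J" and \<omega>: "smooth_form_family A J k \<omega>" and t: "t \<in> J"
  shows "form_dot \<omega> t \<in> forms A k"
proof (rule formsI)
  note der = family_DERIV[OF J \<omega> t]
  note alt = forms_alternating[OF family_forms[OF \<omega>]]
  fix c :: "('m, 'e) chart" and x and v :: "nat \<Rightarrow> 'e"
  show "alternating k (form_dot \<omega> t c x)"
    unfolding alternating_def
  proof (intro conjI allI impI)
    fix v w :: "nat \<Rightarrow> 'e" and i j
    show "form_dot \<omega> t c x v = form_dot \<omega> t c x w" if "\<forall>i<k. v i = w i"
      by (rule form_dot_eqI[OF J t _ der])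
        (use that in \<open>auto intro!: first_argsD[OF alternating_first_args[OF alt]]\<close>)
    show "linear (\<lambda>a. form_dot \<omega> t c x (v(i := a)))" if i: "i < k"
    proof (rule linearI)
      show "form_dot \<omega> t c x (v(i := a + b)) = form_dot \<omega> t c x (v(i := a)) + form_dot \<omega> t c x (v(i := b))" for a b
        by (rule form_dot_eqI[OF J t _ DERIV_add[OF der der]], rule linear_add[OF alternating_linear[OF alt i]])
      show "form_dot \<omega> t c x (v(i := r *\<^sub>R a)) = r *\<^sub>R form_dot \<omega> t c x (v(i := a))" for r a
        unfolding real_scaleR_def
        by (rule form_dot_eqI[OF J t _ DERIV_cmult[OF der]])
          (rule linear_cmul[OF alternating_linear[OF alt i], unfolded real_scaleR_def])
    qed
    show "form_dot \<omega> t c x v = 0" if "i < k" "j < k" "i \<noteq> j \<and> v i = v j"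
      by (rule form_dot_eqI[OF J t _ DERIV_const]) (use that in \<open>blast intro: alternating_eq_0[OF alt]\<close>)
  qed
  show "smooth_on (im_chart c) (\<lambda>x. form_dot \<omega> t c x v)" if "c \<in> A"
    using family_slice[OF J that smooth_form_dot[OF J \<omega> that] t] by simp
  show "form_dot \<omega> t c x v = 0" if "c \<notin> A \<or> x \<notin> im_chart c"
    by (rule form_dot_eqI[OF J t _ DERIV_const]) (rule forms_outside[OF family_forms[OF \<omega>] that])
  show "form_dot \<omega> t c (coord c p) v = form_dot \<omega> t c' (coord c' p)
      (\<lambda>i. frechet_derivative (transition c c') (at (coord c p)) (v i))"
    if "c \<in> A" "c' \<in> A" "p \<in> dom_chart c" "p \<in> dom_chart c'" for c' p
    by (rule form_dot_eqI[OF J t _ der]) (rule forms_transition[OF family_forms[OF \<omega>] that])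
qed

lemma family_add:
  assumes J: "open J" and "smooth_form_family A J k \<omega>" "smooth_form_family A J k \<eta>"
  shows "smooth_form_family A J k (\<lambda>t. \<omega> t + \<eta> t)"
proof (rule familyI)
  show "\<omega> t + \<eta> t \<in> forms A k" if "t \<in> J" for t
    using assms that by (intro form_add family_forms)
  show "smooth_on (J \<times> im_chart c) (\<lambda>z. (\<omega> (fst z) + \<eta> (fst z)) c (snd z) v)" if "c \<in> A" for c v
    unfolding plus_fun_apply by (rule smooth_on_add[OF open_prod[OF J that] family_smooth[OF assms(2) that] family_smooth[OF assms(3) that]])
qed

lemma family_scale:
  assumes J: "open J" and "smooth_form_family A J k \<omega>"
  shows "smooth_form_family A J k (\<lambda>t. form_scale r (\<omega> t))"
proof (rule familyI)
  show "form_scale r (\<omega> t) \<in> forms A k" if "t \<in> J" for t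
    using assms that by (intro form_scale_forms family_forms)
  show "smooth_on (J \<times> im_chart c) (\<lambda>z. form_scale r (\<omega> (fst z)) c (snd z) v)" if "c \<in> A" for c v
    unfolding form_scale_def by (intro smooth_on_mult smooth_on_const open_prod J that family_smooth[OF assms(2)])
qed

lemma form_minus_eq_scale: "- \<omega> = form_scale (-1) \<omega>" for \<omega> :: "('m, 'e) form"
  by (simp add: form_scale_def fun_eq_iff)

lemma form_minus: "\<omega> \<in> forms A k \<Longrightarrow> - \<omega> \<in> forms A k"
  unfolding form_minus_eq_scale by (rule form_scale_forms)

lemma form_diff: "\<omega> \<in> forms A k \<Longrightarrow> \<eta> \<in> forms A k \<Longrightarrow> \<omega> - \<eta> \<in> forms A k"
  using form_add[OF _ form_minus, of \<omega> k \<eta>] by simp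

lemma family_diff:
  assumes "open J" "smooth_form_family A J k \<omega>" "smooth_form_family A J k \<eta>"
  shows "smooth_form_family A J k (\<lambda>t. \<omega> t - \<eta> t)"
  using family_add[OF assms(1,2) family_scale[OF assms(1,3), of "-1"]]
  by (simp flip: form_minus_eq_scale)

lemma family_wedge:
  assumes J: "open J" and "smooth_form_family A J k \<omega>" "smooth_form_family A J l \<eta>"
  shows "smooth_form_family A J (k + l) (\<lambda>t. wedge k l (\<omega> t) (\<eta> t))"
proof (rule familyI)
  show "wedge k l (\<omega> t) (\<eta> t) \<in> forms A (k + l)" if "t \<in> J" for t
    using assms that by (intro wedge_forms family_forms)
  show "smooth_on (J \<times> im_chart c) (\<lambda>z. wedge k l (\<omega> (fst z)) (\<eta> (fst z)) c (snd z) v)" if "c \<in> A" for c v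
    unfolding wedge_eq_pwedge
    by (rule smooth_on_pwedge[OF open_prod[OF J that] family_smooth[OF assms(2) that] family_smooth[OF assms(3) that]])
qed

lemma family_ext_d:
  assumes J: "open J" and \<omega>: "smooth_form_family A J k \<omega>"
  shows "smooth_form_family A J (Suc k) (\<lambda>t. ext_d A k (\<omega> t))"
proof (rule familyI)
  show "ext_d A k (\<omega> t) \<in> forms A (Suc k)" if "t \<in> J" for t
    using assms that by (intro ext_d_forms family_forms)
  fix c :: "('m, 'e) chart" and v :: "nat \<Rightarrow> 'e" assume c: "c \<in> A"
  have slice: "dir_D (\<omega> t) c x u w = frechet_derivative (\<lambda>z. \<omega> (fst z) c (snd z) w) (at (t, x)) (0, u)"
    if "t \<in> J" "x \<in> im_chart c" for t x u w
    using frechet_derivative_snd_slice[OF family_smooth[OF \<omega> c] that] by (simp add: dir_D_def)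
  show "smooth_on (J \<times> im_chart c) (\<lambda>z. ext_d A k (\<omega> (fst z)) c (snd z) v)"
  proof (rule smooth_on_cong[OF open_prod[OF J c]])
    show "smooth_on (J \<times> im_chart c) (\<lambda>z. \<Sum>i\<le>k. (-1) ^ i *
        frechet_derivative (\<lambda>z. \<omega> (fst z) c (snd z) (\<lambda>j. if j < i then v j else v (Suc j))) (at z) (0, v i))"
      by (intro smooth_on_sum smooth_on_mult smooth_on_const smooth_on_frechet_derivative
          open_prod J c family_smooth[OF \<omega>]) auto
  qed (auto simp: ext_d_sum[OF c] slice)
qed

lemma form_dot_add:
  assumes J: "open J" "t \<in> J" and "smooth_form_family A J k \<omega>" "smooth_form_family A J k \<eta>"
  shows "form_dot (\<lambda>t. \<omega> t + \<eta> t) t = form_dot \<omega> t + form_dot \<eta> t"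
proof (intro ext)
  fix c x v
  show "form_dot (\<lambda>t. \<omega> t + \<eta> t) t c x v = (form_dot \<omega> t + form_dot \<eta> t) c x v"
    unfolding plus_fun_apply
    by (rule form_dot_eqI[OF J _ DERIV_add[OF family_DERIV[OF J(1) assms(3) J(2)] family_DERIV[OF J(1) assms(4) J(2)]]])
      simp
qed

lemma form_dot_wedge:
  assumes J: "open J" "t \<in> J" and \<omega>: "smooth_form_family A J k \<omega>" and \<eta>: "smooth_form_family A J l \<eta>"
  shows "form_dot (\<lambda>t. wedge k l (\<omega> t) (\<eta> t)) t =
    wedge k l (form_dot \<omega> t) (\<eta> t) + wedge k l (\<omega> t) (form_dot \<eta> t)"
proof (intro ext)
  fix c x v
  note d\<omega> = family_DERIV[OF J(1) \<omega> J(2)] and d\<eta> = family_DERIV[OF J(1) \<eta> J(2)]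
  have "((\<lambda>s. wedge k l (\<omega> s) (\<eta> s) c x v) has_real_derivative 1 / (fact k * fact l) * Alt (k + l)
      (\<lambda>w. form_dot \<omega> t c x w * \<eta> t c x (\<lambda>i. w (k + i)) + \<omega> t c x w * form_dot \<eta> t c x (\<lambda>i. w (k + i))) v) (at t)"
    unfolding wedge_eq_pwedge pwedge_def Alt_def tensor_def
    by (intro DERIV_cmult DERIV_sum)
      (rule DERIV_cong, rule DERIV_mult[OF d\<omega> d\<eta>], simp add: mult.commute add.commute)
  then have "form_dot (\<lambda>t. wedge k l (\<omega> t) (\<eta> t)) t c x v = 1 / (fact k * fact l) * Alt (k + l)
      (\<lambda>w. form_dot \<omega> t c x w * \<eta> t c x (\<lambda>i. w (k + i)) + \<omega> t c x w * form_dot \<eta> t c x (\<lambda>i. w (k + i))) v"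
    by (rule form_dot_eqI[OF J refl])
  then show "form_dot (\<lambda>t. wedge k l (\<omega> t) (\<eta> t)) t c x v =
    (wedge k l (form_dot \<omega> t) (\<eta> t) + wedge k l (\<omega> t) (form_dot \<eta> t)) c x v"
    by (simp add: wedge_eq_pwedge pwedge_def Alt_add tensor_def[abs_def] add_divide_distrib distrib_left)
qed

text \<open>Symmetry of second derivatives of the coordinate functions on \<open>J \<times> im_chart c\<close>, for the directions
  \<open>(1, 0)\<close> and \<open>(0, u)\<close>.\<close>

lemma form_dot_ext_d:
  assumes J: "open J" "t \<in> J" and \<omega>: "smooth_form_family A J k \<omega>"
  shows "form_dot (\<lambda>t. ext_d A k (\<omega> t)) t = ext_d A k (form_dot \<omega> t)"
proof (rule forms_eqI)
  show "form_dot (\<lambda>t. ext_d A k (\<omega> t)) t \<in> forms A (Suc k)"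
    by (intro form_dot_forms[OF J(1) _ J(2)] family_ext_d J(1) \<omega>)
  show "ext_d A k (form_dot \<omega> t) \<in> forms A (Suc k)"
    by (intro ext_d_forms form_dot_forms[OF J(1) \<omega> J(2)])
  fix c x v assume c: "c \<in> A" and x: "x \<in> im_chart c"
  let ?F = "\<lambda>w z. \<omega> (fst z) c (snd z) w"
  note sm = family_smooth[OF \<omega> c]
  note op = open_prod[OF J(1) c]
  have slice: "dir_D (\<omega> s) c x u w = frechet_derivative (?F w) (at (s, x)) (0, u)" if "s \<in> J" for s u w
    using frechet_derivative_snd_slice[OF sm that x] by (simp add: dir_D_def)
  have mixed: "frechet_derivative (\<lambda>z. frechet_derivative (?F w) (at z) (0, u)) (at (t, x)) (1, 0)
      = dir_D (form_dot \<omega> t) c x u w" for u w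
  proof -
    have "frechet_derivative (\<lambda>z. frechet_derivative (?F w) (at z) (0, u)) (at (t, x)) (1, 0)
        = frechet_derivative (\<lambda>z. frechet_derivative (?F w) (at z) (1, 0)) (at (t, x)) (0, u)"
      by (rule second_derivative_symmetric[OF op _ sm]) (use J x in simp)
    also have "\<dots> = frechet_derivative (\<lambda>y. frechet_derivative (?F w) (at (t, y)) (1, 0)) (at x) u"
      using frechet_derivative_snd_slice[OF smooth_on_frechet_derivative[OF sm] J(2) x] by simp
    also have "\<dots> = dir_D (form_dot \<omega> t) c x u w"
      unfolding dir_D_def
    proof (rule fun_cong[of _ _ u], rule frechet_derivative_transform_within_open[OF _ open_im[OF c] x])
      show "(\<lambda>y. frechet_derivative (?F w) (at (t, y)) (1, 0)) differentiable at x"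
        using smooth_on_differentiable[OF family_slice[OF J(1) c smooth_on_frechet_derivative[OF sm] J(2)] x] .
    qed (simp add: form_dot_family_eq[OF \<omega> J(2) c])
    finally show ?thesis .
  qed
  have "((\<lambda>s. \<Sum>i\<le>k. (-1) ^ i * frechet_derivative (?F (\<lambda>j. if j < i then v j else v (Suc j))) (at (s, x)) (0, v i))
      has_real_derivative (\<Sum>i\<le>k. (-1) ^ i * dir_D (form_dot \<omega> t) c x (v i) (\<lambda>j. if j < i then v j else v (Suc j)))) (at t)"
    unfolding mixed[symmetric]
    by (intro DERIV_sum DERIV_cmult DERIV_fst_slice[OF smooth_on_frechet_derivative[OF sm] J(2) x])
  then show "form_dot (\<lambda>t. ext_d A k (\<omega> t)) t c x v = ext_d A k (form_dot \<omega> t) c x v"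
    unfolding ext_d_sum[OF c x]
    by (rule form_dot_eqI[OF J, rotated]) (simp add: ext_d_sum[OF c x] slice)
qed

lemma form_dot_vanishing:
  assumes J: "open J" "t \<in> J" and "\<And>s. s \<in> J \<Longrightarrow> \<omega> s = 0"
  shows "form_dot \<omega> t = 0"
proof (intro ext)
  show "form_dot \<omega> t c x v = 0 c x v" for c x v
    unfolding zero_fun_apply by (rule form_dot_eqI[OF J _ DERIV_const]) (simp add: assms(3))
qed

section \<open>The differential graded algebra of forms\<close>

lemma wedge_add_left: "wedge k l (\<omega> + \<omega>') \<eta> = wedge k l \<omega> \<eta> + wedge k l \<omega>' \<eta>"
  and wedge_add_right: "wedge k l \<omega> (\<eta> + \<eta>') = wedge k l \<omega> \<eta> + wedge k l \<omega> \<eta>'"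
  for \<omega> \<omega>' \<eta> \<eta>' :: "('m, 'e) form"
  by (simp_all add: fun_eq_iff wedge_eq_pwedge pwedge_add_left pwedge_add_right plus_fun_def)

lemma wedge_scale_left: "wedge k l (form_scale r \<omega>) \<eta> = form_scale r (wedge k l \<omega> \<eta>)"
  and wedge_scale_right: "wedge k l \<omega> (form_scale r \<eta>) = form_scale r (wedge k l \<omega> \<eta>)"
  for \<omega> \<eta> :: "('m, 'e) form"
  by (simp_all add: fun_eq_iff wedge_eq_pwedge pwedge_scale_left pwedge_scale_right form_scale_def)

lemma wedge_minus_left: "wedge k l (- \<omega>) \<eta> = - wedge k l \<omega> \<eta>"
  and wedge_minus_right: "wedge k l \<omega> (- \<eta>) = - wedge k l \<omega> \<eta>"
  for \<omega> \<eta> :: "('m, 'e) form"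
  by (simp_all add: form_minus_eq_scale wedge_scale_left wedge_scale_right)

lemma wedge_diff_right: "wedge k l \<omega> (\<eta> - \<eta>') = wedge k l \<omega> \<eta> - wedge k l \<omega> \<eta>'"
  for \<omega> \<eta> \<eta>' :: "('m, 'e) form"
  using wedge_add_right[of k l \<omega> \<eta> "- \<eta>'"] by (simp add: wedge_minus_right)

lemma wedge_zero_left [simp]: "wedge k l 0 \<eta> = 0"
  and wedge_zero_right [simp]: "wedge k l \<omega> 0 = 0"
  for \<omega> \<eta> :: "('m, 'e) form"
  by (simp_all add: fun_eq_iff wedge_def)

text \<open>The degrees of the products appear as separate variables, so that the rule applies to numerals.\<close>

lemma wedge_assoc:
  assumes "\<omega> \<in> forms A k" "n = k + l" "n' = l + m"
  shows "wedge n m (wedge k l \<omega> \<eta>) \<zeta> = wedge k n' \<omega> (wedge l m \<eta> \<zeta>)"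
  unfolding assms(2,3)
  by (intro ext) (simp add: wedge_eq_pwedge[abs_def] pwedge_assoc alternating_first_args forms_alternating[OF assms(1)])

lemma wedge_commute:
  assumes "\<omega> \<in> forms A k" "\<eta> \<in> forms A l"
  shows "wedge k l \<omega> \<eta> = form_scale ((-1) ^ (k * l)) (wedge l k \<eta> \<omega>)"
  using pwedge_commute[OF alternating_first_args[OF forms_alternating[OF assms(1)]]
      alternating_first_args[OF forms_alternating[OF assms(2)]]]
  by (intro ext) (simp add: wedge_eq_pwedge form_scale_def)

lemma form_scale_1 [simp]: "form_scale 1 \<omega> = \<omega>"
  and form_scale_add: "form_scale r (\<omega> + \<eta>) = form_scale r \<omega> + form_scale r \<eta>"
  and form_scale_scale: "form_scale r (form_scale s \<omega>) = form_scale (r * s) \<omega>"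
  for \<omega> \<eta> :: "('m, 'e) form"
  by (simp_all add: form_scale_def fun_eq_iff distrib_left)

lemma wedge_commute_odd:
  assumes "\<omega> \<in> forms A k" "\<eta> \<in> forms A l" "odd (k * l)"
  shows "wedge k l \<omega> \<eta> = - wedge l k \<eta> \<omega>"
  using wedge_commute[OF assms(1,2)] assms(3) by (simp only: form_minus_eq_scale minus_one_power_iff if_False)

lemma wedge_commute_even:
  assumes "\<omega> \<in> forms A k" "\<eta> \<in> forms A l" "even (k * l)"
  shows "wedge k l \<omega> \<eta> = wedge l k \<eta> \<omega>"
  using wedge_commute[OF assms(1,2)] assms(3) by (simp only: form_scale_1 minus_one_power_iff if_True)

lemma wedge_self_odd:
  assumes "\<omega> \<in> forms A k" "odd k"
  shows "wedge k k \<omega> \<omega> = 0"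
proof -
  have "wedge k k \<omega> \<omega> = - wedge k k \<omega> \<omega>" using wedge_commute_odd[OF assms(1,1)] assms(2) by simp
  then show ?thesis by (simp add: fun_eq_iff)
qed

lemma wedge_in_forms: "\<omega> \<in> forms A k \<Longrightarrow> \<eta> \<in> forms A l \<Longrightarrow> n = k + l \<Longrightarrow> wedge k l \<omega> \<eta> \<in> forms A n"
  using wedge_forms by blast

lemma ext_d_in_forms: "\<omega> \<in> forms A k \<Longrightarrow> n = Suc k \<Longrightarrow> ext_d A k \<omega> \<in> forms A n"
  using ext_d_forms by blast

lemma leibniz_even:
  assumes "\<omega> \<in> forms A k" "\<eta> \<in> forms A l" "even k" "n = k + l" "k' = Suc k" "l' = Suc l"
  shows "ext_d A n (wedge k l \<omega> \<eta>) = wedge k' l (ext_d A k \<omega>) \<eta> + wedge k l' \<omega> (ext_d A l \<eta>)"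
  using leibniz[OF assms(1,2)] assms(3-6) by (simp add: minus_one_power_iff)

lemma leibniz_odd:
  assumes "\<omega> \<in> forms A k" "\<eta> \<in> forms A l" "odd k" "n = k + l" "k' = Suc k" "l' = Suc l"
  shows "ext_d A n (wedge k l \<omega> \<eta>) = wedge k' l (ext_d A k \<omega>) \<eta> - wedge k l' \<omega> (ext_d A l \<eta>)"
  using leibniz[OF assms(1,2)] assms(3-6) by (simp add: minus_one_power_iff flip: form_minus_eq_scale)

lemma ext_d_twice: "\<omega> \<in> forms A k \<Longrightarrow> n = Suc k \<Longrightarrow> ext_d A n (ext_d A k \<omega>) = 0"
  using ext_d_ext_d by blast

lemma ext_d_add:
  assumes "\<omega> \<in> forms A k" "\<eta> \<in> forms A k"
  shows "ext_d A k (\<omega> + \<eta>) = ext_d A k \<omega> + ext_d A k \<eta>"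
proof (rule forms_eqI)
  fix c x v assume cx: "c \<in> A" "x \<in> im_chart c"
  have "dir_D (\<omega> + \<eta>) c x u w = dir_D \<omega> c x u w + dir_D \<eta> c x u w" for u w
    by (rule dir_D_eqI) (simp add: has_derivative_add[OF form_has_derivative[OF assms(1) cx] form_has_derivative[OF assms(2) cx]])
  then show "ext_d A k (\<omega> + \<eta>) c x v = (ext_d A k \<omega> + ext_d A k \<eta>) c x v"
    by (simp add: ext_d_sum[OF cx] sum.distrib distrib_left)
qed (use assms in \<open>blast intro: ext_d_forms form_add\<close>)+

lemma ext_d_scale:
  assumes "\<omega> \<in> forms A k"
  shows "ext_d A k (form_scale r \<omega>) = form_scale r (ext_d A k \<omega>)"
proof (rule forms_eqI)
  fix c x v assume cx: "c \<in> A" "x \<in> im_chart c"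
  have "dir_D (form_scale r \<omega>) c x u w = r * dir_D \<omega> c x u w" for u w
    by (rule dir_D_eqI) (simp add: form_scale_def has_derivative_mult_right[OF form_has_derivative[OF assms cx]])
  then show "ext_d A k (form_scale r \<omega>) c x v = form_scale r (ext_d A k \<omega>) c x v"
    by (simp add: ext_d_sum[OF cx] form_scale_def sum_distrib_left mult.left_commute)
qed (use assms in \<open>blast intro: ext_d_forms form_scale_forms\<close>)+

lemma ext_d_minus: "\<omega> \<in> forms A k \<Longrightarrow> ext_d A k (- \<omega>) = - ext_d A k \<omega>"
  by (simp add: form_minus_eq_scale ext_d_scale)

lemma ext_d_diff: "\<omega> \<in> forms A k \<Longrightarrow> \<eta> \<in> forms A k \<Longrightarrow> ext_d A k (\<omega> - \<eta>) = ext_d A k \<omega> - ext_d A k \<eta>"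
  using ext_d_add[OF _ form_minus, of \<omega> k \<eta>] by (simp add: ext_d_minus)

lemma zero_form: "0 \<in> forms A k"
  by (rule formsI) (auto simp: alternating_0 zero_fun_def intro: smooth_on_const open_im)

end

section \<open>The ideal of a foliation\<close>

text \<open>One vector is changed at a time, which adds a multiple of a value with a repeated argument.\<close>

lemma alternating_add_multiples:
  assumes "alternating n \<psi>" "i < n" "m \<le> n"
  shows "\<psi> (\<lambda>j. if j < m \<and> j \<noteq> i then v j + r j *\<^sub>R v i else v j) = \<psi> v"
  using assms(3)
proof (induction m)
  case 0
  then show ?case by simp
next
  case (Suc m)
  let ?w = "\<lambda>m j. if j < m \<and> j \<noteq> i then v j + r j *\<^sub>R v i else v j"
  show ?case
  proof (cases "m = i")
    case True
    then have "?w (Suc m) = ?w m" by (auto simp: less_Suc_eq)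
    then show ?thesis using Suc by simp
  next
    case False
    have lin: "linear (\<lambda>u. \<psi> ((?w m)(m := u)))"
      by (rule alternating_linear[OF assms(1)]) (use Suc in simp)
    have "?w (Suc m) = (?w m)(m := v m + r m *\<^sub>R v i)"
      using False by (auto simp: fun_eq_iff less_Suc_eq)
    then have "\<psi> (?w (Suc m)) = \<psi> ((?w m)(m := v m)) + r m * \<psi> ((?w m)(m := v i))"
      using linear_add[OF lin] linear_cmul[OF lin] by simp
    moreover have "\<psi> ((?w m)(m := v i)) = 0"
      by (rule alternating_eq_0[OF assms(1), of m i]) (use Suc False assms in auto)
    moreover have "(?w m)(m := v m) = ?w m" by (auto simp: fun_eq_iff)
    ultimately show ?thesis using Suc by simp
  qed
qed

lemma alternating_1_linear:
  assumes "alternating 1 a"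
  shows "linear (\<lambda>u. a (\<lambda>_. u))"
proof -
  have "a ((\<lambda>_. 0)(0 := u)) = a (\<lambda>_. u)" for u
    by (rule first_argsD[OF alternating_first_args[OF assms]]) simp
  then show ?thesis using alternating_linear[OF assms, of 0 "\<lambda>_. 0"] by simp
qed

text \<open>By subtracting multiples of one vector, all but one of the arguments can be moved into the
  hyperplane \<open>ker a\<close>. In each term of the wedge product, the factor that does not receive the
  exceptional argument then vanishes.\<close>

lemma pwedge_vanishing_on_hyperplane:
  assumes a: "alternating 1 a" and \<phi>: "alternating k \<phi>" and \<psi>: "alternating l \<psi>"
    and \<phi>0: "\<And>v. (\<And>i. i < k \<Longrightarrow> a (\<lambda>_. v i) = 0) \<Longrightarrow> \<phi> v = 0"
    and \<psi>0: "\<And>v. (\<And>i. i < l \<Longrightarrow> a (\<lambda>_. v i) = 0) \<Longrightarrow> \<psi> v = 0"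
  shows "pwedge k l \<phi> \<psi> v = 0"
proof -
  note lin = alternating_1_linear[OF a]
  have core: "pwedge k l \<phi> \<psi> w = 0" if w: "\<And>j. j < k + l \<Longrightarrow> j \<noteq> i \<Longrightarrow> a (\<lambda>_. w j) = 0" for w i
  proof -
    have "tensor k \<phi> \<psi> (w \<circ> \<sigma>) = 0" if \<sigma>: "\<sigma> permutes {..<k + l}" for \<sigma>
    proof (cases "\<exists>j<k. \<sigma> j = i")
      case False
      then have "\<phi> (w \<circ> \<sigma>) = 0"
        using permutes_in_image[OF \<sigma>] by (intro \<phi>0) (auto intro!: w)
      then show ?thesis by (simp add: tensor_def)
    next
      case True
      then obtain j where j: "j < k" "\<sigma> j = i" by blast
      have "\<sigma> (k + m) \<noteq> i" for m
        using j permutes_inj[OF \<sigma>] by (metis injD not_add_less1)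
      then have "\<psi> (\<lambda>m. (w \<circ> \<sigma>) (k + m)) = 0"
        using permutes_in_image[OF \<sigma>] by (intro \<psi>0) (auto intro!: w)
      then show ?thesis by (simp add: tensor_def)
    qed
    then have "Alt (k + l) (tensor k \<phi> \<psi>) w = Alt (k + l) (\<lambda>_. 0) w" by (intro Alt_cong) simp
    then show ?thesis by (simp add: pwedge_def)
  qed
  show ?thesis
  proof (cases "\<exists>i<k + l. a (\<lambda>_. v i) \<noteq> 0")
    case False
    then show ?thesis by (intro core[where w=v and i=0]) auto
  next
    case True
    then obtain i where i: "i < k + l" "a (\<lambda>_. v i) \<noteq> 0" by blast
    \<comment> \<open>the multiples of \<open>v i\<close> that move the other arguments into the kernel of \<open>a\<close>\<close>
    let ?r = "\<lambda>j. - (a (\<lambda>_. v j) / a (\<lambda>_. v i))"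
    let ?w = "\<lambda>j. if j < k + l \<and> j \<noteq> i then v j + ?r j *\<^sub>R v i else v j"
    have "pwedge k l \<phi> \<psi> ?w = 0"
    proof (rule core[where i=i])
      fix j assume "j < k + l" "j \<noteq> i"
      then show "a (\<lambda>_. ?w j) = 0"
        using i linear_add[OF lin, of "v j" "?r j *\<^sub>R v i"] linear_cmul[OF lin, of "?r j" "v i"] by simp
    qed
    then show ?thesis
      using alternating_add_multiples[OF alternating_pwedge[OF \<phi> \<psi>] i(1) order_refl, of v ?r] by (simp only:)
  qed
qed

text \<open>Evaluate \<open>a \<and> \<phi>\<close> on a tuple in \<open>ker a\<close> preceded by a vector \<open>n\<close> outside it: only the term \<open>a n * \<phi> v\<close>
  is left.\<close>

lemma pwedge_1_kernel:
  assumes a: "alternating 1 a" and \<phi>: "alternating k \<phi>" and n: "a (\<lambda>_. n) \<noteq> 0"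
    and zero: "\<And>v. pwedge 1 k a \<phi> v = 0" and v: "\<And>i. i < k \<Longrightarrow> a (\<lambda>_. v i) = 0"
  shows "\<phi> v = 0"
proof -
  let ?w = "\<lambda>j. if j = 0 then n else v (j - 1)"
  have "0 = (\<Sum>i\<le>k. (-1) ^ i * (a (\<lambda>_. ?w i) * \<phi> (\<lambda>j. if j < i then ?w j else ?w (Suc j))))"
    using zero[of ?w] unfolding pwedge_1[OF alternating_first_args[OF a] \<phi>] by (rule sym)
  also have "\<dots> = (\<Sum>i\<le>k. if i = 0 then a (\<lambda>_. n) * \<phi> v else 0)"
    using v by (intro sum.cong) auto
  finally show ?thesis using n by simp
qed

context manifold
begin

lemma ideal_forms: "\<omega> \<in> ideal A F k \<Longrightarrow> \<omega> \<in> forms A k"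
  by (simp add: ideal_def)

lemma ideal_iff:
  "\<omega> \<in> ideal A F k \<longleftrightarrow> \<omega> \<in> forms A k \<and> (\<forall>c\<in>A. \<forall>p\<in>dom_chart c. \<forall>v.
    (\<forall>i<k. leaf_tangent F c p (v i)) \<longrightarrow> \<omega> c (coord c p) v = 0)"
  by (simp add: ideal_def)

lemma idealD:
  "\<omega> \<in> ideal A F k \<Longrightarrow> c \<in> A \<Longrightarrow> p \<in> dom_chart c \<Longrightarrow> (\<And>i. i < k \<Longrightarrow> leaf_tangent F c p (v i)) \<Longrightarrow>
    \<omega> c (coord c p) v = 0"
  unfolding ideal_iff by blast

lemma ideal_add: "\<omega> \<in> ideal A F k \<Longrightarrow> \<eta> \<in> ideal A F k \<Longrightarrow> \<omega> + \<eta> \<in> ideal A F k"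
  unfolding ideal_iff by (auto intro: form_add)

lemma ideal_scale: "\<omega> \<in> ideal A F k \<Longrightarrow> form_scale r \<omega> \<in> ideal A F k"
  unfolding ideal_iff by (auto intro: form_scale_forms) (simp add: form_scale_def)

lemma ideal_minus: "\<omega> \<in> ideal A F k \<Longrightarrow> - \<omega> \<in> ideal A F k"
  unfolding form_minus_eq_scale by (rule ideal_scale)

lemma ideal_diff: "\<omega> \<in> ideal A F k \<Longrightarrow> \<eta> \<in> ideal A F k \<Longrightarrow> \<omega> - \<eta> \<in> ideal A F k"
  using ideal_add[OF _ ideal_minus, of \<omega> F k \<eta>] by simp

lemma ideal_zero: "0 \<in> ideal A F k"
  unfolding ideal_iff by (simp add: zero_form)

lemma ideal_wedge_right:
  assumes "\<omega> \<in> forms A k" "\<eta> \<in> ideal A F l" "n = k + l"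
  shows "wedge k l \<omega> \<eta> \<in> ideal A F n"
  unfolding ideal_iff
proof (intro conjI ballI allI impI)
  show "wedge k l \<omega> \<eta> \<in> forms A n"
    by (rule wedge_in_forms[OF assms(1) ideal_forms[OF assms(2)] assms(3)])
  fix c p v assume c: "c \<in> A" "p \<in> dom_chart c" and v: "\<forall>i<n. leaf_tangent F c p (v i)"
  have "\<eta> c (coord c p) (\<lambda>i. v (\<sigma> (k + i))) = 0" if "\<sigma> permutes {..<k + l}" for \<sigma>
  proof -
    have "leaf_tangent F c p (v (\<sigma> (k + i)))" if "i < l" for i
      using v permutes_in_image[OF \<open>\<sigma> permutes {..<k + l}\<close>] assms(3) that by simp
    then show ?thesis by (rule idealD[OF assms(2) c])
  qed
  then show "wedge k l \<omega> \<eta> c (coord c p) v = 0" by (simp add: wedge_def)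
qed

lemma ideal_wedge_left:
  assumes "\<omega> \<in> ideal A F k" "\<eta> \<in> forms A l" "n = k + l"
  shows "wedge k l \<omega> \<eta> \<in> ideal A F n"
  unfolding wedge_commute[OF ideal_forms[OF assms(1)] assms(2)]
  by (rule ideal_scale[OF ideal_wedge_right[OF assms(2,1)]]) (simp add: assms(3))

lemma defining_form_forms: "defining_form A F \<alpha> \<Longrightarrow> \<alpha> \<in> forms A 1"
  unfolding defining_form_def by blast

lemma defining_form_tangent:
  "defining_form A F \<alpha> \<Longrightarrow> c \<in> A \<Longrightarrow> p \<in> dom_chart c \<Longrightarrow>
    leaf_tangent F c p v \<longleftrightarrow> \<alpha> c (coord c p) (\<lambda>_. v) = 0"
  unfolding defining_form_def by blast

lemma defining_form_nonzero:
  "defining_form A F \<alpha> \<Longrightarrow> c \<in> A \<Longrightarrow> p \<in> dom_chart c \<Longrightarrow> \<exists>v. \<alpha> c (coord c p) (\<lambda>_. v) \<noteq> 0"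
  unfolding defining_form_def by blast

lemma defining_form_ideal:
  assumes "defining_form A F \<alpha>"
  shows "\<alpha> \<in> ideal A F 1"
  unfolding ideal_iff
proof (intro conjI ballI allI impI)
  show \<alpha>: "\<alpha> \<in> forms A 1" by (rule defining_form_forms[OF assms])
  fix c p and v :: "nat \<Rightarrow> 'e"
  assume c: "c \<in> A" "p \<in> dom_chart c" and v: "\<forall>i<1. leaf_tangent F c p (v i)"
  have "\<alpha> c (coord c p) v = \<alpha> c (coord c p) (\<lambda>_. v 0)"
    by (rule first_argsD[OF alternating_first_args[OF forms_alternating[OF \<alpha>]]]) simp
  then show "\<alpha> c (coord c p) v = 0" using v defining_form_tangent[OF assms c] by simp
qed

text \<open>The reason why the wedge product with \<open>\<I>(F)\<close> descends to the leafwise complex, and the source of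
  most cancellations below.\<close>

lemma ideal_wedge_ideal:
  assumes \<alpha>: "defining_form A F \<alpha>" and \<omega>: "\<omega> \<in> ideal A F k" and \<eta>: "\<eta> \<in> ideal A F l"
  shows "wedge k l \<omega> \<eta> = 0"
proof (rule forms_eqI[OF wedge_forms[OF ideal_forms[OF \<omega>] ideal_forms[OF \<eta>]] zero_form])
  fix c x v assume c: "c \<in> A" and "x \<in> im_chart c"
  then obtain p where p: "p \<in> dom_chart c" and x: "x = coord c p" by (blast elim: im_chart_point)
  have "pwedge k l (\<omega> c x) (\<eta> c x) v = 0"
  proof (rule pwedge_vanishing_on_hyperplane)
    show "alternating 1 (\<alpha> c x)" by (rule forms_alternating[OF defining_form_forms[OF \<alpha>]])
    show "alternating k (\<omega> c x)" "alternating l (\<eta> c x)"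
      using forms_alternating ideal_forms \<omega> \<eta> by blast+
    show "\<omega> c x v = 0" if "\<And>i. i < k \<Longrightarrow> \<alpha> c x (\<lambda>_. v i) = 0" for v
      unfolding x by (rule idealD[OF \<omega> c p]) (use that in \<open>simp add: defining_form_tangent[OF \<alpha> c p] x\<close>)
    show "\<eta> c x v = 0" if "\<And>i. i < l \<Longrightarrow> \<alpha> c x (\<lambda>_. v i) = 0" for v
      unfolding x by (rule idealD[OF \<eta> c p]) (use that in \<open>simp add: defining_form_tangent[OF \<alpha> c p] x\<close>)
  qed
  then show "wedge k l \<omega> \<eta> c x v = 0 c x v" by (simp add: wedge_eq_pwedge)
qed

text \<open>Together with the previous lemma, applied to \<open>\<alpha>\<close>, this identifies \<open>\<I>(F)\<close> with the annihilator
  of \<open>\<alpha>\<close>. Membership becomes an equation between forms that can be differentiated.\<close>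

lemma ideal_of_wedge_zero:
  assumes \<alpha>: "defining_form A F \<alpha>" and \<omega>: "\<omega> \<in> forms A k" and zero: "wedge 1 k \<alpha> \<omega> = 0"
  shows "\<omega> \<in> ideal A F k"
  unfolding ideal_iff
proof (intro conjI ballI allI impI \<omega>)
  fix c p v assume c: "c \<in> A" "p \<in> dom_chart c" and v: "\<forall>i<k. leaf_tangent F c p (v i)"
  obtain n where n: "\<alpha> c (coord c p) (\<lambda>_. n) \<noteq> 0" using defining_form_nonzero[OF \<alpha> c] by blast
  have "pwedge 1 k (\<alpha> c (coord c p)) (\<omega> c (coord c p)) v = 0" for v
    unfolding wedge_eq_pwedge[symmetric] zero by simp
  from pwedge_1_kernel[OF forms_alternating[OF defining_form_forms[OF \<alpha>]] forms_alternating[OF \<omega>] n this]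
  show "\<omega> c (coord c p) v = 0" using v defining_form_tangent[OF \<alpha> c] by blast
qed

lemma defining_pairD:
  assumes "defining_pair A F \<alpha> \<beta>"
  shows "defining_form A F \<alpha>" "\<alpha> \<in> forms A 1" "\<beta> \<in> forms A 1" "ext_d A 1 \<alpha> = wedge 1 1 \<alpha> \<beta>"
  using assms defining_form_forms unfolding defining_pair_def by blast+

text \<open>From \<open>\<alpha> \<and> \<omega> = 0\<close> follows \<open>\<alpha> \<and> d\<omega> = d\<alpha> \<and> \<omega> = \<alpha> \<and> (\<beta> \<and> \<omega>)\<close>, and this vanishes since \<open>\<beta> \<and> \<omega>\<close> lies in the
  ideal with \<open>\<omega>\<close>.\<close>

lemma ideal_ext_d:
  assumes pair: "defining_pair A F \<alpha> \<beta>" and \<omega>: "\<omega> \<in> ideal A F k" and n: "n = Suc k"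
  shows "ext_d A k \<omega> \<in> ideal A F n"
proof (rule ideal_of_wedge_zero)
  note D = defining_pairD[OF pair]
  note \<omega>f = ideal_forms[OF \<omega>]
  show "defining_form A F \<alpha>" by (rule D)
  show "ext_d A k \<omega> \<in> forms A n" by (rule ext_d_in_forms[OF \<omega>f n])
  have "wedge 2 k (ext_d A 1 \<alpha>) \<omega> = wedge 1 n \<alpha> (wedge 1 k \<beta> \<omega>)"
    unfolding D(4) by (rule wedge_assoc[OF D(2)]) (simp_all add: n)
  also have "\<dots> = 0"
    using ideal_wedge_ideal[OF D(1) defining_form_ideal[OF D(1)] ideal_wedge_right[OF D(3) \<omega>]] n by simp
  finally have 1: "wedge 2 k (ext_d A 1 \<alpha>) \<omega> = 0" .
  have "ext_d A n (wedge 1 k \<alpha> \<omega>) = wedge 2 k (ext_d A 1 \<alpha>) \<omega> - wedge 1 n \<alpha> (ext_d A k \<omega>)"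
    by (rule leibniz_odd[OF D(2) \<omega>f]) (simp_all add: n)
  moreover have "wedge 1 k \<alpha> \<omega> = 0"
    by (rule ideal_wedge_ideal[OF D(1) defining_form_ideal[OF D(1)] \<omega>])
  moreover have "ext_d A n 0 = 0" using ext_d_diff[OF zero_form zero_form, of n] by simp
  ultimately show "wedge 1 n \<alpha> (ext_d A k \<omega>) = 0" using 1 by simp
qed

text \<open>From \<open>0 = d(d\<alpha>) = d(\<alpha> \<and> \<beta>) = \<alpha> \<and> \<beta> \<and> \<beta> - \<alpha> \<and> d\<beta>\<close>.\<close>

lemma ext_d_beta_ideal:
  assumes pair: "defining_pair A F \<alpha> \<beta>"
  shows "ext_d A 1 \<beta> \<in> ideal A F 2"
proof (rule ideal_of_wedge_zero)
  note D = defining_pairD[OF pair]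
  show "defining_form A F \<alpha>" by (rule D)
  show "ext_d A 1 \<beta> \<in> forms A 2" by (rule ext_d_in_forms[OF D(3)]) simp
  have "ext_d A 2 (ext_d A 1 \<alpha>) = 0" by (rule ext_d_twice[OF D(2)]) simp
  moreover have "ext_d A 2 (wedge 1 1 \<alpha> \<beta>) = wedge 2 1 (ext_d A 1 \<alpha>) \<beta> - wedge 1 2 \<alpha> (ext_d A 1 \<beta>)"
    by (rule leibniz_odd[OF D(2,3)]) simp_all
  moreover have "wedge 2 1 (ext_d A 1 \<alpha>) \<beta> = wedge 1 2 \<alpha> (wedge 1 1 \<beta> \<beta>)"
    unfolding D(4) by (rule wedge_assoc[OF D(2)]) simp_all
  moreover have "wedge 1 1 \<beta> \<beta> = 0" by (rule wedge_self_odd[OF D(3)]) simp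
  ultimately show "wedge 1 2 \<alpha> (ext_d A 1 \<beta>) = 0" by (simp add: D(4) del: One_nat_def)
qed

section \<open>The form T and the Godbillon-Vey form under a change of beta\<close>

lemma defining_familiesD:
  assumes "defining_families A J \<F> \<alpha> \<beta>"
  shows "smooth_form_family A J 1 \<alpha>" "smooth_form_family A J 1 \<beta>"
    "t \<in> J \<Longrightarrow> defining_pair A (\<F> t) (\<alpha> t) (\<beta> t)"
  using assms unfolding defining_families_def by blast+

lemma family_ext_d_1: "open J \<Longrightarrow> smooth_form_family A J 1 \<beta> \<Longrightarrow> smooth_form_family A J 2 (\<lambda>s. ext_d A 1 (\<beta> s))"
  using family_ext_d[of J 1 \<beta>] by (simp add: numeral_2_eq_2)

lemma T_form_ideal:
  assumes "open J" "t \<in> J" "defining_families A J \<F> \<alpha> \<beta>"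
  shows "T_form A \<beta> t \<in> ideal A (\<F> t) 3"
  unfolding T_form_def
  by (rule ideal_wedge_right[OF form_dot_forms[OF assms(1) _ assms(2)]
        ext_d_beta_ideal[OF defining_familiesD(3)[OF assms(3,2)]]])
    (use defining_familiesD[OF assms(3)] in simp_all)

text \<open>The form \<open>d\<beta> \<and> d\<beta>\<close> vanishes for all parameters, being a product of elements of the ideal. Its
  parameter derivative is twice \<open>d\<beta>' \<and> d\<beta> = d(\<beta>' \<and> d\<beta>)\<close>, where \<open>\<beta>'\<close> is the derivative of \<open>\<beta>\<close>.\<close>

lemma T_form_closed:
  assumes J: "open J" "t \<in> J" and fam: "defining_families A J \<F> \<alpha> \<beta>"
  shows "ext_d A 3 (T_form A \<beta> t) = 0"
proof -
  note D = defining_familiesD[OF fam]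
  have \<beta>f: "\<beta> t \<in> forms A 1" and db: "form_dot \<beta> t \<in> forms A 1"
    using family_forms[OF D(2) J(2)] form_dot_forms[OF J(1) D(2) J(2)] .
  let ?B = "ext_d A 1 (\<beta> t)" and ?dB = "ext_d A 1 (form_dot \<beta> t)"
  have B: "?B \<in> forms A 2" "?dB \<in> forms A 2" using \<beta>f db by (auto intro: ext_d_in_forms)
  note fB = family_ext_d_1[OF J(1) D(2)]
  have "form_dot (\<lambda>s. wedge 2 2 (ext_d A 1 (\<beta> s)) (ext_d A 1 (\<beta> s))) t = 0"
  proof (rule form_dot_vanishing[OF J])
    fix s assume "s \<in> J"
    note P = D(3)[OF this]
    show "wedge 2 2 (ext_d A 1 (\<beta> s)) (ext_d A 1 (\<beta> s)) = 0"
      by (rule ideal_wedge_ideal[OF defining_pairD(1)[OF P] ext_d_beta_ideal[OF P] ext_d_beta_ideal[OF P]])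
  qed
  moreover have "form_dot (\<lambda>s. wedge 2 2 (ext_d A 1 (\<beta> s)) (ext_d A 1 (\<beta> s))) t
      = wedge 2 2 ?dB ?B + wedge 2 2 ?B ?dB"
    using form_dot_wedge[OF J fB fB] form_dot_ext_d[OF J D(2)] by simp
  moreover have "wedge 2 2 ?B ?dB = wedge 2 2 ?dB ?B"
    by (rule wedge_commute_even[OF B]) simp
  ultimately have 1: "wedge 2 2 ?dB ?B = 0" by (simp add: fun_eq_iff)
  have "ext_d A 3 (wedge 1 2 (form_dot \<beta> t) ?B) = wedge 2 2 ?dB ?B - wedge 1 3 (form_dot \<beta> t) (ext_d A 2 ?B)"
    by (rule leibniz_odd[OF db B(1)]) simp_all
  moreover have "ext_d A 2 ?B = 0" by (rule ext_d_twice[OF \<beta>f]) simp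
  ultimately show ?thesis using 1 by (simp add: T_form_def)
qed

lemma T_form_add_exact:
  assumes J: "open J" "t \<in> J" and \<beta>: "smooth_form_family A J 1 \<beta>" and h: "smooth_form_family A J 0 h"
  shows "T_form A (\<lambda>s. \<beta> s + ext_d A 0 (h s)) t
    = T_form A \<beta> t + ext_d A 2 (wedge 0 2 (form_dot h t) (ext_d A 1 (\<beta> t)))"
proof -
  have dh: "smooth_form_family A J 1 (\<lambda>s. ext_d A 0 (h s))" using family_ext_d[OF J(1) h] by simp
  have \<beta>f: "\<beta> t \<in> forms A 1" and hf: "h t \<in> forms A 0" and dhf: "ext_d A 0 (h t) \<in> forms A 1"
    using family_forms \<beta> h dh J(2) by blast+
  have B: "ext_d A 1 (\<beta> t) \<in> forms A 2" by (rule ext_d_in_forms[OF \<beta>f]) simp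
  have 1: "ext_d A 1 (\<beta> t + ext_d A 0 (h t)) = ext_d A 1 (\<beta> t)"
    using ext_d_add[OF \<beta>f dhf] ext_d_twice[OF hf] by simp
  have 2: "form_dot (\<lambda>s. \<beta> s + ext_d A 0 (h s)) t = form_dot \<beta> t + ext_d A 0 (form_dot h t)"
    using form_dot_add[OF J \<beta> dh] form_dot_ext_d[OF J h] by simp
  have "ext_d A 2 (wedge 0 2 (form_dot h t) (ext_d A 1 (\<beta> t)))
      = wedge 1 2 (ext_d A 0 (form_dot h t)) (ext_d A 1 (\<beta> t)) + wedge 0 3 (form_dot h t) (ext_d A 2 (ext_d A 1 (\<beta> t)))"
    by (rule leibniz_even[OF form_dot_forms[OF J(1) h J(2)] B]) simp_all
  moreover have "ext_d A 2 (ext_d A 1 (\<beta> t)) = 0" by (rule ext_d_twice[OF \<beta>f]) simp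
  ultimately show ?thesis by (simp add: T_form_def 1 2 wedge_add_left del: One_nat_def)
qed

text \<open>Write a prime for the parameter derivative. Replacing \<open>\<beta>\<close> by \<open>\<beta> + a\<close> changes \<open>\<beta>' \<and> d\<beta>\<close> by
  \<open>\<beta>' \<and> da + a' \<and> d\<beta> + a' \<and> da\<close>. For all parameters \<open>a \<and> d\<beta> = 0\<close> and \<open>a \<and> da = 0\<close>. Differentiating the first
  identity gives \<open>d(a \<and> \<beta>') = \<beta>' \<and> da + a' \<and> d\<beta>\<close>, and the second \<open>d(a' \<and> a) = - 2 a' \<and> da\<close>. Note that \<open>a'\<close> is
  in general not in the ideal, as the foliation moves.\<close>

lemma T_form_add_ideal:
  assumes J: "open J" "t \<in> J" and \<beta>: "smooth_form_family A J 1 \<beta>" and a: "smooth_form_family A J 1 a"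
    and pair: "\<And>s. s \<in> J \<Longrightarrow> defining_pair A (\<F> s) (\<alpha> s) (\<beta> s)"
    and ideal: "\<And>s. s \<in> J \<Longrightarrow> a s \<in> ideal A (\<F> s) 1"
  shows "T_form A (\<lambda>s. \<beta> s + a s) t = T_form A \<beta> t +
    ext_d A 2 (wedge 1 1 (a t) (form_dot \<beta> t) - form_scale (1/2) (wedge 1 1 (form_dot a t) (a t)))"
proof -
  let ?b = "form_dot \<beta> t" and ?a = "form_dot a t"
  let ?B = "ext_d A 1 (\<beta> t)" and ?A = "ext_d A 1 (a t)"
  let ?dB = "ext_d A 1 ?b" and ?dA = "ext_d A 1 ?a"
  have F: "\<beta> t \<in> forms A 1" "a t \<in> forms A 1" using family_forms \<beta> a J(2) by blast+
  have dF: "?b \<in> forms A 1" "?a \<in> forms A 1" using form_dot_forms[OF J(1) _ J(2)] \<beta> a by blast+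
  have E: "?B \<in> forms A 2" "?A \<in> forms A 2" "?dB \<in> forms A 2" "?dA \<in> forms A 2"
    using F dF by (auto intro: ext_d_in_forms)
  note fB = family_ext_d_1[OF J(1) \<beta>] and fA = family_ext_d_1[OF J(1) a]
  have "wedge 1 2 (a s) (ext_d A 1 (\<beta> s)) = 0" "wedge 1 2 (a s) (ext_d A 1 (a s)) = 0" if s: "s \<in> J" for s
  proof -
    note P = pair[OF s] and I = ideal[OF s]
    note zero = ideal_wedge_ideal[OF defining_pairD(1)[OF P] I]
    show "wedge 1 2 (a s) (ext_d A 1 (\<beta> s)) = 0" by (rule zero[OF ext_d_beta_ideal[OF P]])
    show "wedge 1 2 (a s) (ext_d A 1 (a s)) = 0" by (rule zero[OF ideal_ext_d[OF P I]]) simp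
  qed
  from form_dot_vanishing[OF J this(1)] form_dot_vanishing[OF J this(2)] this[OF J(2)]
  have z: "wedge 1 2 ?a ?B + wedge 1 2 (a t) ?dB = 0" "wedge 1 2 ?a ?A + wedge 1 2 (a t) ?dA = 0"
    "wedge 1 2 (a t) ?B = 0" "wedge 1 2 (a t) ?A = 0"
    using form_dot_wedge[OF J a fB] form_dot_wedge[OF J a fA] form_dot_ext_d[OF J \<beta>] form_dot_ext_d[OF J a]
    by simp_all
  have c: "wedge 2 1 ?A ?b = wedge 1 2 ?b ?A" "wedge 2 1 ?dA (a t) = wedge 1 2 (a t) ?dA"
    by (rule wedge_commute_even; use E F dF in simp)+
  have "ext_d A 2 (wedge 1 1 (a t) ?b) = wedge 2 1 ?A ?b - wedge 1 2 (a t) ?dB"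
    by (rule leibniz_odd[OF F(2) dF(1)]) simp_all
  also have "\<dots> = wedge 1 2 ?b ?A + wedge 1 2 ?a ?B"
    using z(1) c(1) by (simp add: add_eq_0_iff)
  finally have 1: "ext_d A 2 (wedge 1 1 (a t) ?b) = wedge 1 2 ?b ?A + wedge 1 2 ?a ?B" .
  have "ext_d A 2 (wedge 1 1 ?a (a t)) = wedge 2 1 ?dA (a t) - wedge 1 2 ?a ?A"
    by (rule leibniz_odd[OF dF(2) F(2)]) simp_all
  also have "\<dots> = form_scale (-2) (wedge 1 2 ?a ?A)"
    using z(2) c(2) by (simp add: form_scale_def fun_eq_iff add_eq_0_iff)
  finally have 2: "ext_d A 2 (wedge 1 1 ?a (a t)) = form_scale (-2) (wedge 1 2 ?a ?A)" .
  have W: "wedge 1 1 (a t) ?b \<in> forms A 2" "wedge 1 1 ?a (a t) \<in> forms A 2"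
    using F dF by (auto intro: wedge_in_forms)
  have "ext_d A 2 (wedge 1 1 (a t) ?b - form_scale (1/2) (wedge 1 1 ?a (a t)))
      = wedge 1 2 ?b ?A + wedge 1 2 ?a ?B + wedge 1 2 ?a ?A"
    using ext_d_diff[OF W(1) form_scale_forms[OF W(2)]] ext_d_scale[OF W(2)] 1 2
    by (simp add: form_scale_scale flip: form_minus_eq_scale)
  then show ?thesis
    using form_dot_add[OF J \<beta> a] ext_d_add[OF F]
    by (simp add: T_form_def wedge_add_left wedge_add_right add.assoc add.commute)
qed

lemma GV_form_add_exact:
  assumes \<beta>: "\<beta> \<in> forms A 1" and h: "h \<in> forms A 0"
  defines "\<beta>' \<equiv> \<beta> + ext_d A 0 h"
  shows "wedge 1 2 \<beta>' (ext_d A 1 \<beta>') = wedge 1 2 \<beta> (ext_d A 1 \<beta>) + ext_d A 2 (wedge 0 2 h (ext_d A 1 \<beta>))"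
proof -
  have dh: "ext_d A 0 h \<in> forms A 1" by (rule ext_d_in_forms[OF h]) simp
  have B: "ext_d A 1 \<beta> \<in> forms A 2" by (rule ext_d_in_forms[OF \<beta>]) simp
  have 1: "ext_d A 1 \<beta>' = ext_d A 1 \<beta>"
    unfolding \<beta>'_def using ext_d_add[OF \<beta> dh] ext_d_twice[OF h] by simp
  have "ext_d A 2 (wedge 0 2 h (ext_d A 1 \<beta>))
      = wedge 1 2 (ext_d A 0 h) (ext_d A 1 \<beta>) + wedge 0 3 h (ext_d A 2 (ext_d A 1 \<beta>))"
    by (rule leibniz_even[OF h B]) simp_all
  moreover have "ext_d A 2 (ext_d A 1 \<beta>) = 0" by (rule ext_d_twice[OF \<beta>]) simp
  ultimately show ?thesis unfolding 1 by (simp add: \<beta>'_def wedge_add_left)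
qed

text \<open>In \<open>(\<beta> + a) \<and> (d\<beta> + da)\<close> the terms \<open>a \<and> d\<beta>\<close> and \<open>a \<and> da\<close> vanish, and the remaining \<open>\<beta> \<and> da\<close> is
  \<open>d(a \<and> \<beta>)\<close>.\<close>

lemma GV_form_add_ideal:
  assumes pair: "defining_pair A F \<alpha> \<beta>" and a: "a \<in> ideal A F 1"
  defines "\<beta>' \<equiv> \<beta> + a"
  shows "wedge 1 2 \<beta>' (ext_d A 1 \<beta>') = wedge 1 2 \<beta> (ext_d A 1 \<beta>) + ext_d A 2 (wedge 1 1 a \<beta>)"
proof -
  note D = defining_pairD[OF pair] and af = ideal_forms[OF a]
  have E: "ext_d A 1 a \<in> forms A 2" by (rule ext_d_in_forms[OF af]) simp
  have z: "wedge 1 2 a (ext_d A 1 \<beta>) = 0" by (rule ideal_wedge_ideal[OF D(1) a ext_d_beta_ideal[OF pair]])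
  have z': "wedge 1 2 a (ext_d A 1 a) = 0" by (rule ideal_wedge_ideal[OF D(1) a ideal_ext_d[OF pair a]]) simp
  have "ext_d A 2 (wedge 1 1 a \<beta>) = wedge 2 1 (ext_d A 1 a) \<beta> - wedge 1 2 a (ext_d A 1 \<beta>)"
    by (rule leibniz_odd[OF af D(3)]) simp_all
  moreover have "wedge 2 1 (ext_d A 1 a) \<beta> = wedge 1 2 \<beta> (ext_d A 1 a)"
    by (rule wedge_commute_even[OF E D(3)]) simp
  ultimately show ?thesis
    using ext_d_add[OF D(3) af] z z' by (simp add: \<beta>'_def wedge_add_left wedge_add_right)
qed

text \<open>Both terms of the product rule equal \<open>\<beta>' \<and> d\<beta>\<close> up to an exact form, hence the factor 2.\<close>

lemma GV_form_dot:
  assumes J: "open J" "t \<in> J" and \<beta>: "smooth_form_family A J 1 \<beta>"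
  shows "form_dot (\<lambda>s. wedge 1 2 (\<beta> s) (ext_d A 1 (\<beta> s))) t
    = form_scale 2 (T_form A \<beta> t) - ext_d A 2 (wedge 1 1 (\<beta> t) (form_dot \<beta> t))"
proof -
  have F: "\<beta> t \<in> forms A 1" "form_dot \<beta> t \<in> forms A 1"
    using family_forms[OF \<beta> J(2)] form_dot_forms[OF J(1) \<beta> J(2)] .
  have B: "ext_d A 1 (\<beta> t) \<in> forms A 2" by (rule ext_d_in_forms[OF F(1)]) simp
  have "form_dot (\<lambda>s. wedge 1 2 (\<beta> s) (ext_d A 1 (\<beta> s))) t
      = T_form A \<beta> t + wedge 1 2 (\<beta> t) (ext_d A 1 (form_dot \<beta> t))"
    using form_dot_wedge[OF J \<beta> family_ext_d_1[OF J(1) \<beta>]] form_dot_ext_d[OF J \<beta>] by (simp add: T_form_def)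
  moreover have "ext_d A 2 (wedge 1 1 (\<beta> t) (form_dot \<beta> t))
      = wedge 2 1 (ext_d A 1 (\<beta> t)) (form_dot \<beta> t) - wedge 1 2 (\<beta> t) (ext_d A 1 (form_dot \<beta> t))"
    by (rule leibniz_odd[OF F]) simp_all
  moreover have "wedge 2 1 (ext_d A 1 (\<beta> t)) (form_dot \<beta> t) = T_form A \<beta> t"
    unfolding T_form_def by (rule wedge_commute_even[OF B F(2)]) simp
  moreover have "form_scale 2 (T_form A \<beta> t) = T_form A \<beta> t + T_form A \<beta> t"
    by (simp add: form_scale_def fun_eq_iff)
  ultimately show ?thesis by simp
qed

end

section \<open>Comparing two defining pairs\<close>

text \<open>The ratio of two proportional functionals as a quotient of smooth expressions in their values on a
  basis. With it the ratio of two defining forms is seen to depend smoothly on point and parameter.\<close>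

lemma proportional_functionals:
  fixes f g :: "'e::euclidean_space \<Rightarrow> real"
  assumes f: "linear f" and g: "linear g" and pos: "f n > 0" "g n > 0" and ker: "\<And>v. f v = 0 \<longleftrightarrow> g v = 0"
  defines "r \<equiv> (\<Sum>b\<in>Basis. f b * g b) / (\<Sum>b\<in>Basis. g b * g b)"
  shows "(\<Sum>b\<in>Basis. g b * g b) \<noteq> 0" "r > 0" "f v = r * g v"
proof -
  \<comment> \<open>the vector with the given value of \<open>g\<close> removed along \<open>n\<close> lies in the common kernel\<close>
  have quot: "f v = f n / g n * g v" for v
  proof -
    have "g (v - (g v / g n) *\<^sub>R n) = 0"
      using pos by (simp add: linear_diff[OF g] linear_cmul[OF g])
    then have "f (v - (g v / g n) *\<^sub>R n) = 0" using ker by blast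
    then show ?thesis by (simp add: linear_diff[OF f] linear_cmul[OF f] mult.commute)
  qed
  show nz: "(\<Sum>b\<in>Basis. g b * g b) \<noteq> 0"
  proof
    assume "(\<Sum>b\<in>Basis. g b * g b) = 0"
    then have "\<forall>b\<in>Basis. g b = 0" by (subst (asm) sum_nonneg_eq_0_iff) auto
    then have "g n = 0" using linear_eq_0_on_span[OF g, of Basis n] by simp
    then show False using pos by simp
  qed
  have "(\<Sum>b\<in>Basis. f b * g b) = f n / g n * (\<Sum>b\<in>Basis. g b * g b)"
    unfolding sum_distrib_left
  proof (intro sum.cong refl)
    show "f b * g b = f n / g n * (g b * g b)" for b using quot[of b] by (simp only: mult.assoc)
  qed
  then have r: "r = f n / g n" using nz by (simp add: r_def)
  show "r > 0" using pos by (simp add: r)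
  show "f v = r * g v" unfolding r by (rule quot)
qed

context manifold
begin

lemma foliation_chartD:
  assumes "foliation A F" "(U, f) \<in> F"
  shows "smooth_fun_on A U f"
    "c \<in> A \<Longrightarrow> p \<in> U \<Longrightarrow> p \<in> dom_chart c \<Longrightarrow> \<exists>v. dir_deriv c f p v \<noteq> 0"
proof -
  have "\<forall>(U, f)\<in>F. open U \<and> smooth_fun_on A U f \<and>
      (\<forall>c\<in>A. \<forall>p\<in>U \<inter> dom_chart c. \<exists>v. dir_deriv c f p v \<noteq> 0)"
    using assms(1) unfolding foliation_def by (rule conjunct1)
  from bspec[OF this assms(2), unfolded prod.case]
  show "smooth_fun_on A U f"
    "c \<in> A \<Longrightarrow> p \<in> U \<Longrightarrow> p \<in> dom_chart c \<Longrightarrow> \<exists>v. dir_deriv c f p v \<noteq> 0"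
    by blast+
qed

lemma foliation_overlapD:
  assumes "foliation A F" "(U, f) \<in> F" "(V, g) \<in> F" "p \<in> U" "p \<in> V"
  shows "\<exists>W D h. open W \<and> p \<in> W \<and> W \<subseteq> U \<inter> V \<and> open D \<and> f ` W \<subseteq> D \<and>
    smooth_on D h \<and> (\<forall>r\<in>D. deriv h r > 0) \<and> (\<forall>q\<in>W. g q = h (f q))"
proof -
  have "\<forall>(U, f)\<in>F. \<forall>(V, g)\<in>F. \<forall>p\<in>U \<inter> V.
      \<exists>W D h. open W \<and> p \<in> W \<and> W \<subseteq> U \<inter> V \<and> open D \<and> f ` W \<subseteq> D \<and>
        smooth_on D h \<and> (\<forall>r\<in>D. deriv h r > 0) \<and> (\<forall>q\<in>W. g q = h (f q))"
    using assms(1) unfolding foliation_def by (elim conjE)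
  from bspec[OF bspec[OF this assms(2), unfolded prod.case] assms(3), unfolded prod.case]
  show ?thesis by (rule bspec) (use assms in blast)
qed

lemma dir_deriv_has_derivative:
  assumes "foliation A F" "(U, f) \<in> F" "c \<in> A" "p \<in> dom_chart c" "p \<in> U"
  shows "((f \<circ> inv_chart c) has_derivative dir_deriv c f p) (at (coord c p))"
proof -
  have "smooth_on (coord c ` (U \<inter> dom_chart c)) (f \<circ> inv_chart c)"
    using foliation_chartD(1)[OF assms(1,2)] assms(3) unfolding smooth_fun_on_def by blast
  from smooth_on_has_derivative[OF this, of "coord c p"] show ?thesis
    using assms by (auto simp: dir_deriv_def[abs_def])
qed

text \<open>A vector transverse for one distinguished map, with the right sign, is positive for all others,
  since these are increasing functions of the first.\<close>

lemma positive_transverse_exists: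
  assumes fol: "foliation A F" and c: "c \<in> A" "p \<in> dom_chart c"
  shows "\<exists>v. positive_transverse F c p v"
proof -
  obtain U f where U: "(U, f) \<in> F" "p \<in> U"
  proof -
    have "(\<Union>(U, f)\<in>F. U) = UNIV" using fol unfolding foliation_def by (elim conjE)
    then have "p \<in> (\<Union>(U, f)\<in>F. U)" by simp
    then obtain z where "z \<in> F" "p \<in> (case z of (U, f) \<Rightarrow> U)" by (rule UN_E)
    then show thesis using that by (cases z) simp
  qed
  obtain v0 where v0: "dir_deriv c f p v0 \<noteq> 0"
    using foliation_chartD(2)[OF fol U(1) c(1) U(2) c(2)] by blast
  note Df = dir_deriv_has_derivative[OF fol U(1) c U(2)]
  interpret lf: linear "dir_deriv c f p" using Df by (rule has_derivative_linear)
  define v where "v = (if dir_deriv c f p v0 > 0 then v0 else - v0)"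
  have v: "dir_deriv c f p v > 0" using v0 lf.neg[of v0] by (auto simp: v_def)
  have "dir_deriv c g p v > 0" if V: "(V, g) \<in> F" "p \<in> V" for V g
  proof -
    obtain W D h where W: "open W" "p \<in> W" "W \<subseteq> U \<inter> V" and D: "f ` W \<subseteq> D"
      and h: "smooth_on D h" "\<forall>r\<in>D. deriv h r > 0" and gh: "\<forall>q\<in>W. g q = h (f q)"
      using foliation_overlapD[OF fol U(1) V(1) U(2) V(2)] by blast
    have fp: "f p \<in> D" using W D by blast
    have "h differentiable at (f p)" by (rule smooth_on_differentiable[OF h(1) fp])
    then have "(h has_real_derivative deriv h (f p)) (at (f p))"
      by (metis DERIV_deriv_iff_real_differentiable)
    then have Dh: "(h has_derivative (\<lambda>r. deriv h (f p) * r)) (at ((f \<circ> inv_chart c) (coord c p)))"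
      using inv_chart_coord[OF c] by (simp add: has_field_derivative_def)
    have "((g \<circ> inv_chart c) has_derivative (\<lambda>r. deriv h (f p) * r) \<circ> dir_deriv c f p) (at (coord c p))"
    proof (rule has_derivative_transform_within_open[OF diff_chain_at[OF Df Dh]])
      show "open (coord c ` (W \<inter> dom_chart c))" by (rule open_coord_image[OF c(1) W(1)])
      show "coord c p \<in> coord c ` (W \<inter> dom_chart c)" using W c by blast
      fix y assume "y \<in> coord c ` (W \<inter> dom_chart c)"
      then show "(h \<circ> (f \<circ> inv_chart c)) y = (g \<circ> inv_chart c) y"
        using gh inv_chart_coord[OF c(1)] by auto
    qed
    then have "dir_deriv c g p v = deriv h (f p) * dir_deriv c f p v"
      using frechet_derivative_eqI by (fastforce simp: dir_deriv_def[of c g])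
    then show ?thesis using v h(2) fp by simp
  qed
  then show ?thesis unfolding positive_transverse_def by blast
qed

lemma one_form_linear: "\<alpha> \<in> forms A 1 \<Longrightarrow> linear (\<lambda>u. \<alpha> c x (\<lambda>_. u))"
  using alternating_1_linear[OF forms_alternating] .

lemma one_form_first: "\<alpha> \<in> forms A 1 \<Longrightarrow> \<alpha> c x v = \<alpha> c x (\<lambda>_. v 0)"
  by (erule first_argsD[OF alternating_first_args[OF forms_alternating]]) simp

lemma zero_form_const: "R \<in> forms A 0 \<Longrightarrow> R c x v = R c x w"
  by (erule first_argsD[OF alternating_first_args[OF forms_alternating]]) simp

lemma wedge_0_apply: "R \<in> forms A 0 \<Longrightarrow> \<omega> \<in> forms A k \<Longrightarrow> wedge 0 k R \<omega> c x v = R c x v * \<omega> c x v"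
  unfolding wedge_eq_pwedge by (intro pwedge_0 alternating_first_args forms_alternating)

text \<open>From \<open>\<alpha>' = R \<alpha>\<close> and \<open>dR = - R dh\<close>, comparing \<open>d\<alpha>' = \<alpha>' \<and> \<beta>'\<close> with \<open>dR \<and> \<alpha> + R \<alpha> \<and> \<beta>\<close> gives
  \<open>R \<alpha> \<and> (\<beta>' - \<beta> - dh) = 0\<close>.\<close>

lemma beta_difference:
  assumes pair: "defining_pair A F \<alpha> \<beta>" and pair': "defining_pair A F \<alpha>' \<beta>'"
    and R: "R \<in> forms A 0" and h: "h \<in> forms A 0"
    and pos: "\<And>c x v. c \<in> A \<Longrightarrow> x \<in> im_chart c \<Longrightarrow> R c x v > 0"
    and h_eq: "\<And>c x v. c \<in> A \<Longrightarrow> x \<in> im_chart c \<Longrightarrow> h c x v = - ln (R c x v)"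
    and \<alpha>_eq: "\<And>c x v. c \<in> A \<Longrightarrow> x \<in> im_chart c \<Longrightarrow> \<alpha>' c x v = R c x v * \<alpha> c x v"
  shows "\<beta>' - \<beta> - ext_d A 0 h \<in> ideal A F 1"
proof -
  note D = defining_pairD[OF pair] and D' = defining_pairD[OF pair']
  have dh: "ext_d A 0 h \<in> forms A 1" and dR: "ext_d A 0 R \<in> forms A 1"
    using R h by (auto intro: ext_d_in_forms)
  have dR_eq: "ext_d A 0 R = - wedge 0 1 R (ext_d A 0 h)"
  proof (rule forms_eqI[OF dR form_minus[OF wedge_in_forms[OF R dh]]])
    fix c x and v :: "nat \<Rightarrow> 'e" assume cx: "c \<in> A" "x \<in> im_chart c"
    let ?w = "\<lambda>j. v (Suc j)"
    have "dir_D h c x u ?w = - (dir_D R c x u ?w / R c x ?w)" for u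
    proof (rule dir_D_eqI, rule has_derivative_transform_within_open[OF _ open_im[OF cx(1)] cx(2)])
      show "((\<lambda>y. - ln (R c y ?w)) has_derivative (\<lambda>u. - (dir_D R c x u ?w / R c x ?w))) (at x)"
        using pos[OF cx] form_has_derivative[OF R cx, of ?w]
        by (auto intro!: derivative_eq_intros simp: divide_inverse mult.commute)
    qed (simp add: h_eq[OF cx(1)])
    then show "ext_d A 0 R c x v = (- wedge 0 1 R (ext_d A 0 h)) c x v"
      using pos[OF cx, of ?w] zero_form_const[OF R, of c x v ?w]
      by (simp add: wedge_0_apply[OF R dh] ext_d_sum[OF cx] form_minus_eq_scale form_scale_def del: One_nat_def)
  qed simp
  have \<alpha>': "\<alpha>' = wedge 0 1 R \<alpha>"
    by (rule forms_eqI[OF D'(2) wedge_in_forms[OF R D(2) refl]]) (simp add: \<alpha>_eq wedge_0_apply[OF R D(2)] del: One_nat_def)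
  have "wedge 0 2 R (wedge 1 1 \<alpha> \<beta>') = wedge 1 1 \<alpha>' \<beta>'"
    unfolding \<alpha>' by (rule wedge_assoc[OF R, symmetric]) simp_all
  also have "\<dots> = ext_d A 1 (wedge 0 1 R \<alpha>)" using D'(4) \<alpha>' by simp
  also have "\<dots> = wedge 1 1 (ext_d A 0 R) \<alpha> + wedge 0 2 R (ext_d A 1 \<alpha>)"
    by (rule leibniz_even[OF R D(2)]) simp_all
  finally have 1: "wedge 0 2 R (wedge 1 1 \<alpha> \<beta>') = wedge 1 1 (ext_d A 0 R) \<alpha> + wedge 0 2 R (ext_d A 1 \<alpha>)" .
  have 2: "wedge 1 1 (ext_d A 0 R) \<alpha> = - wedge 0 2 R (wedge 1 1 (ext_d A 0 h) \<alpha>)"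
    unfolding dR_eq wedge_minus_left by (subst wedge_assoc[OF R]) simp_all
  have 3: "wedge 1 1 (ext_d A 0 h) \<alpha> = - wedge 1 1 \<alpha> (ext_d A 0 h)"
    by (rule wedge_commute_odd[OF dh D(2)]) simp
  have "wedge 0 2 R (wedge 1 1 \<alpha> (\<beta>' - \<beta> - ext_d A 0 h)) = 0"
    using 1 unfolding 2 3 by (simp add: wedge_diff_right wedge_minus_right D(4) del: One_nat_def)
  moreover have \<gamma>: "\<beta>' - \<beta> - ext_d A 0 h \<in> forms A 1" by (intro form_diff D(3) D'(3) dh)
  have W: "wedge 1 1 \<alpha> (\<beta>' - \<beta> - ext_d A 0 h) \<in> forms A 2" by (rule wedge_in_forms[OF D(2) \<gamma>]) simp
  ultimately have "wedge 1 1 \<alpha> (\<beta>' - \<beta> - ext_d A 0 h) = 0"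
  proof (intro forms_eqI[OF W zero_form[of 2]])
    fix c x v assume z: "wedge 0 2 R (wedge 1 1 \<alpha> (\<beta>' - \<beta> - ext_d A 0 h)) = 0" and cx: "c \<in> A" "x \<in> im_chart c"
    have "R c x v * wedge 1 1 \<alpha> (\<beta>' - \<beta> - ext_d A 0 h) c x v = 0"
      unfolding wedge_0_apply[OF R W, symmetric] z by simp
    then show "wedge 1 1 \<alpha> (\<beta>' - \<beta> - ext_d A 0 h) c x v = 0 c x v" using pos[OF cx, of v] by simp
  qed
  then show ?thesis by (rule ideal_of_wedge_zero[OF D(1) \<gamma>])
qed

text \<open>Two defining forms have the same kernels, and both are positive on positive transverse vectors;
  so they differ by a positive factor \<open>R\<close>. An explicit quotient for \<open>R\<close> shows its smoothness in \<open>(t, x)\<close>.\<close>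

lemma defining_families_ratio:
  assumes J: "open J" and fol: "\<And>t. t \<in> J \<Longrightarrow> foliation A (\<F> t)"
    and fam: "defining_families A J \<F> \<alpha> \<beta>" and fam': "defining_families A J \<F> \<alpha>' \<beta>'"
  shows "\<exists>R h. smooth_form_family A J 0 R \<and> smooth_form_family A J 0 h \<and>
    (\<forall>t\<in>J. \<forall>c\<in>A. \<forall>x\<in>im_chart c. \<forall>v. R t c x v > 0 \<and> h t c x v = - ln (R t c x v) \<and>
      \<alpha>' t c x v = R t c x v * \<alpha> t c x v)"
proof -
  note D = defining_familiesD[OF fam] and D' = defining_familiesD[OF fam']
  have \<alpha>f: "\<alpha> t \<in> forms A 1" and \<alpha>f': "\<alpha>' t \<in> forms A 1" if "t \<in> J" for t
    using family_forms D(1) D'(1) that by blast+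
  let ?num = "\<lambda>t c x. \<Sum>b\<in>Basis. \<alpha>' t c x (\<lambda>_. b) * \<alpha> t c x (\<lambda>_. b)"
  let ?den = "\<lambda>t c x. \<Sum>b\<in>Basis. \<alpha> t c x (\<lambda>_. b) * \<alpha> t c x (\<lambda>_. b)"
  define R :: "real \<Rightarrow> ('m, 'e) form" where
    "R t c x v = (if c \<in> A \<and> x \<in> im_chart c then ?num t c x / ?den t c x else 0)" for t c x v
  define h :: "real \<Rightarrow> ('m, 'e) form" where
    "h t c x v = (if c \<in> A \<and> x \<in> im_chart c then - ln (R t c x v) else 0)" for t c x v
  have ratio: "?den t c x \<noteq> 0 \<and> R t c x v > 0 \<and> \<alpha>' t c x w = R t c x v * \<alpha> t c x w"
    if t: "t \<in> J" and c: "c \<in> A" and x: "x \<in> im_chart c" for t c x v w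
  proof -
    obtain p where p: "p \<in> dom_chart c" and xp: "x = coord c p" using x by (rule im_chart_point)
    have df: "defining_form A (\<F> t) (\<alpha> t)" "defining_form A (\<F> t) (\<alpha>' t)"
      using defining_pairD(1) D(3)[OF t] D'(3)[OF t] by blast+
    obtain n where "positive_transverse (\<F> t) c p n"
      using positive_transverse_exists[OF fol[OF t] c p] by blast
    then have n: "\<alpha>' t c x (\<lambda>_. n) > 0" "\<alpha> t c x (\<lambda>_. n) > 0"
      using df c p unfolding defining_form_def xp by blast+
    have ker: "\<alpha>' t c x (\<lambda>_. v) = 0 \<longleftrightarrow> \<alpha> t c x (\<lambda>_. v) = 0" for v
      using defining_form_tangent[OF df(1) c p] defining_form_tangent[OF df(2) c p] unfolding xp by blast
    note P = proportional_functionals[OF one_form_linear[OF \<alpha>f'[OF t]] one_form_linear[OF \<alpha>f[OF t]] n ker]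
    have R_eq: "R t c x v = ?num t c x / ?den t c x" using c x by (simp add: R_def)
    show ?thesis
      unfolding R_eq one_form_first[OF \<alpha>f[OF t], of c x w] one_form_first[OF \<alpha>f'[OF t], of c x w]
      by (intro conjI P)
  qed
  have R_const: "R t c x v = R t c x w" for t c x v w by (simp add: R_def)
  have h_const: "h t c x v = h t c x w" for t c x v w by (simp add: h_def R_def)
  have R_smooth: "smooth_on (J \<times> im_chart c) (\<lambda>z. R (fst z) c (snd z) v)" if c: "c \<in> A" for c v
  proof (rule smooth_on_cong[OF open_prod[OF J c]])
    show "smooth_on (J \<times> im_chart c) (\<lambda>z. ?num (fst z) c (snd z) / ?den (fst z) c (snd z))"
      by (intro smooth_on_divide smooth_on_sum smooth_on_mult open_prod J c finite_Basis
          family_smooth[OF D(1)] family_smooth[OF D'(1)]) (use ratio[OF _ c] in auto)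
  qed (use c in \<open>auto simp: R_def\<close>)
  have R_trans: "R t c (coord c p) v = R t c' (coord c' p) w"
    if t: "t \<in> J" and c: "c \<in> A" "c' \<in> A" "p \<in> dom_chart c" "p \<in> dom_chart c'" for t c c' p v w
  proof -
    have im: "coord c p \<in> im_chart c" "coord c' p \<in> im_chart c'" using coord_in_im[OF c(3)] coord_in_im[OF c(4)] .
    obtain n where n: "\<alpha> t c (coord c p) (\<lambda>_. n) \<noteq> 0"
      using defining_form_nonzero[OF defining_pairD(1)[OF D(3)[OF t]] c(1,3)] by blast
    have "R t c (coord c p) v * \<alpha> t c (coord c p) (\<lambda>_. n) = R t c' (coord c' p) w * \<alpha> t c (coord c p) (\<lambda>_. n)"
      using ratio[OF t c(1) im(1)] ratio[OF t c(2) im(2)] forms_transition[OF \<alpha>f[OF t] c]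
        forms_transition[OF \<alpha>f'[OF t] c] by metis
    then show ?thesis using n by simp
  qed
  have "smooth_form_family A J 0 R"
  proof (rule familyI[OF _ R_smooth])
    fix t assume t: "t \<in> J"
    show "R t \<in> forms A 0"
    proof (rule formsI)
      show "alternating 0 (R t c x)" for c x unfolding alternating_def using R_const by blast
      show "smooth_on (im_chart c) (\<lambda>x. R t c x v)" if "c \<in> A" for c v
        using family_slice[OF J that R_smooth[OF that] t] by simp
      show "R t c x v = 0" if "c \<notin> A \<or> x \<notin> im_chart c" for c x v using that by (auto simp: R_def)
    qed (rule R_trans[OF t])
  qed
  moreover have "smooth_form_family A J 0 h"
  proof (rule familyI)
    show h_smooth: "smooth_on (J \<times> im_chart c) (\<lambda>z. h (fst z) c (snd z) v)" if c: "c \<in> A" for c v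
    proof (rule smooth_on_cong[OF open_prod[OF J c]])
      show "smooth_on (J \<times> im_chart c) (\<lambda>z. (-1) * ln (R (fst z) c (snd z) v))"
        by (intro smooth_on_mult smooth_on_const open_prod J c
            smooth_on_compose[OF _ _ _ smooth_on_ln R_smooth]) (use ratio[OF _ c] in auto)
    qed (use c in \<open>auto simp: h_def\<close>)
    fix t assume t: "t \<in> J"
    show "h t \<in> forms A 0"
    proof (rule formsI)
      show "alternating 0 (h t c x)" for c x
        unfolding alternating_def using h_const by blast
      show "smooth_on (im_chart c) (\<lambda>x. h t c x v)" if "c \<in> A" for c v
        using family_slice[OF J that h_smooth[OF that] t] by simp
      show "h t c x v = 0" if "c \<notin> A \<or> x \<notin> im_chart c" for c x v using that by (auto simp: h_def)
      show "h t c (coord c p) v = h t c' (coord c' p)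
          (\<lambda>i. frechet_derivative (transition c c') (at (coord c p)) (v i))"
        if "c \<in> A" "c' \<in> A" "p \<in> dom_chart c" "p \<in> dom_chart c'" for c c' p v
        using R_trans[OF t that, of v "\<lambda>i. frechet_derivative (transition c c') (at (coord c p)) (v i)"]
          that coord_in_im[OF that(3)] coord_in_im[OF that(4)] by (simp add: h_def)
    qed
  qed
  moreover have "\<forall>t\<in>J. \<forall>c\<in>A. \<forall>x\<in>im_chart c. \<forall>v. R t c x v > 0 \<and> h t c x v = - ln (R t c x v) \<and>
      \<alpha>' t c x v = R t c x v * \<alpha> t c x v"
  proof (intro ballI allI)
    fix t c x v assume "t \<in> J" "c \<in> A" "x \<in> im_chart c"
    then show "R t c x v > 0 \<and> h t c x v = - ln (R t c x v) \<and> \<alpha>' t c x v = R t c x v * \<alpha> t c x v"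
      using ratio[of t c x v v] unfolding h_def by presburger
  qed
  ultimately show ?thesis by blast
qed

text \<open>Any two choices of \<open>\<beta>\<close> thus differ by an exact form \<open>dh\<close> and a one-form in the ideal, both depending smoothly
  on the parameter. The independence statements treat the two kinds of change one after the other.\<close>

lemma defining_families_difference:
  assumes J: "open J" and fol: "\<And>t. t \<in> J \<Longrightarrow> foliation A (\<F> t)"
    and fam: "defining_families A J \<F> \<alpha> \<beta>" and fam': "defining_families A J \<F> \<alpha>' \<beta>'"
  obtains h where "smooth_form_family A J 0 h"
    "\<And>t. t \<in> J \<Longrightarrow> \<beta>' t - \<beta> t - ext_d A 0 (h t) \<in> ideal A (\<F> t) 1"
proof -
  obtain R h where R: "smooth_form_family A J 0 R" and h: "smooth_form_family A J 0 h"
    and Rh: "\<forall>t\<in>J. \<forall>c\<in>A. \<forall>x\<in>im_chart c. \<forall>v. R t c x v > 0 \<and> h t c x v = - ln (R t c x v) \<and>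
      \<alpha>' t c x v = R t c x v * \<alpha> t c x v"
    using defining_families_ratio[OF assms] by blast
  have "\<beta>' t - \<beta> t - ext_d A 0 (h t) \<in> ideal A (\<F> t) 1" if t: "t \<in> J" for t
    by (rule beta_difference[OF defining_familiesD(3)[OF fam t] defining_familiesD(3)[OF fam' t]
          family_forms[OF R t] family_forms[OF h t]]) (use Rh t in blast)+
  then show thesis using that h by blast
qed

lemma defining_pair_difference:
  assumes fol: "foliation A F" and pair: "defining_pair A F \<alpha> \<beta>" and pair': "defining_pair A F \<alpha>' \<beta>'"
  obtains h where "h \<in> forms A 0" "\<beta>' - \<beta> - ext_d A 0 h \<in> ideal A F 1"
proof -
  have fam: "defining_families A UNIV (\<lambda>_. F) (\<lambda>_. \<alpha>) (\<lambda>_. \<beta>)" if "defining_pair A F \<alpha> \<beta>" for \<alpha> \<beta>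
    using family_const[OF open_UNIV] defining_pairD[OF that] that unfolding defining_families_def by blast
  obtain h where "smooth_form_family A UNIV 0 h"
    "\<And>t::real. t \<in> UNIV \<Longrightarrow> \<beta>' - \<beta> - ext_d A 0 (h t) \<in> ideal A F 1"
    using defining_families_difference[OF open_UNIV fol fam[OF pair] fam[OF pair']] by blast
  then show thesis using that[of "h 0"] family_forms by blast
qed

text \<open>Passing from \<open>(\<alpha>, \<beta>)\<close> to \<open>(\<alpha>', \<beta>')\<close> goes through the pair \<open>(\<alpha>', \<beta> + dh)\<close>; it is a defining pair
  because it differs from \<open>(\<alpha>', \<beta>')\<close> by an element of the ideal.\<close>

lemma defining_pair_add_ideal:
  assumes pair: "defining_pair A F \<alpha> \<beta>" and a: "a \<in> ideal A F 1"
  shows "defining_pair A F \<alpha> (\<beta> + a)"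
proof -
  note D = defining_pairD[OF pair]
  have "wedge 1 1 \<alpha> a = 0" by (rule ideal_wedge_ideal[OF D(1) defining_form_ideal[OF D(1)] a])
  then have "ext_d A 1 \<alpha> = wedge 1 1 \<alpha> (\<beta> + a)" using D(4) by (simp add: wedge_add_right)
  then show ?thesis unfolding defining_pair_def using D form_add[OF D(3) ideal_forms[OF a]] by blast
qed

lemma GV_form_independent:
  assumes fol: "foliation A F" and pair: "defining_pair A F \<alpha> \<beta>" and pair': "defining_pair A F \<alpha>' \<beta>'"
  shows "\<exists>\<mu>\<in>forms A 2. wedge 1 2 \<beta>' (ext_d A 1 \<beta>') = wedge 1 2 \<beta> (ext_d A 1 \<beta>) + ext_d A 2 \<mu>"
proof -
  obtain h where h: "h \<in> forms A 0" and a: "\<beta>' - \<beta> - ext_d A 0 h \<in> ideal A F 1"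
    by (rule defining_pair_difference[OF fol pair pair'])
  note D = defining_pairD[OF pair]
  let ?a = "\<beta>' - \<beta> - ext_d A 0 h" and ?b = "\<beta> + ext_d A 0 h"
  have "defining_pair A F \<alpha>' (\<beta>' + - ?a)" by (rule defining_pair_add_ideal[OF pair' ideal_minus[OF a]])
  then have pb: "defining_pair A F \<alpha>' ?b" by (simp add: algebra_simps)
  have "wedge 1 2 \<beta>' (ext_d A 1 \<beta>') = wedge 1 2 ?b (ext_d A 1 ?b) + ext_d A 2 (wedge 1 1 ?a ?b)"
    using GV_form_add_ideal[OF pb a] by (simp add: algebra_simps del: One_nat_def)
  also have "wedge 1 2 ?b (ext_d A 1 ?b) = wedge 1 2 \<beta> (ext_d A 1 \<beta>) + ext_d A 2 (wedge 0 2 h (ext_d A 1 \<beta>))"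
    by (rule GV_form_add_exact[OF D(3) h])
  finally have eq: "wedge 1 2 \<beta>' (ext_d A 1 \<beta>') = wedge 1 2 \<beta> (ext_d A 1 \<beta>)
      + ext_d A 2 (wedge 0 2 h (ext_d A 1 \<beta>)) + ext_d A 2 (wedge 1 1 ?a ?b)" .
  have W: "wedge 0 2 h (ext_d A 1 \<beta>) \<in> forms A 2"
    by (rule wedge_in_forms[OF h ext_d_in_forms[OF D(3)]]) simp_all
  have W': "wedge 1 1 ?a ?b \<in> forms A 2"
    by (rule wedge_in_forms[OF ideal_forms[OF a] defining_pairD(3)[OF pb]]) simp
  show ?thesis
    by (rule bexI[OF _ form_add[OF W W']]) (unfold eq ext_d_add[OF W W'] add.assoc, rule refl)
qed

lemma T_form_independent:
  assumes J: "open J" "t \<in> J" and fol: "\<And>t. t \<in> J \<Longrightarrow> foliation A (\<F> t)"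
    and fam: "defining_families A J \<F> \<alpha> \<beta>" and fam': "defining_families A J \<F> \<alpha>' \<beta>'"
  shows "\<exists>\<mu>\<in>ideal A (\<F> t) 2. T_form A \<beta>' t = T_form A \<beta> t + ext_d A 2 \<mu>"
proof -
  note D = defining_familiesD[OF fam] and D' = defining_familiesD[OF fam']
  obtain h where h: "smooth_form_family A J 0 h"
    and a: "\<And>s. s \<in> J \<Longrightarrow> \<beta>' s - \<beta> s - ext_d A 0 (h s) \<in> ideal A (\<F> s) 1"
    using defining_families_difference[OF J(1) fol fam fam'] by blast
  have dh: "smooth_form_family A J 1 (\<lambda>s. ext_d A 0 (h s))" using family_ext_d[OF J(1) h] by simp
  \<comment> \<open>the change from \<open>\<beta>\<close> to \<open>\<beta>'\<close> passes through \<open>\<beta> + dh\<close>, which pairs with \<open>\<alpha>'\<close>\<close>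
  let ?a = "\<lambda>s. \<beta>' s - \<beta> s - ext_d A 0 (h s)" and ?b = "\<lambda>s. \<beta> s + ext_d A 0 (h s)"
  have af: "smooth_form_family A J 1 ?a" by (intro family_diff J(1) D(2) D'(2) dh)
  have bf: "smooth_form_family A J 1 ?b" by (intro family_add J(1) D(2) dh)
  have pb: "defining_pair A (\<F> s) (\<alpha>' s) (?b s)" if s: "s \<in> J" for s
  proof -
    have "defining_pair A (\<F> s) (\<alpha>' s) (\<beta>' s + - ?a s)"
      by (rule defining_pair_add_ideal[OF D'(3)[OF s] ideal_minus[OF a[OF s]]])
    then show ?thesis by (simp add: algebra_simps)
  qed
  let ?\<nu> = "wedge 1 1 (?a t) (form_dot ?b t) - form_scale (1/2) (wedge 1 1 (form_dot ?a t) (?a t))"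
  let ?\<mu> = "wedge 0 2 (form_dot h t) (ext_d A 1 (\<beta> t))"
  have "T_form A \<beta>' t = T_form A (\<lambda>s. ?b s + ?a s) t" by simp
  also have "\<dots> = T_form A ?b t + ext_d A 2 ?\<nu>" by (rule T_form_add_ideal[OF J bf af pb a])
  also have "T_form A ?b t = T_form A \<beta> t + ext_d A 2 ?\<mu>" by (rule T_form_add_exact[OF J D(2) h])
  finally have eq: "T_form A \<beta>' t = T_form A \<beta> t + ext_d A 2 ?\<mu> + ext_d A 2 ?\<nu>" .
  have \<mu>: "?\<mu> \<in> ideal A (\<F> t) 2"
    by (rule ideal_wedge_right[OF form_dot_forms[OF J(1) h J(2)] ext_d_beta_ideal[OF D(3)[OF J(2)]]]) simp
  have \<nu>: "?\<nu> \<in> ideal A (\<F> t) 2"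
    by (intro ideal_diff ideal_scale ideal_wedge_left[OF a[OF J(2)]] ideal_wedge_right[OF _ a[OF J(2)]]
        form_dot_forms[OF J(1) _ J(2)] af bf) simp_all
  show ?thesis
    by (rule bexI[OF _ ideal_add[OF \<mu> \<nu>]])
      (unfold eq ext_d_add[OF ideal_forms[OF \<mu>] ideal_forms[OF \<nu>]] add.assoc, rule refl)
qed

section \<open>Cohomology classes\<close>

lemma class_dR_eq: "n = Suc k \<Longrightarrow> class_dR A n \<omega> = (\<lambda>\<mu>. ext_d A k \<mu> + \<omega>) ` forms A k"
  by (auto simp: class_dR_def coh_class_def r_coset_def form_complex_def)

text \<open>The primitives range over the ideal only, which makes these classes finer than those in de Rham
  cohomology.\<close>

lemma class_ideal_eq: "n = Suc k \<Longrightarrow> class_ideal A F n \<omega> = (\<lambda>\<mu>. ext_d A k \<mu> + \<omega>) ` ideal A F k"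
  by (auto simp: class_ideal_def coh_class_def r_coset_def form_complex_def ideal_complex_def)

lemma class_dR_add_exact:
  assumes n: "n = Suc k" and \<mu>: "\<mu> \<in> forms A k"
  shows "class_dR A n (\<omega> + ext_d A k \<mu>) = class_dR A n \<omega>"
proof -
  have "ext_d A k \<nu> + (\<omega> + ext_d A k \<mu>) = ext_d A k (\<nu> + \<mu>) + \<omega>" if "\<nu> \<in> forms A k" for \<nu>
    using ext_d_add[OF that \<mu>] by (simp add: algebra_simps)
  moreover have "ext_d A k \<nu> + \<omega> = ext_d A k (\<nu> - \<mu>) + (\<omega> + ext_d A k \<mu>)" if "\<nu> \<in> forms A k" for \<nu>
    using ext_d_diff[OF that \<mu>] by (simp add: algebra_simps)
  ultimately show ?thesis
    unfolding class_dR_eq[OF n] using form_add[OF _ \<mu>] form_diff[OF _ \<mu>] by blast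
qed

lemma class_ideal_add_exact:
  assumes n: "n = Suc k" and \<mu>: "\<mu> \<in> ideal A F k"
  shows "class_ideal A F n (\<omega> + ext_d A k \<mu>) = class_ideal A F n \<omega>"
proof -
  have "ext_d A k \<nu> + (\<omega> + ext_d A k \<mu>) = ext_d A k (\<nu> + \<mu>) + \<omega>" if "\<nu> \<in> ideal A F k" for \<nu>
    using ext_d_add[OF ideal_forms[OF that] ideal_forms[OF \<mu>]] by (simp add: algebra_simps)
  moreover have "ext_d A k \<nu> + \<omega> = ext_d A k (\<nu> - \<mu>) + (\<omega> + ext_d A k \<mu>)" if "\<nu> \<in> ideal A F k" for \<nu>
    using ext_d_diff[OF ideal_forms[OF that] ideal_forms[OF \<mu>]] by (simp add: algebra_simps)
  ultimately show ?thesis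
    unfolding class_ideal_eq[OF n] using ideal_add[OF _ \<mu>] ideal_diff[OF _ \<mu>] by blast
qed

lemma coh_class_carrier:
  assumes "x \<in> carrier (C k)" "\<delta> k x = \<one>\<^bsub>C (Suc k)\<^esub>"
  shows "coh_class C \<delta> k x \<in> carrier (cohomology C \<delta> k)"
  using assms by (auto simp: coh_class_def cohomology_def FactGroup_def RCOSETS_def r_coset_def kernel_def)

lemma class_dR_carrier: "\<omega> \<in> forms A k \<Longrightarrow> ext_d A k \<omega> = 0 \<Longrightarrow> class_dR A k \<omega> \<in> carrier (H_dR A k)"
  unfolding class_dR_def H_dR_def by (rule coh_class_carrier) (simp_all add: form_complex_def)

lemma class_ideal_carrier:
  "\<omega> \<in> ideal A F k \<Longrightarrow> ext_d A k \<omega> = 0 \<Longrightarrow> class_ideal A F k \<omega> \<in> carrier (H_ideal A F k)"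
  unfolding class_ideal_def H_ideal_def
  by (rule coh_class_carrier) (simp_all add: ideal_complex_def form_complex_def)

lemma ideal_to_dR_class:
  assumes n: "n = Suc k"
  shows "ideal_to_dR A n (class_ideal A F n \<omega>) = class_dR A n \<omega>"
proof -
  have "class_dR A n (ext_d A k \<mu> + \<omega>) = class_dR A n \<omega>" if "\<mu> \<in> ideal A F k" for \<mu>
    using class_dR_add_exact[OF n ideal_forms[OF that], of \<omega>] by (simp add: add.commute)
  then show ?thesis
    unfolding ideal_to_dR_def class_ideal_eq[OF n] using ideal_zero[of F k] by auto
qed

lemma scale_dR_class:
  assumes n: "n = Suc k"
  shows "scale_dR A n r (class_dR A n \<omega>) = class_dR A n (form_scale r \<omega>)"
proof -
  have "class_dR A n (form_scale r (ext_d A k \<mu> + \<omega>)) = class_dR A n (form_scale r \<omega>)" if "\<mu> \<in> forms A k" for \<mu>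
    using class_dR_add_exact[OF n form_scale_forms[OF that], of "form_scale r \<omega>" r]
    by (simp add: form_scale_add ext_d_scale[OF that] add.commute)
  then show ?thesis
    unfolding scale_dR_def class_dR_eq[OF n, of \<omega>] using zero_form by auto
qed

lemma leaf_form_eq: "leaf_form A F k \<omega> = (\<lambda>\<iota>. \<iota> + \<omega>) ` ideal A F k"
  by (auto simp: leaf_form_def r_coset_def form_complex_def)

lemma leaf_form_add_ideal:
  assumes "\<iota> \<in> ideal A F k"
  shows "leaf_form A F k (\<iota> + \<omega>) = leaf_form A F k \<omega>"
proof -
  have "\<kappa> + (\<iota> + \<omega>) = (\<kappa> + \<iota>) + \<omega>" "\<kappa> + \<omega> = (\<kappa> - \<iota>) + (\<iota> + \<omega>)" for \<kappa> by (simp_all add: algebra_simps)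
  then show ?thesis
    unfolding leaf_form_eq using ideal_add[OF _ assms] ideal_diff[OF _ assms] by blast
qed

lemma leaf_complex_carrier: "carrier (leaf_complex A F k) = leaf_form A F k ` forms A k"
  by (auto simp: leaf_complex_def FactGroup_def RCOSETS_def leaf_form_def form_complex_def)

lemma leaf_complex_mult:
  "leaf_form A F k \<omega> \<otimes>\<^bsub>leaf_complex A F k\<^esub> leaf_form A F k \<eta> = leaf_form A F k (\<omega> + \<eta>)"
proof -
  have "leaf_form A F k \<omega> \<otimes>\<^bsub>leaf_complex A F k\<^esub> leaf_form A F k \<eta>
      = {(\<iota> + \<omega>) + (\<kappa> + \<eta>) |\<iota> \<kappa>. \<iota> \<in> ideal A F k \<and> \<kappa> \<in> ideal A F k}"
    by (auto simp: leaf_complex_def FactGroup_def set_mult_def form_complex_def leaf_form_eq)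
  also have "\<dots> = leaf_form A F k (\<omega> + \<eta>)"
  proof -
    have "(\<iota> + \<omega>) + (\<kappa> + \<eta>) = (\<iota> + \<kappa>) + (\<omega> + \<eta>)" "\<iota> + (\<omega> + \<eta>) = (\<iota> + \<omega>) + (0 + \<eta>)" for \<iota> \<kappa>
      by (simp_all add: algebra_simps)
    then show ?thesis
      unfolding leaf_form_eq using ideal_add ideal_zero by blast
  qed
  finally show ?thesis .
qed

text \<open>The union over representatives in the definition of \<^const>\<open>leaf_d\<close> is a union of equal cosets, because
  \<open>d\<close> preserves the ideal.\<close>

lemma leaf_d_leaf_form:
  assumes pair: "defining_pair A F \<alpha> \<beta>" and \<omega>: "\<omega> \<in> forms A k"
  shows "leaf_d A F k (leaf_form A F k \<omega>) = leaf_form A F (Suc k) (ext_d A k \<omega>)"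
proof -
  have "leaf_form A F (Suc k) (ext_d A k (\<iota> + \<omega>)) = leaf_form A F (Suc k) (ext_d A k \<omega>)"
    if "\<iota> \<in> ideal A F k" for \<iota>
    using leaf_form_add_ideal[OF ideal_ext_d[OF pair that refl]] ext_d_add[OF ideal_forms[OF that] \<omega>] by simp
  then show ?thesis unfolding leaf_d_def leaf_form_eq[of F k \<omega>] using ideal_zero[of F k] by auto
qed

text \<open>A class in leafwise cohomology is a set of cosets; its elements are the cosets of \<open>\<omega> + dh\<close>, so their
  representatives are the forms \<open>\<omega> + dh + \<iota>\<close> with \<open>\<iota>\<close> in the ideal.\<close>

lemma class_leaf_eq:
  assumes pair: "defining_pair A F \<alpha> \<beta>"
  shows "class_leaf A F 1 \<omega> = (\<lambda>h. leaf_form A F 1 (ext_d A 0 h + \<omega>)) ` forms A 0"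
proof -
  have "coboundaries (leaf_complex A F) (leaf_d A F) 1 = (\<lambda>h. leaf_form A F 1 (ext_d A 0 h)) ` forms A 0"
    using leaf_d_leaf_form[OF pair] by (simp add: leaf_complex_carrier image_image)
  then show ?thesis
    by (auto simp: class_leaf_def coh_class_def r_coset_def leaf_complex_mult simp del: One_nat_def)
qed

lemma reeb_class_eq:
  assumes fol: "foliation A F" and pair: "defining_pair A F \<alpha> \<beta>"
  shows "reeb_class A F = class_leaf A F 1 \<beta>"
  unfolding reeb_class_def
proof (rule the_equality)
  show "\<exists>\<alpha>' \<beta>'. defining_pair A F \<alpha>' \<beta>' \<and> class_leaf A F 1 \<beta> = class_leaf A F 1 \<beta>'" using pair by blast
  fix X assume "\<exists>\<alpha>' \<beta>'. defining_pair A F \<alpha>' \<beta>' \<and> X = class_leaf A F 1 \<beta>'"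
  then obtain \<alpha>' \<beta>' where pair': "defining_pair A F \<alpha>' \<beta>'" and X: "X = class_leaf A F 1 \<beta>'" by blast
  obtain h where h: "h \<in> forms A 0" and a: "\<beta>' - \<beta> - ext_d A 0 h \<in> ideal A F 1"
    using defining_pair_difference[OF fol pair pair'] by blast
  have eq: "leaf_form A F 1 (ext_d A 0 k + \<beta>') = leaf_form A F 1 (ext_d A 0 (k + h) + \<beta>)" if "k \<in> forms A 0" for k
  proof -
    have "ext_d A 0 k + \<beta>' = (\<beta>' - \<beta> - ext_d A 0 h) + (ext_d A 0 (k + h) + \<beta>)"
      using ext_d_add[OF that h] by (simp add: algebra_simps)
    then show ?thesis using leaf_form_add_ideal[OF a] by metis
  qed
  have eq': "leaf_form A F 1 (ext_d A 0 k + \<beta>) = leaf_form A F 1 (ext_d A 0 (k - h) + \<beta>')" if "k \<in> forms A 0" for k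
    using eq[OF form_diff[OF that h]] by simp
  show "X = class_leaf A F 1 \<beta>"
    unfolding X class_leaf_eq[OF pair] using eq eq' form_add[OF _ h] form_diff[OF _ h] by blast
qed

lemma reeb_class_carrier:
  assumes fol: "foliation A F" and pair: "defining_pair A F \<alpha> \<beta>"
  shows "reeb_class A F \<in> carrier (H_leaf A F 1)"
  unfolding reeb_class_eq[OF assms] class_leaf_def H_leaf_def
proof (rule coh_class_carrier)
  note \<beta> = defining_pairD(3)[OF pair]
  show "leaf_form A F 1 \<beta> \<in> carrier (leaf_complex A F 1)" using \<beta> by (simp add: leaf_complex_carrier)
  have "leaf_d A F 1 (leaf_form A F 1 \<beta>) = leaf_form A F 2 (ext_d A 1 \<beta> + 0)"
    using leaf_d_leaf_form[OF pair \<beta>] by (simp add: numeral_2_eq_2)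
  also have "\<dots> = leaf_form A F 2 0" by (rule leaf_form_add_ideal[OF ext_d_beta_ideal[OF pair]])
  also have "\<dots> = ideal A F 2" by (simp add: leaf_form_eq)
  finally show "leaf_d A F 1 (leaf_form A F 1 \<beta>) = \<one>\<^bsub>leaf_complex A F (Suc 1)\<^esub>"
    by (simp add: leaf_complex_def FactGroup_def numeral_2_eq_2)
qed

text \<open>Changing representatives, one multiplies a closed form \<open>\<omega> = d\<mu> + T\<close> in the ideal by
  \<open>\<iota> + dh + \<beta>\<close>. Here \<open>\<omega> \<and> \<iota> = 0\<close>, \<open>\<omega> \<and> dh = - d(\<omega> \<and> h)\<close>, and \<open>d\<mu> \<and> \<beta> = d(\<mu> \<and> \<beta>)\<close> because \<open>\<mu> \<and> d\<beta> = 0\<close>; the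
  primitives lie in the ideal.\<close>

lemma pairing_class:
  assumes pair: "defining_pair A F \<alpha> \<beta>" and T: "T \<in> ideal A F 3" and closed: "ext_d A 3 T = 0"
  shows "pairing A F 3 1 (class_ideal A F 3 T) (class_leaf A F 1 \<beta>) = class_ideal A F 4 (wedge 3 1 T \<beta>)"
proof -
  note D = defining_pairD[OF pair]
  have main: "class_ideal A F 4 (wedge 3 1 (ext_d A 2 \<mu> + T) (\<iota> + (ext_d A 0 h + \<beta>))) = class_ideal A F 4 (wedge 3 1 T \<beta>)"
    if \<mu>: "\<mu> \<in> ideal A F 2" and h: "h \<in> forms A 0" and \<iota>: "\<iota> \<in> ideal A F 1" for \<mu> h \<iota>
  proof -
    let ?\<omega> = "ext_d A 2 \<mu> + T"
    have d\<mu>: "ext_d A 2 \<mu> \<in> ideal A F 3" by (rule ideal_ext_d[OF pair \<mu>]) simp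
    have \<omega>: "?\<omega> \<in> ideal A F 3" by (rule ideal_add[OF d\<mu> T])
    have \<omega>_closed: "ext_d A 3 ?\<omega> = 0"
      using ext_d_add[OF ideal_forms[OF d\<mu>] ideal_forms[OF T]] ext_d_twice[OF ideal_forms[OF \<mu>]] closed by simp
    have 1: "wedge 3 1 ?\<omega> \<iota> = 0" by (rule ideal_wedge_ideal[OF D(1) \<omega> \<iota>])
    have "ext_d A 3 (wedge 3 0 ?\<omega> h) = wedge 4 0 (ext_d A 3 ?\<omega>) h - wedge 3 1 ?\<omega> (ext_d A 0 h)"
      by (rule leibniz_odd[OF ideal_forms[OF \<omega>] h]) simp_all
    then have 2: "wedge 3 1 ?\<omega> (ext_d A 0 h) = - ext_d A 3 (wedge 3 0 ?\<omega> h)" unfolding \<omega>_closed by simp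
    have "ext_d A 3 (wedge 2 1 \<mu> \<beta>) = wedge 3 1 (ext_d A 2 \<mu>) \<beta> + wedge 2 2 \<mu> (ext_d A 1 \<beta>)"
      by (rule leibniz_even[OF ideal_forms[OF \<mu>] D(3)]) simp_all
    moreover have "wedge 2 2 \<mu> (ext_d A 1 \<beta>) = 0" by (rule ideal_wedge_ideal[OF D(1) \<mu> ext_d_beta_ideal[OF pair]])
    ultimately have 3: "wedge 3 1 (ext_d A 2 \<mu>) \<beta> = ext_d A 3 (wedge 2 1 \<mu> \<beta>)" by simp
    have W: "wedge 2 1 \<mu> \<beta> \<in> ideal A F 3" "wedge 3 0 ?\<omega> h \<in> ideal A F 3"
      by (rule ideal_wedge_left[OF \<mu> D(3)], simp) (rule ideal_wedge_left[OF \<omega> h], simp)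
    have "wedge 3 1 ?\<omega> (\<iota> + (ext_d A 0 h + \<beta>))
        = wedge 3 1 T \<beta> + (ext_d A 3 (wedge 2 1 \<mu> \<beta>) - ext_d A 3 (wedge 3 0 ?\<omega> h))"
      unfolding wedge_add_right 1 2 wedge_add_left[of 3 1 "ext_d A 2 \<mu>" T \<beta>] 3 by (simp add: algebra_simps)
    also have "\<dots> = wedge 3 1 T \<beta> + ext_d A 3 (wedge 2 1 \<mu> \<beta> - wedge 3 0 ?\<omega> h)"
      using ext_d_diff[OF ideal_forms[OF W(1)] ideal_forms[OF W(2)]] by simp
    finally show ?thesis
      using class_ideal_add_exact[OF _ ideal_diff[OF W], of 4 "wedge 3 1 T \<beta>"] by simp
  qed
  have "pairing A F 3 1 (class_ideal A F 3 T) (class_leaf A F 1 \<beta>) = (\<Union>\<mu>\<in>ideal A F 2. \<Union>h\<in>forms A 0. \<Union>\<iota>\<in>ideal A F 1.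
      class_ideal A F 4 (wedge 3 1 (ext_d A 2 \<mu> + T) (\<iota> + (ext_d A 0 h + \<beta>))))"
    unfolding pairing_def class_leaf_eq[OF pair] leaf_form_eq class_ideal_eq[of 3 2 F T, simplified]
    by (simp del: One_nat_def)
  also have "\<dots> = (\<Union>\<mu>\<in>ideal A F 2. \<Union>h\<in>forms A 0. \<Union>\<iota>\<in>ideal A F 1. class_ideal A F 4 (wedge 3 1 T \<beta>))"
    by (intro SUP_cong refl main)
  also have "\<dots> = class_ideal A F 4 (wedge 3 1 T \<beta>)"
    using ideal_zero zero_form by blast
  finally show ?thesis .
qed

section \<open>Characteristic classes\<close>

lemma GV_form_closed:
  assumes pair: "defining_pair A F \<alpha> \<beta>"
  shows "wedge 1 2 \<beta> (ext_d A 1 \<beta>) \<in> forms A 3" "ext_d A 3 (wedge 1 2 \<beta> (ext_d A 1 \<beta>)) = 0"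
proof -
  note D = defining_pairD[OF pair]
  have B: "ext_d A 1 \<beta> \<in> forms A 2" by (rule ext_d_in_forms[OF D(3)]) simp
  show "wedge 1 2 \<beta> (ext_d A 1 \<beta>) \<in> forms A 3" by (rule wedge_in_forms[OF D(3) B]) simp
  have "ext_d A 3 (wedge 1 2 \<beta> (ext_d A 1 \<beta>))
      = wedge 2 2 (ext_d A 1 \<beta>) (ext_d A 1 \<beta>) - wedge 1 3 \<beta> (ext_d A 2 (ext_d A 1 \<beta>))"
    by (rule leibniz_odd[OF D(3) B]) simp_all
  moreover have "ext_d A 2 (ext_d A 1 \<beta>) = 0" by (rule ext_d_twice[OF D(3)]) simp
  moreover have "wedge 2 2 (ext_d A 1 \<beta>) (ext_d A 1 \<beta>) = 0"
    by (rule ideal_wedge_ideal[OF D(1) ext_d_beta_ideal[OF pair] ext_d_beta_ideal[OF pair]])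
  ultimately show "ext_d A 3 (wedge 1 2 \<beta> (ext_d A 1 \<beta>)) = 0" by simp
qed

lemma GV_eq:
  assumes fol: "foliation A F" and pair: "defining_pair A F \<alpha> \<beta>"
  shows "GV A F = class_dR A 3 (wedge 1 2 \<beta> (ext_d A 1 \<beta>))"
  unfolding GV_def
proof (rule the_equality)
  fix X assume "\<exists>\<alpha>' \<beta>'. defining_pair A F \<alpha>' \<beta>' \<and> X = class_dR A 3 (wedge 1 2 \<beta>' (ext_d A 1 \<beta>'))"
  then obtain \<alpha>' \<beta>' where pair': "defining_pair A F \<alpha>' \<beta>'"
    and X: "X = class_dR A 3 (wedge 1 2 \<beta>' (ext_d A 1 \<beta>'))" by blast
  obtain \<mu> where "\<mu> \<in> forms A 2" "wedge 1 2 \<beta>' (ext_d A 1 \<beta>') = wedge 1 2 \<beta> (ext_d A 1 \<beta>) + ext_d A 2 \<mu>"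
    using GV_form_independent[OF fol pair pair'] by blast
  then show "X = class_dR A 3 (wedge 1 2 \<beta> (ext_d A 1 \<beta>))"
    using class_dR_add_exact[of 3 2 \<mu>] X by simp
qed (use pair in blast)

lemma T_class_independent:
  assumes J: "open J" "t \<in> J" and fol: "\<And>t. t \<in> J \<Longrightarrow> foliation A (\<F> t)"
    and fam: "defining_families A J \<F> \<alpha> \<beta>" and fam': "defining_families A J \<F> \<alpha>' \<beta>'"
  shows "T_class A \<F> \<beta>' t = T_class A \<F> \<beta> t"
proof -
  obtain \<mu> where "\<mu> \<in> ideal A (\<F> t) 2" "T_form A \<beta>' t = T_form A \<beta> t + ext_d A 2 \<mu>"
    using T_form_independent[OF J fol fam fam'] by blast
  then show ?thesis unfolding T_class_def using class_ideal_add_exact[of 3 2 \<mu>] by simp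
qed

text \<open>The family \<open>\<beta> \<and> d\<beta>\<close> represents the curve of Godbillon-Vey classes, since its classes do not
  depend on the choice of \<open>\<beta>\<close>.\<close>

lemma GV_has_class_derivative:
  assumes J: "open J" "t \<in> J" and fol: "\<And>t. t \<in> J \<Longrightarrow> foliation A (\<F> t)"
    and fam: "defining_families A J \<F> \<alpha> \<beta>"
  shows "\<exists>X\<in>carrier (H_dR A 3). has_class_derivative A 3 J (\<lambda>s. GV A (\<F> s)) X t \<and>
    ideal_to_dR A 3 (T_class A \<F> \<beta> t) = scale_dR A 3 (1/2) X"
proof -
  note D = defining_familiesD[OF fam]
  let ?\<omega> = "\<lambda>s. wedge 1 2 (\<beta> s) (ext_d A 1 (\<beta> s))"
  let ?X = "class_dR A 3 (form_dot ?\<omega> t)"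
  have \<omega>: "smooth_form_family A J 3 ?\<omega>"
    using family_wedge[OF J(1) D(2) family_ext_d_1[OF J(1) D(2)]] by (simp del: One_nat_def)
  have closed: "ext_d A 3 (?\<omega> s) = 0" if "s \<in> J" for s by (rule GV_form_closed(2)[OF D(3)[OF that]])
  have "ext_d A 3 (form_dot ?\<omega> t) = 0"
    using form_dot_ext_d[OF J \<omega>] form_dot_vanishing[OF J, of "\<lambda>s. ext_d A 3 (?\<omega> s)"] closed by simp
  then have X: "?X \<in> carrier (H_dR A 3)" by (rule class_dR_carrier[OF form_dot_forms[OF J(1) \<omega> J(2)]])
  have der: "has_class_derivative A 3 J (\<lambda>s. GV A (\<F> s)) ?X t"
    unfolding has_class_derivative_def
    by (rule exI[of _ ?\<omega>]) (use \<omega> closed GV_eq[OF fol D(3)] in blast)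
  have W: "wedge 1 1 (\<beta> t) (form_dot \<beta> t) \<in> forms A 2"
    by (rule wedge_in_forms[OF family_forms[OF D(2) J(2)] form_dot_forms[OF J(1) D(2) J(2)]]) simp
  have "form_scale (1/2) (form_dot ?\<omega> t)
      = T_form A \<beta> t + ext_d A 2 (form_scale (-1/2) (wedge 1 1 (\<beta> t) (form_dot \<beta> t)))"
    unfolding GV_form_dot[OF J D(2)] ext_d_scale[OF W]
    by (simp add: form_scale_def fun_eq_iff field_simps)
  then have "scale_dR A 3 (1/2) ?X = class_dR A 3 (T_form A \<beta> t)"
    using scale_dR_class[of 3 2] class_dR_add_exact[of 3 2, OF _ form_scale_forms[OF W]] by simp
  moreover have "ideal_to_dR A 3 (T_class A \<F> \<beta> t) = class_dR A 3 (T_form A \<beta> t)"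
    unfolding T_class_def by (rule ideal_to_dR_class) simp
  ultimately show ?thesis using X der by (intro bexI[of _ ?X] conjI) simp_all
qed

lemma T_reeb_pairing:
  assumes J: "open J" "t \<in> J" and fol: "foliation A (\<F> t)"
    and fam: "defining_families A J \<F> \<alpha> \<beta>"
  shows "pairing A (\<F> t) 3 1 (T_class A \<F> \<beta> t) (reeb_class A (\<F> t))
    = class_ideal A (\<F> t) 4 (wedge 3 1 (T_form A \<beta> t) (\<beta> t))"
  unfolding T_class_def reeb_class_eq[OF fol defining_familiesD(3)[OF fam J(2)]]
  by (rule pairing_class[OF defining_familiesD(3)[OF fam J(2)] T_form_ideal[OF J fam] T_form_closed[OF J fam]])

text \<open>\<open>T \<and> \<beta>\<close> is closed: \<open>T\<close> is, and \<open>T \<and> d\<beta>\<close> is a product of two elements of the ideal.\<close>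

lemma T_reeb_pairing_carrier:
  assumes J: "open J" "t \<in> J" and fol: "foliation A (\<F> t)"
    and fam: "defining_families A J \<F> \<alpha> \<beta>"
  shows "pairing A (\<F> t) 3 1 (T_class A \<F> \<beta> t) (reeb_class A (\<F> t)) \<in> carrier (H_ideal A (\<F> t) 4)"
  unfolding T_reeb_pairing[OF assms]
proof (rule class_ideal_carrier)
  note P = defining_familiesD(3)[OF fam J(2)]
  note T = T_form_ideal[OF J fam]
  note \<beta> = defining_pairD(3)[OF P]
  show "wedge 3 1 (T_form A \<beta> t) (\<beta> t) \<in> ideal A (\<F> t) 4" by (rule ideal_wedge_left[OF T \<beta>]) simp
  have "ext_d A 4 (wedge 3 1 (T_form A \<beta> t) (\<beta> t))
      = wedge 4 1 (ext_d A 3 (T_form A \<beta> t)) (\<beta> t) - wedge 3 2 (T_form A \<beta> t) (ext_d A 1 (\<beta> t))"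
    by (rule leibniz_odd[OF ideal_forms[OF T] \<beta>]) simp_all
  moreover have "wedge 3 2 (T_form A \<beta> t) (ext_d A 1 (\<beta> t)) = 0"
    by (rule ideal_wedge_ideal[OF defining_pairD(1)[OF P] T ext_d_beta_ideal[OF P]])
  ultimately show "ext_d A 4 (wedge 3 1 (T_form A \<beta> t) (\<beta> t)) = 0"
    using T_form_closed[OF J fam] by simp
qed

text \<open>\<open>(\<beta>' \<and> d\<beta>) \<and> \<beta> = \<beta>' \<and> (\<beta> \<and> d\<beta>)\<close>, as the two-form \<open>d\<beta>\<close> commutes with \<open>\<beta>\<close>; so the sign is \<open>+1\<close>.\<close>

lemma ideal_to_dR_T_reeb:
  assumes J: "open J" "t \<in> J" and fol: "foliation A (\<F> t)"
    and fam: "defining_families A J \<F> \<alpha> \<beta>"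
  shows "ideal_to_dR A 4 (pairing A (\<F> t) 3 1 (T_class A \<F> \<beta> t) (reeb_class A (\<F> t)))
    = class_dR A 4 (wedge 1 3 (form_dot \<beta> t) (wedge 1 2 (\<beta> t) (ext_d A 1 (\<beta> t))))"
proof -
  note D = defining_familiesD[OF fam]
  have \<beta>: "\<beta> t \<in> forms A 1" and b: "form_dot \<beta> t \<in> forms A 1"
    using family_forms[OF D(2) J(2)] form_dot_forms[OF J(1) D(2) J(2)] .
  have B: "ext_d A 1 (\<beta> t) \<in> forms A 2" by (rule ext_d_in_forms[OF \<beta>]) simp
  have "wedge 1 2 (\<beta> t) (ext_d A 1 (\<beta> t)) = wedge 2 1 (ext_d A 1 (\<beta> t)) (\<beta> t)"
    by (rule wedge_commute_even[OF \<beta> B]) simp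
  moreover have "wedge 3 1 (T_form A \<beta> t) (\<beta> t) = wedge 1 3 (form_dot \<beta> t) (wedge 2 1 (ext_d A 1 (\<beta> t)) (\<beta> t))"
    unfolding T_form_def by (rule wedge_assoc[OF b]) simp_all
  moreover have "ideal_to_dR A 4 (class_ideal A (\<F> t) 4 (wedge 3 1 (T_form A \<beta> t) (\<beta> t)))
      = class_dR A 4 (wedge 3 1 (T_form A \<beta> t) (\<beta> t))"
    by (rule ideal_to_dR_class) simp
  ultimately show ?thesis by (simp only: T_reeb_pairing[OF assms])
qed

text \<open>The left-hand side is defined by choosing \<open>\<alpha>\<close> and \<open>\<beta>\<close>. That all choices agree follows from the
  independence of the class of \<open>T\<close> and of the Reeb class, of which it is the product.\<close>

lemma TGV_eq:
  assumes J: "open J" "t \<in> J" and fol: "\<And>t. t \<in> J \<Longrightarrow> foliation A (\<F> t)"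
    and fam: "defining_families A J \<F> \<alpha> \<beta>"
  shows "TGV A J \<F> t = ideal_to_dR A 4 (pairing A (\<F> t) 3 1 (T_class A \<F> \<beta> t) (reeb_class A (\<F> t)))"
  unfolding TGV_def
proof (rule the_equality)
  show "\<exists>\<alpha>' \<beta>'. defining_families A J \<F> \<alpha>' \<beta>' \<and>
      ideal_to_dR A 4 (pairing A (\<F> t) 3 1 (T_class A \<F> \<beta> t) (reeb_class A (\<F> t)))
      = class_dR A 4 (wedge 1 3 (form_dot \<beta>' t) (wedge 1 2 (\<beta>' t) (ext_d A 1 (\<beta>' t))))"
    using fam ideal_to_dR_T_reeb[OF J fol[OF J(2)] fam] by blast
  fix X assume "\<exists>\<alpha>' \<beta>'. defining_families A J \<F> \<alpha>' \<beta>' \<and>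
      X = class_dR A 4 (wedge 1 3 (form_dot \<beta>' t) (wedge 1 2 (\<beta>' t) (ext_d A 1 (\<beta>' t))))"
  then obtain \<alpha>' \<beta>' where fam': "defining_families A J \<F> \<alpha>' \<beta>'"
    and X: "X = class_dR A 4 (wedge 1 3 (form_dot \<beta>' t) (wedge 1 2 (\<beta>' t) (ext_d A 1 (\<beta>' t))))" by blast
  have "T_class A \<F> \<beta>' t = T_class A \<F> \<beta> t" by (rule T_class_independent[OF J fol fam fam'])
  then show "X = ideal_to_dR A 4 (pairing A (\<F> t) 3 1 (T_class A \<F> \<beta> t) (reeb_class A (\<F> t)))"
    unfolding X ideal_to_dR_T_reeb[OF J fol[OF J(2)] fam', symmetric] by (simp only:)
qed

end

theorem theorem11:
  fixes A :: "('m::{t2_space,second_countable_topology}, 'e::euclidean_space) atlas"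
    and J :: "real set"
    and \<F> :: "real \<Rightarrow> 'm foliation"
    and \<alpha> \<beta> :: "real \<Rightarrow> ('m, 'e) form"
  assumes "smooth_atlas A"
    and "open J" and "is_interval J"
    and "foliation_family A J \<F>"
    and "defining_families A J \<F> \<alpha> \<beta>"
  shows "(\<forall>t\<in>J. T_form A \<beta> t \<in> ideal A (\<F> t) 3
           \<and> ext_d A 3 (T_form A \<beta> t) = 0
           \<and> T_class A \<F> \<beta> t \<in> carrier (H_ideal A (\<F> t) 3)
           \<and> (\<forall>\<alpha>' \<beta>'. defining_families A J \<F> \<alpha>' \<beta>' \<longrightarrow>
                T_class A \<F> \<beta>' t = T_class A \<F> \<beta> t)
           \<and> (\<exists>X \<in> carrier (H_dR A 3).
                has_class_derivative A 3 J (\<lambda>s. GV A (\<F> s)) X t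
                \<and> ideal_to_dR A 3 (T_class A \<F> \<beta> t) = scale_dR A 3 (1/2) X))
       \<and> (\<exists>\<epsilon>\<in>{1, -1}. \<forall>t\<in>J.
            reeb_class A (\<F> t) \<in> carrier (H_leaf A (\<F> t) 1)
            \<and> pairing A (\<F> t) 3 1 (T_class A \<F> \<beta> t) (reeb_class A (\<F> t))
                \<in> carrier (H_ideal A (\<F> t) 4)
            \<and> ideal_to_dR A 4 (pairing A (\<F> t) 3 1 (T_class A \<F> \<beta> t) (reeb_class A (\<F> t)))
                = scale_dR A 4 \<epsilon> (TGV A J \<F> t))"
proof -
  interpret manifold A by unfold_locales fact
  note J = \<open>open J\<close> and fam = \<open>defining_families A J \<F> \<alpha> \<beta>\<close>
  have fol: "foliation A (\<F> t)" if "t \<in> J" for t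
    using \<open>foliation_family A J \<F>\<close> that unfolding foliation_family_def by blast
  have TGV: "ideal_to_dR A 4 (pairing A (\<F> t) 3 1 (T_class A \<F> \<beta> t) (reeb_class A (\<F> t)))
      = scale_dR A 4 1 (TGV A J \<F> t)" if t: "t \<in> J" for t
  proof -
    have eq: "TGV A J \<F> t = ideal_to_dR A 4 (pairing A (\<F> t) 3 1 (T_class A \<F> \<beta> t) (reeb_class A (\<F> t)))"
      by (rule TGV_eq[OF J t fol fam])
    show ?thesis
      unfolding eq ideal_to_dR_T_reeb[OF J t fol[OF t] fam] by (simp add: scale_dR_class[of 4 3])
  qed
  show ?thesis
  proof (intro conjI ballI bexI[of _ "1::real"] allI impI)
    fix t assume t: "t \<in> J"
    show "T_form A \<beta> t \<in> ideal A (\<F> t) 3" by (rule T_form_ideal[OF J t fam])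
    show "ext_d A 3 (T_form A \<beta> t) = 0" by (rule T_form_closed[OF J t fam])
    show "T_class A \<F> \<beta> t \<in> carrier (H_ideal A (\<F> t) 3)"
      unfolding T_class_def by (rule class_ideal_carrier[OF T_form_ideal[OF J t fam] T_form_closed[OF J t fam]])
    show "T_class A \<F> \<beta>' t = T_class A \<F> \<beta> t" if "defining_families A J \<F> \<alpha>' \<beta>'" for \<alpha>' \<beta>'
      by (rule T_class_independent[OF J t fol fam that])
    show "\<exists>X\<in>carrier (H_dR A 3). has_class_derivative A 3 J (\<lambda>s. GV A (\<F> s)) X t
        \<and> ideal_to_dR A 3 (T_class A \<F> \<beta> t) = scale_dR A 3 (1/2) X"
      by (rule GV_has_class_derivative[OF J t fol fam])
    show "reeb_class A (\<F> t) \<in> carrier (H_leaf A (\<F> t) 1)"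
      by (rule reeb_class_carrier[OF fol[OF t] defining_familiesD(3)[OF fam t]])
    show "pairing A (\<F> t) 3 1 (T_class A \<F> \<beta> t) (reeb_class A (\<F> t)) \<in> carrier (H_ideal A (\<F> t) 4)"
      by (rule T_reeb_pairing_carrier[OF J t fol[OF t] fam])
    show "ideal_to_dR A 4 (pairing A (\<F> t) 3 1 (T_class A \<F> \<beta> t) (reeb_class A (\<F> t)))
        = scale_dR A 4 1 (TGV A J \<F> t)"
      by (rule TGV[OF t])
  qed simp
qed

end
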